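(* Consider the following two families of models. (I) $k\in\{1,2,3\}$ and $\mathbf q=(1,0,0,\dots)$ (constellations with $k\le 3$). Put $L_i=-p_i^*+t\,M^{(k,1)}_i$ for $i\ge 1$ and let $\tau\in\mathbb{Q}(b)[u_1,\dots,u_k][\mathbf p][[t]]$ be the unique formal power series in $t$ with $[t^0]\tau=1$ and $$\frac{\partial \tau}{\partial t}=\sum_{i\ge1}p_iM_i^{(k,1)}\,\tau .$$ (II) $k=1$ (write $u=u_1$) and $\mathbf q=(q_1,q_2,q_3,0,0,\dots)$ with $q_1,q_2,q_3$ indeterminates (bipartite maps with black vertices of degree at most 3). Put $L_i=-p_i^*+\sum_{m=1}^3 q_mt^mM^{(1,m)}_i$ for $i\ge1$ and let $\tau\in\mathbb{Q}(b)[u,q_1,q_2,q_3][\mathbf p][[t]]$ be the unique formal power series in $t$ with $[t^0]\tau=1$ and $$\frac{\partial\tau}{\partial t}=\sum_{m=1}^3 q_mt^{m-1}\sum_{i\ge1}p_iM^{(1,m)}_i\,\tau .$$ In both families, $-L_i=i\frac{\partial}{\partial p_i}-t^rM_i$ with $r=1$, where $M_i$ is a polynomial in $t$ whose coefficients are explicit differential operators in the variables $p_j$, and $\tau$ satisfies the differential constraints $$L_i\,\tau=0\qquad\text{for all } i\ge1,$$ and $\tau$ is determined by these constraints: it is the only formal power series $Z$ in $t$ (over the same coefficient ring) such that $[t^0]Z=1$, $[t^n]Z$ is a homogeneous polynomial of degree $n$ in the $p_i$'s (with $\deg p_i=i$) for every $n\ge0$, and $L_iZ=0$ for all $i\ge1$.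 Moreover the constraints satisfy $[L_i,L_j]=t\sum_{l\ge1}D_{ij}^{l}L_l$ for all $i,j\geq 1$, with explicit differential operators $D_{ij}^l$ (polynomial in $t$, with coefficients differential operators in the $p_n$'s). Explicitly, with $\mu=\min(i,j)$ and $M=\max(i,j)$, for all $i,j\ge1$: Family (I), $k=1$: $[L_i,L_j]=0$. Family (I), $k=2$ (bipartite maps): $[L_i,L_j]=t(i-j)L_{i+j-1}$. Family (I), $k=3$ (3-constellations): $$\begin{aligned}[L_i,L_j]={}&2t(i-j)\sum_{n\ge1}p_nL_{i+j+n-1}+tb(i-j)(i+j-2)L_{i+j-1}\\&+(1+b)t\Bigl(3(i-j)\sum_{n=1}^{\mu-1}+\operatorname{sgn}(i-j)\sum_{n=\mu}^{M-1}(2M-2n-\mu-1)\Bigr)p_n^*L_{i+j-1-n}\\&+t(u_1+u_2+u_3)(i-j)L_{i+j-1}.\end{aligned}$$ Family (II) (bipartite maps with black vertices of degree at most 3): $$\begin{aligned}[L_i,L_j]={}&2t^3q_3(i-j)\sum_{n\ge1}p_nL_{i+j+n-3}+t^3q_3\,b(i-j)(i+j-3)L_{i+j-3}\\&+(1+b)t^3q_3\Bigl(3(i-j)\sum_{n=1}^{\mu-2}+\operatorname{sgn}(i-j)\sum_{n=\mu-1}^{M-2}(2M-2n-\mu-3)\Bigr)p_n^*L_{i+j-3-n}\\&+3t^3q_3\,u\,(i-j)L_{i+j-3}+t^2q_2(i-j)L_{i+j-2}.\end{aligned}$$ Here a summation sign followed by a coefficient in the large parentheses is applied to the summand $p_n^*L_{\,\cdot\,-n}$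 written to their right, and by convention $p_n^*=0$ and $L_n=0$ for $n\le0$.
   Context: Notation. $b$ is a formal parameter, $u_1,\dots,u_k$ are indeterminates, $\mathbf p=(p_1,p_2,\dots)$ and $\mathbf y=(y_0,y_1,y_2,\dots)$ are infinite sequences of indeterminates. $p_i^*=i\,\partial/\partial p_i$ for $i\ge1$ and $p_i^*=0$ for $i\le0$. $[A,B]=AB-BA$. $\operatorname{sgn}(0)=0$. Let $$\Lambda_Y=(1+b)\sum_{i,j\ge1}i\,y_{i+j-1}\frac{\partial^2}{\partial p_i\partial y_{j-1}}+\sum_{i,j\ge1}p_iy_{j-1}\frac{\partial}{\partial y_{i+j-1}}+b\sum_{i\ge1}i\,y_i\frac{\partial}{\partial y_i},\qquad Y_+=\sum_{j\ge1}y_j\frac{\partial}{\partial y_{j-1}},$$ acting on expressions $\sum_{a\ge0}y_aF_a$ that are linear in $\mathbf y$, with $F_a$ polynomials in $\mathbf p$; write $[y_a]\sum_c y_cF_c=F_a$. For $k,m,i\ge1$, $M_i^{(k,m)}$ is the differential operator in $\mathbf p$ (possibly an infinite sum, but finite when applied to a polynomial) given by $$M_i^{(k,m)}F=[y_i]\Bigl(Y_+\prod_{l=1}^k(\Lambda_Y+u_l)\Bigr)^m\frac{y_0F}{1+b}$$ for polynomials $F$ in $\mathbf p$ (extended coefficientwise in $t$). Infinite sums such as $\sum_n p_nL_{n+c}$ are finite when applied to a polynomial in $\mathbf p$. Interpretation (not needed for the precise statement): by a theorem of Chapuy and Dołęga, $\tau$ is the generating function of (not necessarily connected) labeled non-oriented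 $k$-constellations counted with $b$-weights, where $t$ counts the size, $p_i$ the faces of degree $i$, $q_m$ the vertices of color $0$ of degree $m$, and $u_l$ the vertices of color $l$.
   Formalization: In Family (II) the coefficient 3(i-j) of t^3 q_3 u L_{i+j-3} is false when min(i,j)=1 and max(i,j)>=3 (e.g. i=3, j=1 on p_1); for min(i,j)=1 it is replaced by sgn(i-j)(2max(i,j)-4), all else as printed. *)

theory Defs
  imports
    "HOL-Library.Poly_Mapping"
    "HOL-Computational_Algebra.Computational_Algebra"
begin

text \<open>
  \<open>'v coeff\<close> is the polynomial ring over \<open>\<rat>(b)\<close> whose indeterminates are the elements of the
  type \<open>'v\<close>, and \<open>'v ppoly\<close> is the polynomial ring over it in \<open>p\<^sub>1, p\<^sub>2, \<dots>\<close>.  The indeterminate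
  \<open>p\<^sub>i\<close> (\<open>i \<ge> 1\<close>) is variable number \<open>i - 1\<close>, so that there is no spurious \<open>p\<^sub>0\<close>.
  An element \<open>G\<close> of \<open>'v yexpr\<close> is the expression \<open>\<Sum>\<^sub>a y\<^sub>a F\<^sub>a\<close> with \<open>F\<^sub>a = lookup G a\<close>.
\<close>

type_synonym 'v coeff = "('v \<Rightarrow>\<^sub>0 nat) \<Rightarrow>\<^sub>0 rat poly fract"
type_synonym 'v ppoly = "(nat \<Rightarrow>\<^sub>0 nat) \<Rightarrow>\<^sub>0 'v coeff"
type_synonym 'v yexpr = "nat \<Rightarrow>\<^sub>0 'v ppoly"

definition b_fract :: "rat poly fract" where
  "b_fract = Fract [:0, 1:] 1"

definition rat_const :: "rat poly fract \<Rightarrow> 'v coeff" where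
  "rat_const c = Poly_Mapping.single 0 c"

definition indet :: "'v \<Rightarrow> 'v coeff" where
  "indet x = Poly_Mapping.single (Poly_Mapping.single x 1) 1"

definition coeff_const :: "'v coeff \<Rightarrow> 'v ppoly" where
  "coeff_const c = Poly_Mapping.single 0 c"

abbreviation b_const :: "'v ppoly" where
  "b_const \<equiv> coeff_const (rat_const b_fract)"

definition p_var :: "nat \<Rightarrow> 'v ppoly" where
  "p_var i = Poly_Mapping.single (Poly_Mapping.single (i - 1) 1) 1"

text \<open>\<open>p_deriv i\<close> is \<open>\<partial>/\<partial>p\<^sub>i\<close>, for \<open>i \<ge> 1\<close>.\<close>

definition p_deriv :: "nat \<Rightarrow> 'v ppoly \<Rightarrow> 'v ppoly" where
  "p_deriv i F = (\<Sum>m\<in>Poly_Mapping.keys F.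
     Poly_Mapping.single (m - Poly_Mapping.single (i - 1) 1)
       (of_nat (Poly_Mapping.lookup m (i - 1)) * Poly_Mapping.lookup F m))"

text \<open>
  Infinite sums of operators are evaluated with \<open>sum'\<close>, the sum over the indices whose term is
  nonzero.
\<close>

text \<open>
  \<open>ydy a c D\<close> is the operator \<open>y\<^sub>a D \<partial>/\<partial>y\<^sub>c\<close> on expressions linear in the \<open>y\<close>'s,
  where \<open>D\<close> acts on the \<open>p\<close>'s only.
\<close>

definition ydy :: "nat \<Rightarrow> nat \<Rightarrow> ('v ppoly \<Rightarrow> 'v ppoly) \<Rightarrow> 'v yexpr \<Rightarrow> 'v yexpr" where
  "ydy a c D G = Poly_Mapping.single a (D (Poly_Mapping.lookup G c))"

definition Lambda_Y :: "'v yexpr \<Rightarrow> 'v yexpr" where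
  "Lambda_Y G =
     sum' (\<lambda>(i, j). ydy (i + j - 1) (j - 1) (\<lambda>F. (1 + b_const) * of_nat i * p_deriv i F) G)
       ({1..} \<times> {1..})
   + sum' (\<lambda>(i, j). ydy (j - 1) (i + j - 1) (\<lambda>F. p_var i * F) G) ({1..} \<times> {1..})
   + sum' (\<lambda>i. ydy i i (\<lambda>F. b_const * of_nat i * F) G) {1..}"

definition Y_plus :: "'v yexpr \<Rightarrow> 'v yexpr" where
  "Y_plus G = sum' (\<lambda>j. ydy j (j - 1) (\<lambda>F. F) G) {1..}"

definition Lambda_Y_shift :: "'v coeff \<Rightarrow> 'v yexpr \<Rightarrow> 'v yexpr" where
  "Lambda_Y_shift c G = Lambda_Y G + Poly_Mapping.map (\<lambda>F. coeff_const c * F) G"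

text \<open>The composition \<open>(\<Lambda>\<^sub>Y + u\<^sub>1) \<circ> \<dots> \<circ> (\<Lambda>\<^sub>Y + u\<^sub>k)\<close>; the factors commute.\<close>

definition Lambda_Y_prod :: "nat \<Rightarrow> (nat \<Rightarrow> 'v coeff) \<Rightarrow> 'v yexpr \<Rightarrow> 'v yexpr" where
  "Lambda_Y_prod k u G = foldr (\<lambda>l. Lambda_Y_shift (u l)) [1..<k + 1] G"

definition M_op ::
    "nat \<Rightarrow> nat \<Rightarrow> (nat \<Rightarrow> 'v coeff) \<Rightarrow> nat \<Rightarrow> 'v ppoly \<Rightarrow> 'v ppoly" where
  "M_op k m u i F = Poly_Mapping.lookup
     (((Y_plus \<circ> Lambda_Y_prod k u) ^^ m)
        (Poly_Mapping.single 0 (coeff_const (rat_const (inverse (1 + b_fract))) * F))) i"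

text \<open>Power series in \<open>t\<close> over \<open>'v ppoly\<close>; here \<open>t\<close> is \<open>fps_X\<close>.\<close>

definition coeffwise :: "('v ppoly \<Rightarrow> 'v ppoly) \<Rightarrow> 'v ppoly fps \<Rightarrow> 'v ppoly fps" where
  "coeffwise A Z = Abs_fps (\<lambda>n. A (fps_nth Z n))"

text \<open>Infinite sums of operators applied to a series are evaluated coefficientwise in \<open>t\<close>.\<close>

definition fps_sum :: "('i \<Rightarrow> 'v ppoly fps) \<Rightarrow> 'i set \<Rightarrow> 'v ppoly fps" where
  "fps_sum f I = Abs_fps (\<lambda>n. sum' (\<lambda>i. fps_nth (f i) n) I)"

definition coeff_fps :: "'v coeff \<Rightarrow> 'v ppoly fps" where
  "coeff_fps c = fps_const (coeff_const c)"

definition b_fps :: "'v ppoly fps" where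
  "b_fps = coeff_fps (rat_const b_fract)"

definition p_mult :: "int \<Rightarrow> 'v ppoly fps \<Rightarrow> 'v ppoly fps" where
  "p_mult i Z = fps_const (p_var (nat i)) * Z"

definition p_star :: "int \<Rightarrow> 'v ppoly fps \<Rightarrow> 'v ppoly fps" where
  "p_star i Z = (if i \<ge> 1 then of_int i * coeffwise (p_deriv (nat i)) Z else 0)"

text \<open>
  The models: \<open>d\<close> is the largest \<open>m\<close> with \<open>q\<^sub>m \<noteq> 0\<close>, and the values of \<open>u\<close> and \<open>q\<close>
  outside \<open>{1..k}\<close> and \<open>{1..d}\<close> are irrelevant.  The bijection \<open>v\<close> says that the coefficient
  ring is exactly \<open>\<rat>(b)[u\<^sub>1,\<dots>,u\<^sub>k]\<close>, respectively \<open>\<rat>(b)[u,q\<^sub>1,q\<^sub>2,q\<^sub>3]\<close>.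
\<close>

definition family_I ::
    "nat \<Rightarrow> nat \<Rightarrow> (nat \<Rightarrow> 'v coeff) \<Rightarrow> (nat \<Rightarrow> 'v coeff) \<Rightarrow> bool" where
  "family_I k d u q \<longleftrightarrow> k \<in> {1, 2, 3} \<and> d = 1 \<and> q 1 = 1 \<and>
     (\<exists>v. bij_betw v {1..k} (UNIV :: 'v set) \<and> (\<forall>l\<in>{1..k}. u l = indet (v l)))"

definition family_II ::
    "nat \<Rightarrow> nat \<Rightarrow> (nat \<Rightarrow> 'v coeff) \<Rightarrow> (nat \<Rightarrow> 'v coeff) \<Rightarrow> bool" where
  "family_II k d u q \<longleftrightarrow> k = 1 \<and> d = 3 \<and>
     (\<exists>v. bij_betw v {0..3::nat} (UNIV :: 'v set) \<and> u 1 = indet (v 0) \<and>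
        (\<forall>m\<in>{1..3}. q m = indet (v m)))"

definition L_op :: "nat \<Rightarrow> nat \<Rightarrow> (nat \<Rightarrow> 'v coeff) \<Rightarrow> (nat \<Rightarrow> 'v coeff) \<Rightarrow> int \<Rightarrow>
    'v ppoly fps \<Rightarrow> 'v ppoly fps" where
  "L_op k d u q i Z =
     (if i \<ge> 1
      then - p_star i Z
           + (\<Sum>m=1..d. coeff_fps (q m) * fps_X ^ m * coeffwise (M_op k m u (nat i)) Z)
      else 0)"

definition evolution ::
    "nat \<Rightarrow> nat \<Rightarrow> (nat \<Rightarrow> 'v coeff) \<Rightarrow> (nat \<Rightarrow> 'v coeff) \<Rightarrow> 'v ppoly fps \<Rightarrow> bool" where
  "evolution k d u q \<tau> \<longleftrightarrow> fps_nth \<tau> 0 = 1 \<and>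
     fps_deriv \<tau> = (\<Sum>m=1..d. coeff_fps (q m) * fps_X ^ (m - 1) *
       coeffwise (\<lambda>F. sum' (\<lambda>i. p_var i * M_op k m u i F) {1..}) \<tau>)"

text \<open>Homogeneity for \<open>deg p\<^sub>i = i\<close>; variable number \<open>x\<close> is \<open>p\<^bsub>x+1\<^esub>\<close>.\<close>

definition homogeneous :: "nat \<Rightarrow> 'v ppoly \<Rightarrow> bool" where
  "homogeneous n F \<longleftrightarrow> (\<forall>m\<in>Poly_Mapping.keys F.
     (\<Sum>x\<in>Poly_Mapping.keys m. (x + 1) * Poly_Mapping.lookup m x) = n)"

definition constraints ::
    "nat \<Rightarrow> nat \<Rightarrow> (nat \<Rightarrow> 'v coeff) \<Rightarrow> (nat \<Rightarrow> 'v coeff) \<Rightarrow> 'v ppoly fps \<Rightarrow> bool" where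
  "constraints k d u q Z \<longleftrightarrow> fps_nth Z 0 = 1 \<and> (\<forall>n. homogeneous n (fps_nth Z n)) \<and>
     (\<forall>i\<ge>1. L_op k d u q i Z = 0)"

text \<open>Differential operators with polynomial coefficients in the \<open>p\<^sub>i\<close>.\<close>

inductive_set weyl :: "('v ppoly \<Rightarrow> 'v ppoly) set" where
  mult: "(\<lambda>F. G * F) \<in> weyl"
| deriv: "i \<ge> 1 \<Longrightarrow> p_deriv i \<in> weyl"
| add: "A \<in> weyl \<Longrightarrow> B \<in> weyl \<Longrightarrow> (\<lambda>F. A F + B F) \<in> weyl"
| comp: "A \<in> weyl \<Longrightarrow> B \<in> weyl \<Longrightarrow> A \<circ> B \<in> weyl"

text \<open>Infinite sums of these that are finite when applied to a polynomial.\<close>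

definition weyl_inf :: "('v ppoly \<Rightarrow> 'v ppoly) set" where
  "weyl_inf = {A. \<exists>W. (\<forall>n::nat. W n \<in> weyl) \<and>
     (\<forall>F. finite {n. W n F \<noteq> 0} \<and> A F = sum' (\<lambda>n. W n F) UNIV)}"

text \<open>Polynomials in \<open>t\<close> with coefficients in a set \<open>S\<close> of operators.\<close>

definition t_polynomials ::
    "('v ppoly \<Rightarrow> 'v ppoly) set \<Rightarrow> ('v ppoly fps \<Rightarrow> 'v ppoly fps) set" where
  "t_polynomials S = {D. \<exists>N A. (\<forall>m\<le>N. A m \<in> S) \<and>
     (\<forall>Z. D Z = (\<Sum>m\<le>(N::nat). fps_X ^ m * coeffwise (A m) Z))}"

definition commutator ::
    "('v ppoly fps \<Rightarrow> 'v ppoly fps) \<Rightarrow> ('v ppoly fps \<Rightarrow> 'v ppoly fps) \<Rightarrow>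
     'v ppoly fps \<Rightarrow> 'v ppoly fps" where
  "commutator A B Z = A (B Z) - B (A Z)"

text \<open>
  The coefficient of \<open>t\<^sup>3 q\<^sub>3 u L\<^bsub>i+j-3\<^esub>\<close> in \<open>[L\<^sub>i, L\<^sub>j]\<close> for bipartite maps with black vertices of
  degree at most 3.  It is \<open>3 (i - j)\<close> only for \<open>min i j \<ge> 2\<close> (or when \<open>L\<^bsub>i+j-3\<^esub> = 0\<close> or \<open>i = j\<close>).
  For \<open>min i j = 1\<close> it is the \<open>n = 0\<close> coefficient of the sum with summand
  \<open>sgn (i - j) (2 M - 2 n - \<mu> - 3)\<close>.  For instance the constant term of the coefficient of
  \<open>t\<^sup>3 q\<^sub>3\<close> in \<open>[L\<^sub>3, L\<^sub>1] p\<^sub>1\<close> is \<open>- 2 b - 2 u\<close>, whereas \<open>3 (i - j)\<close> would give \<open>- 2 b - 6 u\<close>.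
\<close>

definition u_factor :: "int \<Rightarrow> int \<Rightarrow> int" where
  "u_factor i j = (if min i j = 1 then sgn (i - j) * (2 * max i j - 4) else 3 * (i - j))"

end

theory Submission
  imports Defs
begin

text \<open>
  The \<open>y\<close>-coefficients of \<open>(\<Lambda>\<^sub>Y + u)G\<close> are \<open>\<Sum>\<^sub>c J\<^sub>i\<^sub>-\<^sub>c G\<^sub>c + b i G\<^sub>i\<close> for a Heisenberg current
  \<open>J\<close>, \<open>[J\<^sub>m, J\<^sub>n] = (1 + b) m \<delta>\<^sub>m\<^sub>+\<^sub>n\<^sub>,\<^sub>0\<close>, whose modes are \<open>(1 + b) p\<^sub>n\<^sup>*\<close>, multiplication by \<open>p\<^sub>n\<close> and the
  constant \<open>J\<^sub>0 = u\<close>.  Hence both families of operators are combinations of the coefficients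
  \<open>v\<^sub>1, v\<^sub>2, v\<^sub>3\<close> of the first three iterates of one recursion, with an index shift \<open>e = 0\<close> for
  constellations and \<open>e = 1\<close> for bipartite maps, and \<open>L\<^sub>i + p\<^sub>i\<^sup>*\<close> is such a combination.
  By bilinearity the brackets of the \<open>L\<^sub>i\<close> reduce to those of the \<open>v\<^sub>l\<close>, which
  are computed by peeling off one current at a time.  The hard one is \<open>[v\<^sub>3, v\<^sub>3]\<close>: minus its
  expected value, it is a sum of \<open>\<kappa>\<^sub>c(m) J\<^sub>m J\<^sub>k\<^sub>-\<^sub>m v\<^sub>2\<^sub>,\<^sub>c\<close> in which, after a suitable symmetrisation of the terms
  \<open>v\<^sub>2 v\<^sub>2\<close>, the weight \<open>\<kappa>\<^sub>c\<close> is antisymmetric under \<open>m \<leftrightarrow> k - m\<close>.  Only central terms are left, and they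
  cancel by a polynomial identity.

  For \<open>\<tau>\<close>, let \<open>z\<^sub>i\<close> be the coefficient of \<open>L\<^sub>i \<tau>\<close> at the lowest order in \<open>t\<close> where some \<open>L\<^sub>i \<tau>\<close> does not
  vanish.  The evolution equation and homogeneity give \<open>\<Sum> p\<^sub>i z\<^sub>i = 0\<close>, and the brackets give
  \<open>p\<^sub>j\<^sup>* z\<^sub>i = p\<^sub>i\<^sup>* z\<^sub>j\<close>.  Applying \<open>p\<^sub>j\<^sup>*\<close> to the former yields \<open>(j + E) z\<^sub>j = 0\<close> with \<open>E\<close> the Euler operator, so
  \<open>z\<^sub>j = 0\<close>.
\<close>

text \<open>The obstacle is the cut of the \<open>y\<close>-indices at 0. Because of it, moving a
  mode through \<open>v2\<close> or \<open>v3\<close> leaves boundary terms supported on half lines,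
  and a single mixed bracket such as \<open>[v3 i, v2 j]\<close> carries weights with no symmetry in
  \<open>i\<close> and \<open>j\<close>. The brackets are therefore computed in the combinations
  \<open>[v3 i, v2 j] + [v2 i, v3 j]\<close> that occur in \<open>[L i, L j]\<close>; these have the
  expected value. The computation is done for \<open>(1 + b) * L i\<close>: the derivative part is
  then itself a mode, the prefactor \<open>1 / (1 + b)\<close> of \<open>y_0 F\<close> disappears,
  and every bracket produces one factor \<open>s = 1 + b\<close>, cancelled at the end. Antisymmetry
  is always exploited by adding an expression to its own reflection, so it determines
  \<open>x + x\<close> only; hence the hypothesis \<open>torsion_free\<close>. The mode
  \<open>J 0\<close> is neither a \<open>p_n\<close> nor a \<open>p_n^*\<close>. Its weight in the
  cubic bracket is \<open>structure_coeff\<close> at 0, which is the origin of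
  \<open>u_factor\<close>. Uniqueness of \<open>Z\<close> uses the argument for
  \<open>\<tau>\<close> backwards: for homogeneous \<open>Z\<close>, the sum of all
  \<open>p_i * L i Z\<close> is the evolution equation, so the constraints imply it, and its
  solution is unique by recursion on the order in \<open>t\<close>.\<close>

abbreviation "lookup \<equiv> Poly_Mapping.lookup"
abbreviation "keys \<equiv> Poly_Mapping.keys"

section \<open>Commutators in a Heisenberg algebra\<close>

lemma Sum_any_reflect: "Sum_any (\<lambda>x::int. g (k - x)) = Sum_any g"
proof (rule Sum_any.reindex_cong[symmetric, where l = "\<lambda>x. k - x"])
  show "bij (\<lambda>x. k - x)"
    by (rule bij_betw_byWitness[where f' = "\<lambda>x. k - x"]) auto
qed (auto simp: fun_eq_iff)

text \<open>These are the coefficient sequences of expressions linear in the \<open>y_a\<close>,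
  extended by 0 to negative indices so that index shifts need no side conditions.\<close>

definition fin_family :: "(int \<Rightarrow> 'a::zero) \<Rightarrow> bool" where
  "fin_family g \<longleftrightarrow> (\<forall>c<0. g c = 0) \<and> (\<exists>B. \<forall>c>B. g c = 0)"

abbreviation supported :: "int \<Rightarrow> (int \<Rightarrow> 'a::zero) \<Rightarrow> bool" where
  "supported C g \<equiv> \<forall>c. c \<notin> {0..C} \<longrightarrow> g c = 0"

text \<open>The bound can be taken above any given \<open>B0\<close>, so that several families, or a
  family and the centre of a reflection, share one index range.\<close>

lemma fin_familyE:
  assumes "fin_family g"
  obtains B where "B0 \<le> B" "supported B g"
proof -
  from assms obtain B where "\<forall>c>B. g c = 0" "\<forall>c<0. g c = 0"
    by (auto simp: fin_family_def)
  then have "supported (max B B0) g" by auto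
  then show ?thesis using that[of "max B B0"] by auto
qed

lemma fin_familyE0:
  assumes "fin_family g"
  obtains B where "supported B g"
  using fin_familyE[OF assms] by metis

lemma fin_familyI: "(\<And>c. c < 0 \<Longrightarrow> g c = 0) \<Longrightarrow> (\<And>c. c > B \<Longrightarrow> g c = 0) \<Longrightarrow> fin_family g"
  by (auto simp: fin_family_def)

lemma fin_familyI': "supported B g \<Longrightarrow> fin_family g"
  by (rule fin_familyI[of _ B]) auto

lemma fin_family_neg: "fin_family g \<Longrightarrow> c < 0 \<Longrightarrow> g c = 0"
  by (auto simp: fin_family_def)

lemma fin_family_map: "fin_family g \<Longrightarrow> (\<And>c. g c = 0 \<Longrightarrow> h c = 0) \<Longrightarrow> fin_family h"
  unfolding fin_family_def by blast

lemma fin_family_sum: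
  "(\<And>x. x \<in> S \<Longrightarrow> fin_family (g x)) \<Longrightarrow> fin_family (\<lambda>a. \<Sum>x\<in>S. g x a)"
proof (induction S rule: infinite_finite_induct)
  case (insert x F)
  obtain B where B: "supported B (g x)"
    by (rule fin_familyE0[OF insert.prems[of x]]) auto
  from insert have "fin_family (\<lambda>a. \<Sum>x\<in>F. g x a)" by auto
  then obtain B' where "B \<le> B'" "supported B' (\<lambda>c. \<Sum>x\<in>F. g x c)"
    by (rule fin_familyE[where ?B0.0 = B])
  then show ?case
    using B insert.hyps by (intro fin_familyI'[of B']) auto
qed (auto simp: fin_family_def)

lemma fin_family_add: "fin_family g \<Longrightarrow> fin_family h \<Longrightarrow> fin_family (\<lambda>c. g c + h c :: 'a::monoid_add)"
proof -
  assume g: "fin_family g" and h: "fin_family h"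
  from g obtain B where B: "supported B g" by (rule fin_familyE0)
  from h obtain B' where "B \<le> B'" "supported B' h" by (rule fin_familyE[where ?B0.0 = B])
  with B show ?thesis by (intro fin_familyI'[of B']) auto
qed

lemma fin_family_shift: "fin_family f \<Longrightarrow> fin_family (\<lambda>a. if 0 \<le> a then f (a + r) else 0)"
proof -
  assume "fin_family f"
  then obtain B where "supported B f" by (rule fin_familyE0)
  then show ?thesis by (intro fin_familyI[where B = "B - r"]) auto
qed

section \<open>Heisenberg modes and the recursion on coefficient families\<close>

locale heisenberg =
  fixes J :: "int \<Rightarrow> 'a::comm_ring_1 \<Rightarrow> 'a" and K :: "'a set" and s b :: 'a and e :: int
  assumes J_add: "J m (x + y) = J m x + J m y"
    and J_scale: "k \<in> K \<Longrightarrow> J m (k * x) = k * J m x"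
    and s_K: "s \<in> K" and b_K: "b \<in> K"
    and J_comm: "J m (J n x) = J n (J m x) + (if m + n = 0 then of_int m * (s * x) else 0)"
    and J_fin: "\<exists>R. \<forall>m>R. J m x = 0"
    and e: "e = 0 \<or> e = 1"
    and torsion_free: "x + x = (0::'a) \<Longrightarrow> x = 0"
begin

lemma J_zero [simp]: "J m 0 = 0"
  using J_add[of m 0 0] by simp

lemma J_minus: "J m (- x) = - J m x"
  using J_add[of m x "- x"] by (simp add: eq_neg_iff_add_eq_0 add.commute)

lemma J_diff: "J m (x - y) = J m x - J m y"
  using J_add[of m x "- y"] by (simp add: J_minus)

lemma J_of_nat: "J m (of_nat n * x) = of_nat n * J m x"
  by (induction n) (auto simp: J_add algebra_simps)

lemma J_of_int: "J m (of_int n * x) = of_int n * J m x"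
  by (cases n rule: int_cases2) (auto simp: J_of_nat J_minus)

lemma J_sum: "J m (sum f S) = (\<Sum>x\<in>S. J m (f x))"
  by (induction S rule: infinite_finite_induct) (auto simp: J_add)

lemma J_fin_set: "finite S \<Longrightarrow> \<exists>R. \<forall>m>R. \<forall>x\<in>S. J m x = 0"
proof (induction S rule: finite_induct)
  case (insert x F)
  then obtain R where "\<forall>m>R. \<forall>x\<in>F. J m x = 0" by blast
  moreover obtain R' where "\<forall>m>R'. J m x = 0" using J_fin by blast
  ultimately show ?case by (intro exI[of _ "max R R'"]) auto
qed auto

lemmas J_linear = J_add J_diff J_minus J_of_int J_scale[OF s_K] J_scale[OF b_K]

text \<open>
  Without the shift by \<open>e\<close> this is \<open>\<Lambda>\<^sub>Y + u\<close> on \<open>y\<close>-coefficients.  For \<open>e = 1\<close> it is \<open>Y\<^sub>+ (\<Lambda>\<^sub>Y + u)\<close>,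
  where index \<open>i\<close> stands for the coefficient of \<open>y\<^sub>i\<^sub>+\<^sub>1\<close>.
\<close>

definition step :: "(int \<Rightarrow> 'a) \<Rightarrow> int \<Rightarrow> 'a" where
  "step g i = (if 0 \<le> i then (\<Sum>c. J (i - e - c) (g c)) + b * (of_int i * g (i - e)) else 0)"

lemma step_eq:
  assumes "\<And>c. c \<notin> S \<Longrightarrow> g c = 0" "finite S"
  shows "step g i = (if 0 \<le> i then (\<Sum>c\<in>S. J (i - e - c) (g c)) + b * (of_int i * g (i - e)) else 0)"
proof -
  have "(\<Sum>c. J (i - e - c) (g c)) = (\<Sum>c\<in>S. J (i - e - c) (g c))"
    by (rule Sum_any.expand_superset) (use assms in force)+
  then show ?thesis by (simp add: step_def)
qed

lemma step_cong: "(\<And>c. g c = h c) \<Longrightarrow> step g i = step h i"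
  by (simp add: step_def)

lemma step_neg: "i < 0 \<Longrightarrow> step g i = 0"
  by (simp add: step_def)

lemma step_0 [simp]: "step (\<lambda>c. 0) i = 0"
  by (simp add: step_def)

lemma step_add:
  assumes "fin_family g" "fin_family h"
  shows "step (\<lambda>c. g c + h c) i = step g i + step h i"
proof -
  obtain B where B: "supported B g" using assms(1) by (rule fin_familyE0)
  obtain B' where B': "B \<le> B'" "supported B' h" using assms(2) by (rule fin_familyE[where ?B0.0 = B])
  show ?thesis using B B'
    by (subst (1 2 3) step_eq[of "{0..B'}"]) (auto simp: J_add sum.distrib algebra_simps)
qed

lemma step_scale:
  assumes "k \<in> K" "fin_family g"
  shows "step (\<lambda>c. k * g c) i = k * step g i"
proof -
  from assms(2) obtain B where "supported B g" by (rule fin_familyE0)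
  then show ?thesis using assms(1)
    by (subst (1 2) step_eq[of "{0..B}"]) (auto simp: J_scale sum_distrib_left algebra_simps)
qed

lemma step_minus:
  assumes "fin_family g"
  shows "step (\<lambda>c. - g c) i = - step g i"
proof -
  from assms obtain B where "supported B g" by (rule fin_familyE0)
  then show ?thesis
    by (subst (1 2) step_eq[of "{0..B}"]) (auto simp: J_minus sum_negf)
qed

lemma step_diff:
  assumes "fin_family g" "fin_family h"
  shows "step (\<lambda>c. g c - h c) i = step g i - step h i"
  using step_add[OF assms(1) fin_family_map[OF assms(2), of "\<lambda>c. - h c"]] assms(2)
  by (simp add: step_minus)

lemma step_sum:
  assumes "\<And>x. x \<in> S \<Longrightarrow> fin_family (g x)"
  shows "step (\<lambda>a. \<Sum>x\<in>S. g x a) i = (\<Sum>x\<in>S. step (g x) i)"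
  using assms
proof (induction S rule: infinite_finite_induct)
  case (insert x F)
  then show ?case using fin_family_sum[of F g] by (simp add: step_add)
qed auto

lemma fin_family_step:
  assumes "fin_family g"
  shows "fin_family (step g)"
proof -
  from assms obtain B where B: "supported B g" by (rule fin_familyE0)
  obtain R where R: "\<And>m c. m > R \<Longrightarrow> c \<in> {0..B} \<Longrightarrow> J m (g c) = 0"
    using J_fin_set[of "g ` {0..B}"] by (metis finite_imageI finite_atLeastAtMost_int imageI)
  show ?thesis
  proof (rule fin_familyI[of _ "max 0 (B + max R 0 + 1)"])
    fix c assume c: "c > max 0 (B + max R 0 + 1)"
    have "(\<Sum>c'\<in>{0..B}. J (c - e - c') (g c')) = 0"
      using c e by (intro sum.neutral ballI R) auto
    moreover have "g (c - e) = 0" using c e B by auto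
    ultimately show "step g c = 0" using B by (subst step_eq[of "{0..B}"]) auto
  qed (auto simp: step_neg)
qed

text \<open>The mode \<open>J n\<close> meets its partner \<open>J (- n)\<close> in the single
  summand \<open>c = i - e + n\<close>.\<close>

lemma J_step:
  assumes "fin_family g"
  shows "J n (step g i) = step (\<lambda>c. J n (g c)) i
    + (if 0 \<le> i then of_int n * (s * g (i - e + n)) else 0)"
proof (cases "0 \<le> i")
  case True
  from assms obtain B where B: "supported B g" by (rule fin_familyE0)
  have "J n (step g i) = (\<Sum>c\<in>{0..B}. J n (J (i - e - c) (g c))) + b * (of_int i * J n (g (i - e)))"
    using True B by (subst step_eq[of "{0..B}"]) (auto simp: J_linear J_sum)
  also have "(\<Sum>c\<in>{0..B}. J n (J (i - e - c) (g c))) =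
      (\<Sum>c\<in>{0..B}. J (i - e - c) (J n (g c)))
    + (\<Sum>c\<in>{0..B}. if c = i - e + n then of_int n * (s * g (i - e + n)) else 0)"
    unfolding sum.distrib[symmetric]
    by (intro sum.cong refl, subst J_comm) auto
  also have "(\<Sum>c\<in>{0..B}. if c = i - e + n then of_int n * (s * g (i - e + n)) else 0)
      = of_int n * (s * g (i - e + n))"
    using B by auto
  finally show ?thesis
    using True B by (subst step_eq[of "{0..B}"]) auto
qed (auto simp: step_neg)

text \<open>The device for peeling off one current: if \<open>A\<close> fails to commute with the
  modes by \<open>X\<close>, pulling it out of \<open>step\<close> costs one sum of
  \<open>X\<close>. It is used for \<open>A\<close> equal to \<open>v2 _ j\<close> and
  \<open>v3 _ j\<close>, with \<open>X\<close> equal to \<open>s\<close> times \<open>ad_v2\<close>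
  and \<open>ad_v3\<close>.\<close>

lemma step_commutator:
  assumes A_add: "\<And>x y. A (x + y) = A x + A y"
    and A_b: "\<And>x. A (b * x) = b * A x"
    and A_J: "\<And>n x. A (J n x) = J n (A x) - X n x"
    and g: "\<And>c. c \<notin> S \<Longrightarrow> g c = 0" and S: "finite S" and i: "0 \<le> i"
  shows "step (\<lambda>c. A (g c)) i - A (step g i) = (\<Sum>c\<in>S. X (i - e - c) (g c))"
proof -
  have A_0: "A 0 = 0" using A_add[of 0 0] by simp
  have A_uminus: "A (- x) = - A x" for x
    using A_add[of x "- x"] A_0 by (simp add: eq_neg_iff_add_eq_0 add.commute)
  have A_nat: "A (of_nat n * x) = of_nat n * A x" for n x
    by (induction n) (auto simp: A_0 A_add algebra_simps)
  have A_int: "A (of_int n * x) = of_int n * A x" for n x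
    by (cases n rule: int_cases2) (auto simp: A_nat A_uminus)
  have A_sum: "A (\<Sum>c\<in>S. h c) = (\<Sum>c\<in>S. A (h c))" for h :: "int \<Rightarrow> 'a"
    by (induction S rule: infinite_finite_induct) (auto simp: A_0 A_add)
  have "A (step g i) = (\<Sum>c\<in>S. A (J (i - e - c) (g c))) + b * (of_int i * A (g (i - e)))"
    using g S i by (subst step_eq) (auto simp: A_add A_b A_int A_sum)
  also have "\<dots> = (\<Sum>c\<in>S. J (i - e - c) (A (g c))) - (\<Sum>c\<in>S. X (i - e - c) (g c))
      + b * (of_int i * A (g (i - e)))"
    by (simp add: A_J sum_subtractf)
  also have "\<dots> = step (\<lambda>c. A (g c)) i - (\<Sum>c\<in>S. X (i - e - c) (g c))"
    using g S i by (subst step_eq[of S]) (auto simp: A_0)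
  finally show ?thesis by simp
qed

text \<open>Given directly and not as a value of \<open>step\<close>: for \<open>e = 1\<close> the
  initial expression \<open>y_0 F\<close> would sit at index -1, outside the range of the
  families.\<close>

definition v1 :: "'a \<Rightarrow> int \<Rightarrow> 'a" where "v1 F c = (if 0 \<le> c then J c F else 0)"
definition v2 :: "'a \<Rightarrow> int \<Rightarrow> 'a" where "v2 F = step (v1 F)"
definition v3 :: "'a \<Rightarrow> int \<Rightarrow> 'a" where "v3 F = step (v2 F)"

lemma fin_v1: "fin_family (v1 F)"
proof -
  obtain R where "\<And>m. m > R \<Longrightarrow> J m F = 0" using J_fin by blast
  then show ?thesis by (intro fin_familyI[of _ R]) (auto simp: v1_def)
qed

lemma fin_v2: "fin_family (v2 F)" unfolding v2_def by (intro fin_family_step fin_v1)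
lemma fin_v3: "fin_family (v3 F)" unfolding v3_def by (intro fin_family_step fin_v2)

lemma v1_add: "v1 (x + y) c = v1 x c + v1 y c" by (simp add: v1_def J_add)
lemma v2_add: "v2 (x + y) c = v2 x c + v2 y c"
  unfolding v2_def by (subst step_add[symmetric]) (auto simp: v1_add fin_v1 intro: step_cong)
lemma v3_add: "v3 (x + y) c = v3 x c + v3 y c"
  unfolding v3_def by (subst step_add[symmetric]) (auto simp: v2_add fin_v2 intro: step_cong)

lemma v1_scale: "k \<in> K \<Longrightarrow> v1 (k * x) c = k * v1 x c" by (simp add: v1_def J_scale)
lemma v2_scale: "k \<in> K \<Longrightarrow> v2 (k * x) c = k * v2 x c"
  unfolding v2_def by (subst step_scale[symmetric]) (auto simp: v1_scale fin_v1 intro: step_cong)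
lemma v3_scale: "k \<in> K \<Longrightarrow> v3 (k * x) c = k * v3 x c"
  unfolding v3_def by (subst step_scale[symmetric]) (auto simp: v2_scale fin_v2 intro: step_cong)

lemma v1_neg: "c < 0 \<Longrightarrow> v1 F c = 0" by (simp add: v1_def)
lemma v2_neg: "c < 0 \<Longrightarrow> v2 F c = 0" by (simp add: v2_def step_neg)
lemma v3_neg: "c < 0 \<Longrightarrow> v3 F c = 0" by (simp add: v3_def step_neg)

lemma step_point: "step (\<lambda>c. if 0 \<le> c \<and> c = p then y else 0) i =
  (if 0 \<le> i \<and> 0 \<le> p then J (i - e - p) y + b * (of_int i * (if i - e = p then y else 0)) else 0)"
  by (subst step_eq[of "{p}"]) auto

lemma step_shift:
  assumes f: "supported C f" and i: "0 \<le> i"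
  shows "step (\<lambda>a. if 0 \<le> a then of_int (h a) * f (a + r) else 0) i =
    (\<Sum>c\<in>{0..C}. of_int (if r \<le> c then h (c - r) else 0) * J (i - e + r - c) (f c))
    + b * (of_int (i * h (i - e)) * f (i - e + r))"
proof -
  let ?g = "\<lambda>a. if 0 \<le> a then of_int (h a) * f (a + r) else 0"
  have g: "?g c = 0" if "c \<notin> {- r..C - r}" for c using that f by auto
  have "step ?g i = (\<Sum>a\<in>{- r..C - r}. J (i - e - a) (?g a)) + b * (of_int i * ?g (i - e))"
    using g i by (subst step_eq[of "{- r..C - r}"]) auto
  also have "(\<Sum>a\<in>{- r..C - r}. J (i - e - a) (?g a)) =
      (\<Sum>c\<in>{0..C}. J (i - e - (c - r)) (?g (c - r)))"
    by (rule sum.reindex_bij_witness[of _ "\<lambda>c. c - r" "\<lambda>a. a + r"]) auto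
  also have "\<dots> = (\<Sum>c\<in>{0..C}. of_int (if r \<le> c then h (c - r) else 0) * J (i - e + r - c) (f c))"
  proof (intro sum.cong refl)
    fix c
    have "i - e - (c - r) = i - e + r - c" by simp
    show "J (i - e - (c - r)) (?g (c - r)) =
        of_int (if r \<le> c then h (c - r) else 0) * J (i - e + r - c) (f c)"
      unfolding \<open>i - e - (c - r) = i - e + r - c\<close> by (simp add: J_of_int)
  qed
  \<comment> \<open>The cut at index 0 is invisible here: \<open>i - e < 0\<close> forces
    \<open>i = 0\<close>, and then the factor \<open>i\<close> vanishes.\<close>
  also have "of_int i * ?g (i - e) = of_int (i * h (i - e)) * f (i - e + r)"
    using i e by (cases "i = 0") auto
  finally show ?thesis .
qed

section \<open>Weighted sums of products of two modes\<close>

definition double_current :: "(int \<Rightarrow> int) \<Rightarrow> int \<Rightarrow> 'a \<Rightarrow> 'a" where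
  "double_current \<kappa> k x = (\<Sum>m. of_int (\<kappa> m) * J m (J (k - m) x))"

text \<open>An upper bound on the support of the weight suffices, since for very negative
  \<open>m\<close> the inner mode \<open>J (k - m)\<close> kills \<open>x\<close>.\<close>

lemma double_current_fin: "(\<And>m. m > B \<Longrightarrow> \<kappa> m = 0) \<Longrightarrow> finite {m. of_int (\<kappa> m) * J m (J (k - m) x) \<noteq> 0}"
proof -
  assume B: "\<And>m. m > B \<Longrightarrow> \<kappa> m = 0"
  obtain R where "\<forall>m>R. J m x = 0" using J_fin by blast
  then have "{m. of_int (\<kappa> m) * J m (J (k - m) x) \<noteq> 0} \<subseteq> {k - R..B}"
    using B by (auto simp: not_less[symmetric])
  then show ?thesis by (rule finite_subset) simp
qed

lemma double_current_add:
  assumes "\<And>m. m > B \<Longrightarrow> \<kappa> m = 0" "\<And>m. m > B \<Longrightarrow> \<kappa>' m = 0"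
  shows "double_current (\<lambda>m. \<kappa> m + \<kappa>' m) k x = double_current \<kappa> k x + double_current \<kappa>' k x"
  unfolding double_current_def using assms
  by (subst Sum_any.distrib[symmetric]) (auto intro: double_current_fin simp: algebra_simps)

lemma double_current_cong: "(\<And>m. \<kappa> m = \<kappa>' m) \<Longrightarrow> double_current \<kappa> k x = double_current \<kappa>' k x"
  by (simp add: double_current_def)

lemma double_current_uminus: "double_current (\<lambda>m. - \<kappa> m) k x = - double_current \<kappa> k x"
  unfolding double_current_def Sum_any.expand_set by (simp add: sum_negf)

lemma double_current_diff:
  assumes "\<And>m. m > B \<Longrightarrow> \<kappa> m = 0" "\<And>m. m > B \<Longrightarrow> \<kappa>' m = 0"
  shows "double_current (\<lambda>m. \<kappa> m - \<kappa>' m) k x = double_current \<kappa> k x - double_current \<kappa>' k x"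
  using double_current_add[of B \<kappa> "\<lambda>m. - \<kappa>' m"] assms by (simp add: double_current_uminus)

text \<open>Exchanging \<open>m\<close> and \<open>k - m\<close> turns twice the sum into a sum of
  commutators \<open>[J m, J (k - m)]\<close>, which vanish unless \<open>k = 0\<close>.
  Antisymmetry also reflects the upper bound of the support into a lower one.\<close>

lemma double_current_antisymmetric:
  assumes anti: "\<And>m. \<kappa> m + \<kappa> (k - m) = 0" and B: "\<And>m. m > B \<Longrightarrow> \<kappa> m = 0"
  shows "double_current \<kappa> k x + double_current \<kappa> k x =
    (if k = 0 then of_int (\<Sum>m\<in>{- B..B}. m * \<kappa> m) * (s * x) else 0)"
proof -
  have B': "\<kappa> m = 0" if "m < k - B" for m using anti[of m] B[of "k - m"] that by simp
  define S where "S = {k - B..B}"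
  have S: "double_current \<kappa> k x = (\<Sum>m\<in>S. of_int (\<kappa> m) * J m (J (k - m) x))"
    unfolding double_current_def
  proof (rule Sum_any.expand_superset)
    show "{a. of_int (\<kappa> a) * J a (J (k - a) x) \<noteq> 0} \<subseteq> S"
      using B B' by (auto simp: S_def not_less[symmetric])
  qed (simp add: S_def)
  also have "(\<Sum>m\<in>S. of_int (\<kappa> m) * J m (J (k - m) x)) =
      (\<Sum>m\<in>S. of_int (\<kappa> (k - m)) * J (k - m) (J m x))"
    by (rule sum.reindex_bij_witness[of _ "\<lambda>m. k - m" "\<lambda>m. k - m"]) (auto simp: S_def)
  also have "\<dots> = (\<Sum>m\<in>S. - of_int (\<kappa> m) * J (k - m) (J m x))"
  proof (intro sum.cong refl)
    fix m
    have "\<kappa> (k - m) = - \<kappa> m" using anti[of m] by linarith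
    then show "of_int (\<kappa> (k - m)) * J (k - m) (J m x) = - of_int (\<kappa> m) * J (k - m) (J m x)"
      by simp
  qed
  finally have "double_current \<kappa> k x + double_current \<kappa> k x =
      (\<Sum>m\<in>S. of_int (\<kappa> m) * (J m (J (k - m) x) - J (k - m) (J m x)))"
    using S by (simp add: right_diff_distrib sum_subtractf sum_negf)
  also have "\<dots> = (\<Sum>m\<in>S. if k = 0 then of_int (m * \<kappa> m) * (s * x) else 0)"
    by (intro sum.cong refl, subst (1) J_comm) auto
  also have "\<dots> = (if k = 0 then of_int (\<Sum>m\<in>{- B..B}. m * \<kappa> m) * (s * x) else 0)"
    by (auto simp: sum_distrib_right S_def)
  finally show ?thesis .
qed

text \<open>The substitution \<open>m = i - e - a\<close> makes the index of the outer mode the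
  summation variable; the cut \<open>0 \<le> a\<close> becomes the condition
  \<open>m \<le> i - e\<close> on the weight.\<close>

lemma step_shift_J:
  assumes i: "0 \<le> i"
  shows "fin_family (\<lambda>a. if 0 \<le> a then of_int (h a) * J (r + a) x else 0)"
    and "step (\<lambda>a. if 0 \<le> a then of_int (h a) * J (r + a) x else 0) i =
      double_current (\<lambda>m. if m \<le> i - e then h (i - e - m) else 0) (r + i - e) x
      + b * (of_int (i * h (i - e)) * J (r + i - e) x)"
proof -
  let ?g = "\<lambda>a. if 0 \<le> a then of_int (h a) * J (r + a) x else 0"
  obtain R where R: "\<forall>m>R. J m x = 0" using J_fin by blast
  then show "fin_family ?g" by (intro fin_familyI[of _ "R - r"]) auto
  have "(\<Sum>c. J (i - e - c) (?g c)) = (\<Sum>m. J m (?g (i - e - m)))"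
    by (subst Sum_any_reflect[of _ "i - e", symmetric]) simp
  also have "\<dots> = double_current (\<lambda>m. if m \<le> i - e then h (i - e - m) else 0) (r + i - e) x"
    unfolding double_current_def by (intro Sum_any.cong) (auto simp: J_of_int algebra_simps)
  moreover have "of_int i * ?g (i - e) = of_int (i * h (i - e)) * J (r + i - e) x"
    using i e by (cases "i = 0") (auto simp: algebra_simps)
  ultimately show "step ?g i = double_current (\<lambda>m. if m \<le> i - e then h (i - e - m) else 0) (r + i - e) x
      + b * (of_int (i * h (i - e)) * J (r + i - e) x)"
    using i by (simp only: step_def if_True)
qed

section \<open>Brackets of \<open>v2\<close> and \<open>v3\<close> with a single mode\<close>

lemma v1_0 [simp]: "v1 0 c = 0" by (simp add: v1_def)
lemma v2_0 [simp]: "v2 0 c = 0" unfolding v2_def using step_cong[of "v1 0" "\<lambda>c. 0"] by simp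
lemma v3_0 [simp]: "v3 0 c = 0" unfolding v3_def using step_cong[of "v2 0" "\<lambda>c. 0"] by simp

text \<open>\<open>s * ad_v2 n j\<close> is the bracket of \<open>J n\<close> with
  \<open>v2 _ j\<close>. The part under \<open>n \<le> 0\<close> is the contraction with the inner
  mode \<open>J (- n)\<close>, present only if that mode survives the cut in \<open>v1\<close>; the
  last summand is the contraction with the outer mode.\<close>

definition ad_v2 :: "int \<Rightarrow> int \<Rightarrow> 'a \<Rightarrow> 'a" where
  "ad_v2 n j G = (if n \<le> 0 then of_int n * J (j - e + n) G
      + b * (of_int (j * n) * (if j - e = - n then G else 0)) else 0)
    + of_int n * v1 G (j - e + n)"

definition ad_v3 :: "int \<Rightarrow> int \<Rightarrow> 'a \<Rightarrow> 'a" where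
  "ad_v3 n j G = step (\<lambda>c. if 0 \<le> c then ad_v2 n c G else 0) j + of_int n * v2 G (j - e + n)"

lemma v2_J:
  assumes j: "0 \<le> j"
  shows "v2 (J n G) j = J n (v2 G j) - s * ad_v2 n j G"
proof -
  let ?p = "\<lambda>c. if 0 \<le> c \<and> c = - n then of_int n * G else 0"
  have p: "fin_family ?p" by (intro fin_familyI[of _ "- n"]) auto
  have "J n (v2 G j) = step (\<lambda>c. J n (v1 G c)) j + of_int n * (s * v1 G (j - e + n))"
    using j by (simp add: v2_def J_step fin_v1)
  also have "step (\<lambda>c. J n (v1 G c)) j = step (\<lambda>c. v1 (J n G) c + s * ?p c) j"
    by (intro step_cong) (use J_comm[of n _ G] in \<open>auto simp: v1_def add_eq_0_iff2 algebra_simps\<close>)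
  also have "\<dots> = v2 (J n G) j + s * step ?p j"
    using p by (subst step_add) (auto simp: v2_def fin_v1 step_scale s_K intro: fin_family_map)
  also have "step ?p j = ad_v2 n j G - of_int n * v1 G (j - e + n)"
    using j by (auto simp: step_point ad_v2_def J_of_int)
  finally show ?thesis by (simp add: algebra_simps)
qed

lemma fin_ad_v2: "fin_family (\<lambda>c. if 0 \<le> c then ad_v2 n c G else 0)"
proof -
  obtain R where R: "\<And>m. m > R \<Longrightarrow> J m G = 0" using J_fin by blast
  then show ?thesis using e
    by (intro fin_familyI[of _ "max R 0 + e - n"]) (auto simp: ad_v2_def v1_def)
qed

lemma v3_J:
  assumes j: "0 \<le> j"
  shows "v3 (J n G) j = J n (v3 G j) - s * ad_v3 n j G"
proof -
  let ?p = "\<lambda>c. if 0 \<le> c then ad_v2 n c G else 0"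
  have "J n (v3 G j) = step (\<lambda>c. J n (v2 G c)) j + of_int n * (s * v2 G (j - e + n))"
    using j by (simp add: v3_def J_step fin_v2)
  also have "step (\<lambda>c. J n (v2 G c)) j = step (\<lambda>c. v2 (J n G) c + s * ?p c) j"
    by (intro step_cong) (auto simp: v2_J v2_neg)
  also have "\<dots> = v3 (J n G) j + s * step ?p j"
    using fin_ad_v2[of n G] by (subst step_add) (auto simp: v3_def fin_v2 step_scale s_K intro: fin_family_map)
  finally show ?thesis by (simp add: algebra_simps ad_v3_def)
qed

section \<open>Brackets of the iterates, up to cubic with quadratic\<close>

lemma v1_v1: "0 \<le> i \<Longrightarrow> 0 \<le> j \<Longrightarrow> v1 (v1 F j) i = v1 (v1 F i) j"
  using J_comm[of i j F] by (cases "i = 0") (auto simp: v1_def split: if_splits)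

lemma v1_v2:
  assumes "0 \<le> a" "0 \<le> j"
  shows "v1 (v2 F j) a - v2 (v1 F a) j = s * (of_int a * v1 F (a + (j - e)))"
proof -
  have "v1 x a = J a x" for x using assms by (simp add: v1_def)
  then show ?thesis
    using assms v2_J[of j a F] by (cases "a = 0") (auto simp: ad_v2_def algebra_simps)
qed

lemma v1_v3:
  assumes "0 \<le> a" "0 \<le> j"
  shows "v1 (v3 F j) a - v3 (v1 F a) j = s * ad_v3 a j F"
  using assms v3_J[of j a F] by (simp add: v1_def)

text \<open>Nonnegative modes commute, so \<open>J (N - c) (v1 F c)\<close> is invariant under
  \<open>c \<mapsto> N - c\<close> on \<open>{0..N}\<close>, and the sum with an antisymmetric
  weight equals its own negative.\<close>

lemma sum_v1_symmetric:
  assumes "\<And>c. 0 \<le> c \<Longrightarrow> c \<le> N \<Longrightarrow> \<kappa> c + \<kappa> (N - c) = 0"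
    and "\<And>c. N < c \<Longrightarrow> 0 \<le> c \<Longrightarrow> \<kappa> c = 0" and "N \<le> C"
  shows "(\<Sum>c\<in>{0..C}. of_int (\<kappa> c) * J (N - c) (v1 F c)) = 0"
proof -
  let ?h = "\<lambda>c. of_int (\<kappa> c) * J (N - c) (v1 F c)"
  have eq: "sum ?h {0..C} = sum ?h {0..N}"
    by (rule sum.mono_neutral_right) (use assms in auto)
  have "sum ?h {0..N} = (\<Sum>c\<in>{0..N}. ?h (N - c))"
    by (rule sum.reindex_bij_witness[of _ "\<lambda>c. N - c" "\<lambda>c. N - c"]) auto
  also have "\<dots> = (\<Sum>c\<in>{0..N}. - ?h c)"
  proof (intro sum.cong refl)
    fix c assume c: "c \<in> {0..N}"
    have "J (N - (N - c)) (v1 F (N - c)) = J (N - c) (v1 F c)"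
      using c v1_v1[of c "N - c" F] by (simp add: v1_def)
    moreover have "\<kappa> (N - c) = - \<kappa> c" using assms(1)[of c] c by auto
    ultimately show "?h (N - c) = - ?h c" by simp
  qed
  also have "\<dots> = - sum ?h {0..N}" by (simp add: sum_negf)
  finally have "sum ?h {0..N} + sum ?h {0..N} = 0" by (simp add: eq_neg_iff_add_eq_0)
  then show ?thesis unfolding eq by (rule torsion_free)
qed

text \<open>The leftovers of \<open>step_commutator\<close> brought to the common shape of a weight
  times \<open>J (i + j - 2 * e - c)\<close>. The \<open>b\<close>-part comes from one point, where
  the contraction hits the diagonal term of \<open>step\<close>.\<close>

lemma sum_ad_v2:
  assumes f: "supported C f"
  shows "(\<Sum>c\<in>{0..C}. ad_v2 (i - e - c) j (f c)) =
    (\<Sum>c\<in>{0..C}. of_int ((if i - e \<le> c then i - e - c else 0)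
        + (if c \<le> i + j - 2 * e then i - e - c else 0)) * J (i + j - 2 * e - c) (f c))
    + b * (of_int (j * (e - j)) * (if e \<le> j then f (i + j - 2 * e) else 0))"
proof -
  have "(\<Sum>c\<in>{0..C}. ad_v2 (i - e - c) j (f c)) =
    (\<Sum>c\<in>{0..C}. of_int ((if i - e \<le> c then i - e - c else 0)
        + (if c \<le> i + j - 2 * e then i - e - c else 0)) * J (i + j - 2 * e - c) (f c)
     + (if c = i + j - 2 * e then b * (of_int (j * (e - j)) * (if e \<le> j then f c else 0)) else 0))"
  proof (intro sum.cong refl)
    fix c
    have *: "j - e + (i - e - c) = i + j - 2 * e - c" by simp
    show "ad_v2 (i - e - c) j (f c) = of_int ((if i - e \<le> c then i - e - c else 0)
        + (if c \<le> i + j - 2 * e then i - e - c else 0)) * J (i + j - 2 * e - c) (f c)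
     + (if c = i + j - 2 * e then b * (of_int (j * (e - j)) * (if e \<le> j then f c else 0)) else 0)"
    proof (cases "c = i + j - 2 * e")
      case True
      show ?thesis unfolding ad_v2_def v1_def * unfolding True by (auto simp: algebra_simps)
    qed (unfold ad_v2_def v1_def *, auto simp: algebra_simps)
  qed
  also have "\<dots> = (\<Sum>c\<in>{0..C}. of_int ((if i - e \<le> c then i - e - c else 0)
        + (if c \<le> i + j - 2 * e then i - e - c else 0)) * J (i + j - 2 * e - c) (f c))
    + b * (of_int (j * (e - j)) * (if e \<le> j then f (i + j - 2 * e) else 0))"
    using f by (auto simp: sum.distrib)
  finally show ?thesis .
qed

lemma b_term_irrelevant: "0 \<le> j \<Longrightarrow> of_int (j * (e - j)) * (if e \<le> j then x else 0) = of_int (j * (e - j)) * x"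
  using e by (cases "j = 0") auto

text \<open>Half of a Witt algebra, without central term. Pulling \<open>v2 _ j\<close> out of the
  two layers of \<open>v2 _ i\<close> leaves the weight \<open>\<kappa>\<close>. It differs from the
  constant \<open>i - j\<close> by a weight antisymmetric under \<open>c \<mapsto> N - c\<close>,
  which \<open>sum_v1_symmetric\<close> annihilates.\<close>

lemma v2_v2:
  assumes i: "0 \<le> i" and j: "0 \<le> j"
  shows "v2 (v2 F j) i - v2 (v2 F i) j = s * (of_int (i - j) * v2 F (i + j - e))"
proof -
  define N where "N = i + j - 2 * e"
  obtain C where C: "N \<le> C" "supported C (v1 F)"
    by (rule fin_familyE[OF fin_v1[of F], where ?B0.0 = N])
  let ?p = "\<lambda>a. if 0 \<le> a then of_int a * v1 F (a + (j - e)) else 0"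
  have p: "fin_family ?p"
    by (rule fin_family_map[OF fin_family_shift[OF fin_v1[of F], of "j - e"]]) auto
  have q: "fin_family (\<lambda>c. v2 (v1 F c) j)"
    by (rule fin_family_map[OF fin_v1[of F]]) auto
  have "v2 (v2 F j) i = step (\<lambda>c. v2 (v1 F c) j + s * ?p c) i"
    unfolding v2_def[of "v2 F j"]
    by (intro step_cong) (use v1_v2[OF _ j, of _ F] in \<open>auto simp: v1_neg algebra_simps\<close>)
  also have "\<dots> = step (\<lambda>c. v2 (v1 F c) j) i + s * step ?p i"
    using p q by (subst step_add) (auto simp: step_scale s_K intro: fin_family_map)
  finally have 1: "v2 (v2 F j) i = step (\<lambda>c. v2 (v1 F c) j) i + s * step ?p i" .
  have 2: "step (\<lambda>c. v2 (v1 F c) j) i - v2 (v2 F i) j = (\<Sum>c\<in>{0..C}. s * ad_v2 (i - e - c) j (v1 F c))"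
    unfolding v2_def[of F]
    by (rule step_commutator) (use C i j in \<open>auto simp: v2_add v2_scale b_K v2_J\<close>)
  have 3: "step ?p i = (\<Sum>c\<in>{0..C}. of_int (if j - e \<le> c then c - (j - e) else 0) * J (N - c) (v1 F c))
      + b * (of_int (i * (i - e)) * v1 F N)"
    using step_shift[OF C(2) i, where h = "\<lambda>a. a" and r = "j - e"] by (simp add: N_def algebra_simps)
  define \<kappa> where "\<kappa> = (\<lambda>c. (if j - e \<le> c then c - (j - e) else 0) +
     ((if i - e \<le> c then i - e - c else 0) + (if c \<le> i + j - 2 * e then i - e - c else 0)))"
  have z: "(\<Sum>c\<in>{0..C}. of_int (\<kappa> c - (i - j)) * J (N - c) (v1 F c)) = 0"
    by (rule sum_v1_symmetric) (use C e i j in \<open>auto simp: \<kappa>_def N_def\<close>)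
  have 4: "of_int (i - j) * v2 F (i + j - e) = (\<Sum>c\<in>{0..C}. of_int (i - j) * J (N - c) (v1 F c))
      + b * (of_int ((i - j) * (i + j - e)) * v1 F N)"
  proof (cases "i = j")
    case False
    then have "0 \<le> i + j - e" using i j e by auto
    then show ?thesis unfolding v2_def using C
      by (subst step_eq[of "{0..C}"]) (auto simp: N_def sum_distrib_left algebra_simps)
  qed auto
  have "v2 (v2 F j) i - v2 (v2 F i) j = s * (step ?p i + (\<Sum>c\<in>{0..C}. ad_v2 (i - e - c) j (v1 F c)))"
    using 1 2 by (simp add: sum_distrib_left algebra_simps)
  also have "step ?p i + (\<Sum>c\<in>{0..C}. ad_v2 (i - e - c) j (v1 F c)) =
     (\<Sum>c\<in>{0..C}. of_int (\<kappa> c) * J (N - c) (v1 F c))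
     + b * (of_int (i * (i - e) + j * (e - j)) * v1 F N)"
    unfolding 3
    by (subst sum_ad_v2[OF C(2)], subst b_term_irrelevant[OF j])
       (simp add: \<kappa>_def N_def[symmetric] sum.distrib ring_distribs)
  also have "\<dots> = of_int (i - j) * v2 F (i + j - e)"
  proof -
    have "(\<Sum>c\<in>{0..C}. of_int (\<kappa> c) * J (N - c) (v1 F c)) =
        (\<Sum>c\<in>{0..C}. of_int (i - j) * J (N - c) (v1 F c))"
      using z unfolding of_int_diff[of "\<kappa> _"] left_diff_distrib sum_subtractf by simp
    moreover have "i * (i - e) + j * (e - j) = (i - j) * (i + j - e)" by (simp add: algebra_simps)
    ultimately show ?thesis unfolding 4 by simp
  qed
  finally show ?thesis .
qed

text \<open>The weight of \<open>J (i + j - 2 * e - c) (v2 F c)\<close> in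
  \<open>[v3 i, v2 j]\<close>, up to the factor \<open>s\<close>. The first summand is the weight
  \<open>a - j\<close> of \<open>v2_v2\<close> at \<open>a = c - (j - e)\<close>; the other two are
  the contractions of the outer current recorded in \<open>ad_v2\<close>.\<close>

definition v3_v2_coeff :: "int \<Rightarrow> int \<Rightarrow> int \<Rightarrow> int" where
  "v3_v2_coeff i j c = (if j - e \<le> c then c - (j - e) - j else 0)
     + ((if i - e \<le> c then i - e - c else 0) + (if c \<le> i + j - 2 * e then i - e - c else 0))"

lemma v3_v2:
  assumes i: "0 \<le> i" and j: "0 \<le> j" and C: "supported C (v2 F)"
  shows "v3 (v2 F j) i - v2 (v3 F i) j =
    s * ((\<Sum>c\<in>{0..C}. of_int (v3_v2_coeff i j c) * J (i + j - 2 * e - c) (v2 F c))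
      + b * (of_int (i * (i - e - j) + j * (e - j)) * v2 F (i + j - 2 * e)))"
proof -
  let ?p = "\<lambda>a. if 0 \<le> a then of_int (a - j) * v2 F (a + (j - e)) else 0"
  have p: "fin_family ?p"
    by (rule fin_family_map[OF fin_family_shift[OF fin_v2[of F], of "j - e"]]) auto
  have q: "fin_family (\<lambda>c. v2 (v2 F c) j)"
    by (rule fin_family_map[OF fin_v2[of F]]) auto
  have "v3 (v2 F j) i = step (\<lambda>c. v2 (v2 F c) j + s * ?p c) i"
    unfolding v3_def
    by (intro step_cong) (use v2_v2[OF _ j, of _ F] in \<open>auto simp: v2_neg algebra_simps\<close>)
  also have "\<dots> = step (\<lambda>c. v2 (v2 F c) j) i + s * step ?p i"
    using p q by (subst step_add) (auto simp: step_scale s_K intro: fin_family_map)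
  finally have 1: "v3 (v2 F j) i = step (\<lambda>c. v2 (v2 F c) j) i + s * step ?p i" .
  have 2: "step (\<lambda>c. v2 (v2 F c) j) i - v2 (v3 F i) j = (\<Sum>c\<in>{0..C}. s * ad_v2 (i - e - c) j (v2 F c))"
    unfolding v3_def[of F]
    by (rule step_commutator) (use C i j in \<open>auto simp: v2_add v2_scale b_K v2_J\<close>)
  have 3: "step ?p i = (\<Sum>c\<in>{0..C}. of_int (if j - e \<le> c then c - (j - e) - j else 0) * J (i + j - 2 * e - c) (v2 F c))
      + b * (of_int (i * (i - e - j)) * v2 F (i + j - 2 * e))"
    using step_shift[OF C i, where h = "\<lambda>a. a - j" and r = "j - e"] by (simp add: algebra_simps)
  have "v3 (v2 F j) i - v2 (v3 F i) j = s * (step ?p i + (\<Sum>c\<in>{0..C}. ad_v2 (i - e - c) j (v2 F c)))"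
    using 1 2 by (simp add: sum_distrib_left algebra_simps)
  also have "step ?p i + (\<Sum>c\<in>{0..C}. ad_v2 (i - e - c) j (v2 F c)) =
     (\<Sum>c\<in>{0..C}. of_int (v3_v2_coeff i j c) * J (i + j - 2 * e - c) (v2 F c))
     + b * (of_int (i * (i - e - j) + j * (e - j)) * v2 F (i + j - 2 * e))"
    unfolding 3
    by (subst sum_ad_v2[OF C], subst b_term_irrelevant[OF j])
       (simp add: v3_v2_coeff_def sum.distrib ring_distribs)
  finally show ?thesis .
qed

text \<open>
  The coefficient of \<open>J\<^sub>m\<close> in the bracket of two cubic operators; \<open>m < 0\<close> gives the \<open>p\<^sub>n\<close>-terms of the
  theorem and \<open>m > 0\<close> its \<open>p\<^sub>n\<^sup>*\<close>-terms.
\<close>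

definition structure_coeff :: "int \<Rightarrow> int \<Rightarrow> int \<Rightarrow> int" where
  "structure_coeff i j m = (if m < 0 then 2 * (i - j)
     else (if m \<le> i - e then 2 * i - j - 2 * m - 2 * e else 0)
        - (if m \<le> j - e then 2 * j - i - 2 * m - 2 * e else 0))"

lemma structure_coeff_refl [simp]: "structure_coeff i i m = 0" by (simp add: structure_coeff_def)

definition structure_op :: "int \<Rightarrow> int \<Rightarrow> (int \<Rightarrow> 'a) \<Rightarrow> 'a" where
  "structure_op i j w = (\<Sum>m. of_int (structure_coeff i j m) * J m (w (i + j - 2 * e - m)))
     + b * (of_int ((i - j) * (i + j - e)) * w (i + j - 2 * e))"

lemma structure_op_eq:
  assumes "supported C w"
  shows "structure_op i j w = (\<Sum>c\<in>{0..C}. of_int (structure_coeff i j (i + j - 2 * e - c)) * J (i + j - 2 * e - c) (w c))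
     + b * (of_int ((i - j) * (i + j - e)) * w (i + j - 2 * e))"
proof -
  have "(\<Sum>m. of_int (structure_coeff i j m) * J m (w (i + j - 2 * e - m))) =
    (\<Sum>c. of_int (structure_coeff i j (i + j - 2 * e - c)) * J (i + j - 2 * e - c) (w c))"
    by (subst Sum_any_reflect[of _ "i + j - 2 * e", symmetric]) simp
  also have "\<dots> = (\<Sum>c\<in>{0..C}. of_int (structure_coeff i j (i + j - 2 * e - c)) * J (i + j - 2 * e - c) (w c))"
    by (rule Sum_any.expand_superset) (use assms in force)+
  finally show ?thesis by (simp add: structure_op_def)
qed

text \<open>This is what multiplies \<open>\<gamma> 2 * \<gamma> 3\<close> in the bracket of two
  constraints. Its two halves arise from each other by exchanging \<open>i\<close> and
  \<open>j\<close> and a sign, so only the part of \<open>v3_v2_coeff\<close> antisymmetric in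
  \<open>i\<close> and \<open>j\<close> survives. That part is \<open>structure_coeff\<close> plus
  the constant \<open>i - j\<close>, and the constant sums up to \<open>v3\<close>.\<close>

lemma v3_v2_mixed:
  assumes i: "0 \<le> i" and j: "0 \<le> j"
  shows "v3 (v2 F j) i - v2 (v3 F i) j + (v2 (v3 F j) i - v3 (v2 F i) j) =
    s * (structure_op i j (v2 F) + of_int (i - j) * v3 F (i + j - e))"
proof (cases "i = j")
  case True
  then show ?thesis by (simp add: structure_op_def)
next
  case False
  then have pos: "0 \<le> i + j - e" using i j e by auto
  define N where "N = i + j - 2 * e"
  obtain C where C: "supported C (v2 F)"
    by (rule fin_familyE0[OF fin_v2[of F]])
  have 1: "of_int (i - j) * v3 F (i + j - e) = (\<Sum>c\<in>{0..C}. of_int (i - j) * J (N - c) (v2 F c))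
      + b * (of_int ((i - j) * (i + j - e)) * v2 F N)"
    unfolding v3_def using C pos
    by (subst step_eq[of "{0..C}"]) (auto simp: N_def sum_distrib_left algebra_simps)
  have v3_v2_coeff: "v3_v2_coeff i j c - v3_v2_coeff j i c = structure_coeff i j (N - c) + (i - j)" if "0 \<le> c" for c
    using i j e pos that by (auto simp: v3_v2_coeff_def structure_coeff_def N_def)
  have "v3 (v2 F j) i - v2 (v3 F i) j - (v3 (v2 F i) j - v2 (v3 F j) i) =
    s * ((\<Sum>c\<in>{0..C}. of_int (v3_v2_coeff i j c - v3_v2_coeff j i c) * J (N - c) (v2 F c))
      + b * (of_int (i * (i - e - j) + j * (e - j) - (j * (j - e - i) + i * (e - i))) * v2 F N))"
  proof -
    have *: "v3 (v2 F i) j - v2 (v3 F j) i =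
      s * ((\<Sum>c\<in>{0..C}. of_int (v3_v2_coeff j i c) * J (N - c) (v2 F c))
        + b * (of_int (j * (j - e - i) + i * (e - i)) * v2 F N))"
      using v3_v2[OF j i C] by (simp add: N_def add.commute)
    show ?thesis
      unfolding v3_v2[OF i j C] * N_def[symmetric]
      unfolding of_int_diff[of "v3_v2_coeff _ _ _"] left_diff_distrib sum_subtractf
        of_int_diff[of "_ + j * (e - j)"] right_diff_distrib[of s] right_diff_distrib[of b] distrib_left[of s]
      by simp
  qed
  also have "(\<Sum>c\<in>{0..C}. of_int (v3_v2_coeff i j c - v3_v2_coeff j i c) * J (N - c) (v2 F c)) =
     (\<Sum>c\<in>{0..C}. of_int (structure_coeff i j (N - c)) * J (N - c) (v2 F c)) +
     (\<Sum>c\<in>{0..C}. of_int (i - j) * J (N - c) (v2 F c))"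
    unfolding sum.distrib[symmetric] by (intro sum.cong refl) (simp add: v3_v2_coeff ring_distribs)
  also have "i * (i - e - j) + j * (e - j) - (j * (j - e - i) + i * (e - i)) =
     (i - j) * (i + j - e) + (i - j) * (i + j - e)"
    by (simp add: algebra_simps)
  finally show ?thesis
    unfolding 1 structure_op_eq[OF C] N_def[symmetric] by (simp add: algebra_simps)
qed

end

section \<open>Integer identities behind the cubic bracket\<close>

lemma int_sum_telescope:
  fixes g h :: "int \<Rightarrow> int"
  assumes "\<And>c. h (c + 1) - h c = g c" "-1 \<le> N"
  shows "(\<Sum>c\<in>{0..N}. g c) = h (N + 1) - h 0"
  using assms(2)
proof (induction N rule: int_ge_induct)
  case (step i)
  then have "{0..i + 1} = insert (i + 1) {0..i}" by auto
  with step show ?case using assms(1)[of "i + 1"] by simp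
qed auto

lemma sum_odd:
  fixes d :: "int \<Rightarrow> int"
  assumes "\<And>m. d m + d (- m) = 0" "0 \<le> B"
  shows "(\<Sum>m\<in>{- B..B}. m * d m) = 2 * (\<Sum>m\<in>{1..B}. m * d m)"
proof -
  have "(\<Sum>m\<in>{- B..-1}. m * d m) = (\<Sum>m\<in>{1..B}. (- m) * d (- m))"
    by (rule sum.reindex_bij_witness[of _ uminus uminus]) auto
  also have "\<dots> = (\<Sum>m\<in>{1..B}. m * d m)"
    using assms(1) by (intro sum.cong) (auto simp: add_eq_0_iff algebra_simps)
  finally have 1: "(\<Sum>m\<in>{- B..-1}. m * d m) = (\<Sum>m\<in>{1..B}. m * d m)" .
  have "{- B..B} = {- B..-1} \<union> {0} \<union> {1..B}" using assms(2) by auto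
  then show ?thesis using 1 by (simp add: sum.union_disjoint)
qed

context heisenberg
begin

text \<open>
  In \<open>[v\<^sub>3, v\<^sub>3]\<close> the product \<open>v\<^sub>2\<^sub>,\<^sub>N\<^sub>-\<^sub>c v\<^sub>2\<^sub>,\<^sub>c\<close> comes with the coefficient \<open>i - e - c\<close>.  It is replaced by
  \<open>k_coeff\<close>, which differs from it by a function antisymmetric under \<open>c \<leftrightarrow> N - c\<close> (so that
  \<open>[v\<^sub>2, v\<^sub>2]\<close> applies to the difference) and makes the total weight \<open>d_coeff\<close> antisymmetric.
\<close>

definition k_coeff :: "int \<Rightarrow> int \<Rightarrow> int \<Rightarrow> int" where
  "k_coeff i j c = i - j - max 0 (c + e - j) + max 0 (c + e - i)"

text \<open>With \<open>n = i - e - c\<close>, this is the weight of \<open>J (a - e + n)\<close> in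
  \<open>ad_v2 n a\<close>: inner contraction plus outer contraction.\<close>

definition h_coeff :: "int \<Rightarrow> int \<Rightarrow> int \<Rightarrow> int" where
  "h_coeff i c a = (if i - e \<le> c then i - e - c else 0) + (if c \<le> a + i - 2 * e then i - e - c else 0)"

text \<open>The weight of \<open>J m (J (i + j - 3 * e - c - m) (v2 F c))\<close> in
  \<open>[v3 i, v3 j]\<close>, divided by \<open>s\<close>, minus its expected value. The four lines
  come from \<open>ad_v3\<close>, from \<open>[v3 j, v2 a]\<close>, from the products of two
  \<open>v2\<close> after the change of weight, and from \<open>structure_op\<close>. Each condition
  \<open>m \<le> ...\<close> is the cut of some index at 0.\<close>

definition d_coeff :: "int \<Rightarrow> int \<Rightarrow> int \<Rightarrow> int \<Rightarrow> int" where
  "d_coeff i j c m = (if m \<le> j - e then h_coeff i c (j - e - m) else 0)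
     - (if m \<le> i - e then v3_v2_coeff j (i - e - m) c else 0)
     + (if m \<le> i + j - 3 * e - c \<and> c \<le> i + j - 2 * e then k_coeff i j c else 0)
     - (if m \<le> i + j - 2 * e then structure_coeff i j m else 0)"

text \<open>All weights are piecewise linear. Once \<open>e\<close> has a value and the reflected
  index is a variable \<open>n\<close> tied by \<open>m + n\<close>, the claim is a statement of
  linear integer arithmetic.\<close>

lemma d_coeff_antisymmetric:
  assumes "0 \<le> i" "0 \<le> j" "i \<noteq> j" "0 \<le> c"
  shows "d_coeff i j c m + d_coeff i j c (i + j - 3 * e - c - m) = 0"
proof -
  have "d_coeff i j c m + d_coeff i j c n = 0" if n: "m + n = i + j - 3 * e - c" for n
    using e
  proof
    assume e: "e = 0"
    show ?thesis using n assms
      unfolding d_coeff_def h_coeff_def v3_v2_coeff_def k_coeff_def structure_coeff_def max_def unfolding e by (smt (z3))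
  next
    assume e: "e = 1"
    show ?thesis using n assms
      unfolding d_coeff_def h_coeff_def v3_v2_coeff_def k_coeff_def structure_coeff_def max_def unfolding e by (smt (z3))
  qed
  then show ?thesis by simp
qed

text \<open>The weight of \<open>b * J (i + j - 3 * e - c) (v2 F c)\<close> in the same difference.
  The four sources enter again, now through the diagonal \<open>b\<close>-terms of the inner and
  outer applications of \<open>step\<close>.\<close>

definition db_coeff :: "int \<Rightarrow> int \<Rightarrow> int \<Rightarrow> int" where
  "db_coeff i j c = j * h_coeff i c (j - e) + (if i - e \<le> c then (c - i + 2 * e) * (i - e - c) else 0)
     - i * v3_v2_coeff j (i - e) c
     - (if j - 2 * e \<le> c then j * (j - e - (c - (j - 2 * e))) + (c - (j - 2 * e)) * (e - (c - (j - 2 * e))) else 0)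
     + (if c \<le> i + j - 2 * e then k_coeff i j c * (i + j - 2 * e - c) else 0)
     - structure_coeff i j (i + j - 3 * e - c) * (c + e) - (i - j) * (i + j - e)"

text \<open>These weights are quadratic, so the conditionals are resolved first, by the position of
  \<open>c\<close>; what remains is polynomial algebra. For \<open>e = 1\<close> the thresholds do
  not coincide, and \<open>c = i - 2\<close>, \<open>c = j - 2\<close>, \<open>c = i + j - 2\<close>
  become cases of their own.\<close>

lemma db_coeff_eq_0:
  assumes "0 \<le> i" "0 \<le> j" "i \<noteq> j" "0 \<le> c"
  shows "db_coeff i j c = 0"
  using e
proof
  assume e: "e = 0"
  have "c < i \<or> i \<le> c" "c < j \<or> j \<le> c" "c \<le> i + j \<or> i + j < c" by linarith+
  then show ?thesis
    using assms unfolding db_coeff_def h_coeff_def v3_v2_coeff_def k_coeff_def structure_coeff_def max_def unfolding e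
    by (elim disjE; simp; simp add: algebra_simps)
next
  assume e: "e = 1"
  have "c < i - 2 \<or> c = i - 2 \<or> i - 1 \<le> c" "c < j - 2 \<or> c = j - 2 \<or> j - 1 \<le> c"
    "c \<le> i + j - 3 \<or> c = i + j - 2 \<or> i + j - 2 < c" by linarith+
  then show ?thesis
    using assms unfolding db_coeff_def h_coeff_def v3_v2_coeff_def k_coeff_def structure_coeff_def max_def unfolding e
    by (elim disjE; simp; simp add: algebra_simps)
qed

text \<open>For \<open>c = i + j - 3 * e\<close> the two modes are \<open>J m\<close> and
  \<open>J (- m)\<close>, the only pairs with a nonzero commutator. Positive \<open>m\<close>
  suffice because the weight is odd there.\<close>

lemma d_coeff_diagonal:
  assumes "0 \<le> i" "0 \<le> j" "i \<noteq> j" "3 * e \<le> i + j" "1 \<le> m"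
  shows "d_coeff i j (i + j - 3 * e) m = (if m \<le> j - e then j - i - 2 * m else 0)"
    using e
  proof
    assume e: "e = 0"
    show ?thesis using assms
      unfolding d_coeff_def h_coeff_def v3_v2_coeff_def k_coeff_def structure_coeff_def max_def unfolding e by (smt (z3))
  next
    assume e: "e = 1"
    show ?thesis using assms
      unfolding d_coeff_def h_coeff_def v3_v2_coeff_def k_coeff_def structure_coeff_def max_def unfolding e by (smt (z3))
  qed

text \<open>The first sum collects the commutators \<open>[J m, J (- m)]\<close>, the second the
  brackets \<open>[v2, v2]\<close> of the symmetrised products; both multiply
  \<open>s * v2 F (i + j - 3 * e)\<close>. Each is a cubic polynomial in \<open>x = i - e\<close>
  and \<open>y = j - e\<close>; the factor 6 clears denominators.\<close>

lemma central_term: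
  assumes ij: "0 \<le> i" "0 \<le> j" "i \<noteq> j" "3 * e \<le> i + j"
  shows "(\<Sum>m\<in>{- (i + j)..i + j}. m * d_coeff i j (i + j - 3 * e) m) +
    (\<Sum>c\<in>{0..i + j - 2 * e}. (i - e - c - k_coeff i j c) * (i + j - 2 * e - 2 * c)) = 0"
proof -
  define x y N where "x = i - e" "y = j - e" "N = i + j - 2 * e"
  have xy: "-1 \<le> x" "-1 \<le> y" "0 \<le> N" "N = x + y" "i = x + e" "j = y + e" "y \<le> N + 1" "x \<le> N + 1"
    using ij e by (auto simp: x_y_N_def)
  have 1: "(\<Sum>m\<in>{- (i + j)..i + j}. m * d_coeff i j (i + j - 3 * e) m)
    = 2 * (\<Sum>m\<in>{1..i + j}. m * d_coeff i j (i + j - 3 * e) m)"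
    by (rule sum_odd) (use ij d_coeff_antisymmetric[of i j "i + j - 3 * e"] in auto)
  have "(\<Sum>m\<in>{1..i + j}. m * d_coeff i j (i + j - 3 * e) m) = (\<Sum>m\<in>{0..y}. m * (y - x - 2 * m))"
    by (rule sum.mono_neutral_cong) (use ij e in \<open>auto simp: d_coeff_diagonal x_y_N_def\<close>)
  also have "6 * \<dots> = (\<Sum>m\<in>{0..y}. 6 * (m * (y - x - 2 * m)))" by (simp add: sum_distrib_left)
  also have "\<dots> = 3 * (y - x) * ((y + 1) * y) - 2 * ((y + 1) * y * (2 * y + 1))"
    \<comment> \<open>The summation polynomials are built from \<open>m * (m - 1) / 2\<close> and
      \<open>m * (m - 1) * (2 * m - 1) / 6\<close>, the sums of \<open>k\<close> and of
      \<open>k ^ 2\<close> over \<open>k < m\<close>.\<close>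
    by (subst int_sum_telescope[where h = "\<lambda>m. 3 * (y - x) * (m * (m - 1)) - 2 * (m * (m - 1) * (2 * m - 1))"])
       (use xy in \<open>auto simp: algebra_simps\<close>)
  finally have 2: "6 * (\<Sum>m\<in>{1..i + j}. m * d_coeff i j (i + j - 3 * e) m) = 
     3 * (y - x) * ((y + 1) * y) - 2 * ((y + 1) * y * (2 * y + 1))" .
  \<comment> \<open>Both \<open>max\<close> terms of \<open>k_coeff\<close> have this form, with
    \<open>z = x\<close> and \<open>z = y\<close>, because
    \<open>c - y = x - (N - c)\<close>.\<close>
  have pos: "6 * (\<Sum>c\<in>{0..N}. max 0 (z - (N - c)) * (N - 2 * c)) = z * (z + 1) * (2 * z - 2 - 3 * N)"
    if z: "-1 \<le> z" "z \<le> N + 1" for z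
  proof -
    have "(\<Sum>c\<in>{0..N}. max 0 (z - (N - c)) * (N - 2 * c)) = (\<Sum>c\<in>{0..N}. max 0 (z - c) * (2 * c - N))"
      by (rule sum.reindex_bij_witness[of _ "\<lambda>c. N - c" "\<lambda>c. N - c"]) auto
    also have "\<dots> = (\<Sum>c\<in>{0..z}. (z - c) * (2 * c - N))"
      by (rule sum.mono_neutral_cong) (use z in auto)
    also have "6 * \<dots> = (\<Sum>c\<in>{0..z}. 6 * ((z - c) * (2 * c - N)))" by (simp add: sum_distrib_left)
    also have "\<dots> = z * (z + 1) * (2 * z - 2 - 3 * N)"
      by (subst int_sum_telescope[where h = "\<lambda>c. 6 * z * (c * (c - 1)) - 6 * z * N * c - 2 * (c * (c - 1) * (2 * c - 1)) + 3 * N * (c * (c - 1))"])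
         (use z in \<open>auto simp: algebra_simps\<close>)
    finally show ?thesis .
  qed
  have 3: "6 * (\<Sum>c\<in>{0..N}. (y - c) * (N - 2 * c)) = N * (N + 1) * (N + 2)"
  proof -
    have "6 * (\<Sum>c\<in>{0..N}. (y - c) * (N - 2 * c)) = (\<Sum>c\<in>{0..N}. 6 * ((y - c) * (N - 2 * c)))"
      by (simp add: sum_distrib_left)
    also have "\<dots> = N * (N + 1) * (N + 2)"
      by (subst int_sum_telescope[where h = "\<lambda>c. 6 * y * N * c - 6 * y * (c * (c - 1)) - 3 * N * (c * (c - 1)) + 2 * (c * (c - 1) * (2 * c - 1))"])
         (use xy(3) in \<open>auto simp: algebra_simps\<close>)
    finally show ?thesis .
  qed
  have "(\<Sum>c\<in>{0..N}. (i - e - c - k_coeff i j c) * (N - 2 * c)) =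
    (\<Sum>c\<in>{0..N}. (y - c) * (N - 2 * c)) + (\<Sum>c\<in>{0..N}. max 0 (x - (N - c)) * (N - 2 * c))
    - (\<Sum>c\<in>{0..N}. max 0 (y - (N - c)) * (N - 2 * c))"
    unfolding sum.distrib[symmetric] sum_subtractf[symmetric]
    by (intro sum.cong) (auto simp: k_coeff_def xy(4-6) algebra_simps)
  then have "6 * (\<Sum>c\<in>{0..N}. (i - e - c - k_coeff i j c) * (N - 2 * c)) =
    N * (N + 1) * (N + 2) + x * (x + 1) * (2 * x - 2 - 3 * N) - y * (y + 1) * (2 * y - 2 - 3 * N)"
    using 3 pos[of x] pos[of y] xy by simp
  then have "6 * ((\<Sum>m\<in>{- (i + j)..i + j}. m * d_coeff i j (i + j - 3 * e) m) +
    (\<Sum>c\<in>{0..N}. (i - e - c - k_coeff i j c) * (N - 2 * c))) = 0"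
    using 1 2 by (simp add: xy(4) algebra_simps)
  then show ?thesis by (simp add: x_y_N_def)
qed

lemma Sum_any_sum:
  assumes "finite S" "\<And>x. x \<in> S \<Longrightarrow> finite {m. f m x \<noteq> (0::'b::comm_monoid_add)}"
  shows "Sum_any (\<lambda>m. \<Sum>x\<in>S. f m x) = (\<Sum>x\<in>S. Sum_any (\<lambda>m. f m x))"
  using assms
proof (induction S rule: finite_induct)
  case (insert x F)
  have "finite {m. (\<Sum>x\<in>F. f m x) \<noteq> 0}"
  proof (rule finite_subset)
    show "{m. (\<Sum>x\<in>F. f m x) \<noteq> 0} \<subseteq> (\<Union>x\<in>F. {m. f m x \<noteq> 0})"
      using sum.not_neutral_contains_not_neutral by fastforce
  qed (use insert in auto)
  with insert show ?case by (simp add: Sum_any.distrib)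
qed simp

section \<open>Brackets with the linear part of the constraints\<close>

lemma v2_v1_mixed:
  assumes "0 \<le> i" "0 \<le> j" "0 \<le> r"
  shows "v2 (v1 F (j + r)) i - v1 (v2 F i) (j + r) + (v1 (v2 F j) (i + r) - v2 (v1 F (i + r)) j) =
    s * (of_int (i - j) * (if 0 \<le> i + j - e then v1 F (i + j - e + r) else 0))"
proof -
  have 1: "v1 (v2 F i) (j + r) - v2 (v1 F (j + r)) i = s * (of_int (j + r) * v1 F (i + j - e + r))"
    using v1_v2[of "j + r" i F] assms by (simp add: algebra_simps)
  have 2: "v1 (v2 F j) (i + r) - v2 (v1 F (i + r)) j = s * (of_int (i + r) * v1 F (i + j - e + r))"
    using v1_v2[of "i + r" j F] assms by (simp add: algebra_simps)
  have "0 \<le> i + j - e \<or> i = j" using assms e by auto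
  moreover have "v2 (v1 F (j + r)) i - v1 (v2 F i) (j + r) + (v1 (v2 F j) (i + r) - v2 (v1 F (i + r)) j)
     = s * (of_int (i - j) * v1 F (i + j - e + r))"
    unfolding 2 using 1 by (simp add: algebra_simps)
  ultimately show ?thesis by auto
qed

text \<open>For a mode of nonnegative index no inner contraction occurs, and
  \<open>ad_v2 a c F\<close> is just a shifted multiple of \<open>v1\<close>.\<close>

lemma ad_v3_nonneg:
  assumes "0 \<le> a" "0 \<le> j" and C: "supported C (v1 F)"
  shows "ad_v3 a j F = (\<Sum>c\<in>{0..C}. of_int (if a - e \<le> c then a else 0) * J (j + a - 2 * e - c) (v1 F c))
    + b * (of_int (j * a) * v1 F (j + a - 2 * e)) + of_int a * v2 F (j + a - e)"
proof -
  have "step (\<lambda>c. if 0 \<le> c then ad_v2 a c F else 0) j = step (\<lambda>c. if 0 \<le> c then of_int a * v1 F (c + (a - e)) else 0) j"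
    using \<open>0 \<le> a\<close> by (intro step_cong) (cases "a = 0", auto simp: ad_v2_def algebra_simps)
  also have "\<dots> = (\<Sum>c\<in>{0..C}. of_int (if a - e \<le> c then a else 0) * J (j - e + (a - e) - c) (v1 F c))
    + b * (of_int (j * a) * v1 F (j - e + (a - e)))"
    by (rule step_shift[OF C \<open>0 \<le> j\<close>])
  also have "j - e + (a - e) = j + a - 2 * e" by simp
  finally show ?thesis by (simp add: ad_v3_def algebra_simps)
qed

text \<open>\<open>r = 1\<close> is the derivative part \<open>J (i + 1)\<close> of the constraint,
  \<open>r = 0\<close> its term \<open>v1\<close>. The explicit cut \<open>0 \<le> a\<close> matters
  for \<open>r = 1\<close>: at \<open>a = -1\<close> the value \<open>v1 F 0\<close> is
  \<open>J 0 F\<close>, whereas the constraint of index 0 is 0 by convention.\<close>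

lemma v3_v1_mixed:
  assumes i: "0 \<le> i" and j: "0 \<le> j" and r: "r = 0 \<or> r = 1"
  shows "v3 (v1 F (j + r)) i - v1 (v3 F i) (j + r) + (v1 (v3 F j) (i + r) - v3 (v1 F (i + r)) j) =
    s * structure_op i j (\<lambda>a. if 0 \<le> a then v1 F (a + r) else 0)"
proof (cases "i = j")
  case True
  then show ?thesis by (simp add: structure_op_def)
next
  case False
  define N where "N = i + j + r - 2 * e"
  have r': "0 \<le> r" using r by auto
  have pos: "0 \<le> i + j + r - e" using i j e r False by auto
  obtain C where C: "N \<le> C" "supported C (v1 F)"
    by (rule fin_familyE[OF fin_v1[of F], where ?B0.0 = N])
  have 1: "v1 (v3 F i) (j + r) - v3 (v1 F (j + r)) i = s * ad_v3 (j + r) i F"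
    using v1_v3[of "j + r" i F] assms by auto
  have 2: "v1 (v3 F j) (i + r) - v3 (v1 F (i + r)) j = s * ad_v3 (i + r) j F"
    using v1_v3[of "i + r" j F] assms by auto
  have X: "ad_v3 (i + r) j F - ad_v3 (j + r) i F =
    (\<Sum>c\<in>{0..C}. of_int ((if i + r - e \<le> c then i + r else 0) - (if j + r - e \<le> c then j + r else 0) + (i - j)) * J (N - c) (v1 F c))
    + b * (of_int (j * (i + r) - i * (j + r) + (i - j) * (i + j + r - e)) * v1 F N)"
  proof -
    have v: "v2 F (i + j + r - e) = (\<Sum>c\<in>{0..C}. J (N - c) (v1 F c)) + b * (of_int (i + j + r - e) * v1 F N)"
      unfolding v2_def using C pos by (subst step_eq[of "{0..C}"]) (auto simp: N_def algebra_simps)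
    have 3: "ad_v3 (i + r) j F = (\<Sum>c\<in>{0..C}. of_int (if i + r - e \<le> c then i + r else 0) * J (N - c) (v1 F c))
      + b * (of_int (j * (i + r)) * v1 F N) + of_int (i + r) * v2 F (i + j + r - e)"
      using ad_v3_nonneg[of "i + r" j, OF _ j C(2)] i r' by (simp add: N_def algebra_simps)
    have 4: "ad_v3 (j + r) i F = (\<Sum>c\<in>{0..C}. of_int (if j + r - e \<le> c then j + r else 0) * J (N - c) (v1 F c))
      + b * (of_int (i * (j + r)) * v1 F N) + of_int (j + r) * v2 F (i + j + r - e)"
      using ad_v3_nonneg[of "j + r" i, OF _ i C(2)] j r' by (simp add: N_def algebra_simps)
    have 5: "of_int (i + r) * v2 F (i + j + r - e) - of_int (j + r) * v2 F (i + j + r - e)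
      = (\<Sum>c\<in>{0..C}. of_int (i - j) * J (N - c) (v1 F c))
      + b * (of_int ((i - j) * (i + j + r - e)) * v1 F N)"
      unfolding left_diff_distrib[symmetric] v by (simp add: sum_distrib_left algebra_simps)
    have "ad_v3 (i + r) j F - ad_v3 (j + r) i F =
      ((\<Sum>c\<in>{0..C}. of_int (if i + r - e \<le> c then i + r else 0) * J (N - c) (v1 F c))
       - (\<Sum>c\<in>{0..C}. of_int (if j + r - e \<le> c then j + r else 0) * J (N - c) (v1 F c)))
      + (b * (of_int (j * (i + r)) * v1 F N) - b * (of_int (i * (j + r)) * v1 F N))
      + (of_int (i + r) * v2 F (i + j + r - e) - of_int (j + r) * v2 F (i + j + r - e))"
      unfolding 3 4 by (simp only: algebra_simps)
    then show ?thesis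
      unfolding 5
      by (simp only: of_int_add of_int_diff distrib_right left_diff_distrib sum.distrib sum_subtractf
           distrib_left right_diff_distrib) (simp only: algebra_simps)
  qed
  let ?w = "\<lambda>a. if 0 \<le> a then v1 F (a + r) else 0"
  have D: "structure_op i j ?w = (\<Sum>c\<in>{0..C}. of_int (if r \<le> c then structure_coeff i j (N - c) else 0) * J (N - c) (v1 F c))
    + b * (of_int ((i - j) * (i + j - e)) * v1 F N)"
  proof -
    have "(\<Sum>m. of_int (structure_coeff i j m) * J m (?w (i + j - 2 * e - m))) =
       (\<Sum>c. of_int (structure_coeff i j (N - c)) * J (N - c) (?w (i + j - 2 * e - (N - c))))"
      by (subst Sum_any_reflect[of _ N, symmetric]) simp
    also have "\<dots> = (\<Sum>c. of_int (if r \<le> c then structure_coeff i j (N - c) else 0) * J (N - c) (v1 F c))"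
      by (intro Sum_any.cong) (auto simp: N_def)
    also have "\<dots> = (\<Sum>c\<in>{0..C}. of_int (if r \<le> c then structure_coeff i j (N - c) else 0) * J (N - c) (v1 F c))"
      by (rule Sum_any.expand_superset) (use C in force)+
    finally have "(\<Sum>m. of_int (structure_coeff i j m) * J m (?w (i + j - 2 * e - m))) = \<dots>" .
    moreover have "of_int ((i - j) * (i + j - e)) * ?w (i + j - 2 * e) = of_int ((i - j) * (i + j - e)) * v1 F N"
    proof (cases "0 \<le> i + j - 2 * e")
      case False
      \<comment> \<open>Distinct nonnegative \<open>i\<close>, \<open>j\<close> with
        \<open>i + j < 2 * e\<close> leave only \<open>i + j = 1 = e\<close>.\<close>
      then have "i + j - e = 0" using e i j \<open>i \<noteq> j\<close> by auto
      then show ?thesis by simp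
    qed (simp add: N_def algebra_simps)
    ultimately show ?thesis unfolding structure_op_def by simp
  qed
  \<comment> \<open>The difference of the two weights of \<open>J (N - c) (v1 F c)\<close>;
    \<open>sum_v1_symmetric\<close> disposes of it.\<close>
  define \<kappa> where "\<kappa> = (\<lambda>c. (if i + r - e \<le> c then i + r else 0) - (if j + r - e \<le> c then j + r else 0) + (i - j)
     - (if r \<le> c then structure_coeff i j (N - c) else 0))"
  have anti: "\<kappa> c + \<kappa> c' = 0" if "0 \<le> c" "0 \<le> c'" "c + c' = i + j + r - 2 * e" for c c'
    using r e
    apply (elim disjE)
    subgoal premises p unfolding \<kappa>_def structure_coeff_def N_def unfolding p using i j that p by (smt (z3))
    subgoal premises p unfolding \<kappa>_def structure_coeff_def N_def unfolding p using i j that p by (smt (z3))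
    subgoal premises p unfolding \<kappa>_def structure_coeff_def N_def unfolding p using i j that p by (smt (z3))
    subgoal premises p unfolding \<kappa>_def structure_coeff_def N_def unfolding p using i j that p by (smt (z3))
    done
  have "(\<Sum>c\<in>{0..C}. of_int (\<kappa> c) * J (N - c) (v1 F c)) = 0"
  proof (rule sum_v1_symmetric)
    fix c assume "N < c" "0 \<le> c"
    then show "\<kappa> c = 0" using e r i j \<open>i \<noteq> j\<close> by (auto simp: \<kappa>_def structure_coeff_def N_def)
  next
    fix c assume "c \<le> N" "0 \<le> c"
    then show "\<kappa> c + \<kappa> (N - c) = 0" by (intro anti) (auto simp: N_def)
  qed (use C in auto)
  then have "(\<Sum>c\<in>{0..C}. of_int ((if i + r - e \<le> c then i + r else 0) - (if j + r - e \<le> c then j + r else 0) + (i - j)) * J (N - c) (v1 F c))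
     = (\<Sum>c\<in>{0..C}. of_int (if r \<le> c then structure_coeff i j (N - c) else 0) * J (N - c) (v1 F c))"
    unfolding \<kappa>_def of_int_diff[of "_ + (i - j)"] left_diff_distrib sum_subtractf by simp
  moreover have "j * (i + r) - i * (j + r) + (i - j) * (i + j + r - e) = (i - j) * (i + j - e)"
    by (simp add: algebra_simps)
  ultimately have "ad_v3 (i + r) j F - ad_v3 (j + r) i F = structure_op i j ?w" unfolding X D by simp
  then show ?thesis unfolding 2 using 1 by (simp add: algebra_simps)
qed

section \<open>The bracket of two cubic iterates\<close>

lemma v2_expand:
  assumes "0 \<le> i"
  shows "v2 G i = double_current (\<lambda>m. if m \<le> i - e then 1 else 0) (i - e) G + b * (of_int i * J (i - e) G)"
proof -
  have "v2 G i = step (\<lambda>a. if 0 \<le> a then of_int 1 * J (0 + a) G else 0) i"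
    unfolding v2_def by (intro step_cong) (simp add: v1_def)
  also have "\<dots> = double_current (\<lambda>m. if m \<le> i - e then 1 else 0) (0 + i - e) G
      + b * (of_int (i * 1) * J (0 + i - e) G)"
    by (rule step_shift_J(2)[OF assms])
  finally show ?thesis by simp
qed

lemma double_current_scale: "double_current (\<lambda>m. k * \<kappa> m) l x = of_int k * double_current \<kappa> l x"
  if "\<And>m. m > B \<Longrightarrow> \<kappa> m = 0"
  unfolding double_current_def using double_current_fin[of B \<kappa> l x] that
  by (subst Sum_any_right_distrib) (auto simp: algebra_simps)

text \<open>The pairing of \<open>c\<close> with \<open>N - c\<close> again, with
  \<open>v2_v2\<close> in place of the Heisenberg relation: each exchange costs
  \<open>N - 2 * c\<close>.\<close>

lemma sum_antisymmetric_v2: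
  assumes g: "\<And>c. 0 \<le> c \<Longrightarrow> c \<le> N \<Longrightarrow> g c + g (N - c) = 0"
  shows "(\<Sum>c\<in>{0..N}. of_int (g c) * v2 (v2 F c) (N - c)) + (\<Sum>c\<in>{0..N}. of_int (g c) * v2 (v2 F c) (N - c))
    = s * (of_int (\<Sum>c\<in>{0..N}. g c * (N - 2 * c)) * v2 F (N - e))" (is "?S + ?S = _")
proof -
  have "?S = (\<Sum>c\<in>{0..N}. of_int (g (N - c)) * v2 (v2 F (N - c)) (N - (N - c)))"
    by (rule sum.reindex_bij_witness[of _ "\<lambda>c. N - c" "\<lambda>c. N - c"]) auto
  also have "\<dots> = (\<Sum>c\<in>{0..N}. - (of_int (g c) * v2 (v2 F (N - c)) c))"
  proof (intro sum.cong refl)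
    fix c assume "c \<in> {0..N}"
    then have "g (N - c) = - g c" using g[of c] by auto
    then show "of_int (g (N - c)) * v2 (v2 F (N - c)) (N - (N - c)) = - (of_int (g c) * v2 (v2 F (N - c)) c)"
      by simp
  qed
  finally have "?S + ?S = (\<Sum>c\<in>{0..N}. of_int (g c) * (v2 (v2 F c) (N - c) - v2 (v2 F (N - c)) c))"
    by (simp add: right_diff_distrib sum_subtractf sum_negf)
  also have "\<dots> = (\<Sum>c\<in>{0..N}. s * (of_int (g c * (N - 2 * c)) * v2 F (N - e)))"
    by (intro sum.cong refl, subst v2_v2) (auto simp: algebra_simps)
  also have "\<dots> = s * (of_int (\<Sum>c\<in>{0..N}. g c * (N - 2 * c)) * v2 F (N - e))"
    by (simp add: sum_distrib_left sum_distrib_right)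
  finally show ?thesis .
qed

text \<open>The \<open>v2\<close> in the last term is left unexpanded, because its weight
  \<open>i - e - c\<close> has to be replaced by \<open>k_coeff\<close> before it is written in
  modes.\<close>

lemma ad_v3_expand:
  assumes j: "0 \<le> j"
  shows "ad_v3 (i - e - c) j G =
    double_current (\<lambda>m. if m \<le> j - e then h_coeff i c (j - e - m) else 0) (i + j - 3 * e - c) G
    + b * (of_int (j * h_coeff i c (j - e) + (if i - e \<le> c then (c - i + 2 * e) * (i - e - c) else 0)) * J (i + j - 3 * e - c) G)
    + b * (b * (if c = i + j - 3 * e then of_int (j * (j - e) * (2 * e - j)) * G else 0))
    + of_int (i - e - c) * v2 G (i + j - 2 * e - c)"
proof -
  let ?n = "i - e - c"
  let ?p = "\<lambda>a. if 0 \<le> a then of_int (h_coeff i c a) * J ((i - 2 * e - c) + a) G else 0"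
  let ?y = "of_int (if ?n \<le> 0 then (c - i + 2 * e) * ?n else 0) * G"
  let ?q = "\<lambda>a. if 0 \<le> a \<and> a = c - i + 2 * e then ?y else 0"
  have q: "fin_family ?q" by (intro fin_familyI[of _ "c - i + 2 * e"]) auto
  have X: "(if 0 \<le> a then ad_v2 ?n a G else 0) = ?p a + b * ?q a" for a
  proof -
    show ?thesis
    proof (cases "a = c - i + 2 * e")
      case True
      show ?thesis unfolding ad_v2_def v1_def h_coeff_def unfolding True by (auto simp: algebra_simps)
    qed (unfold ad_v2_def v1_def h_coeff_def, auto simp: algebra_simps)
  qed
  have "step (\<lambda>a. if 0 \<le> a then ad_v2 ?n a G else 0) j = step ?p j + b * step ?q j"
  proof -
    have bq: "fin_family (\<lambda>a. b * ?q a)" by (rule fin_family_map[OF q]) auto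
    show ?thesis
      unfolding X step_add[OF step_shift_J(1)[OF j, of "h_coeff i c" "i - 2 * e - c" G] bq] step_scale[OF b_K q] ..
  qed
  also have "step ?p j = double_current (\<lambda>m. if m \<le> j - e then h_coeff i c (j - e - m) else 0) (i - 2 * e - c + j - e) G
    + b * (of_int (j * h_coeff i c (j - e)) * J (i - 2 * e - c + j - e) G)"
    by (rule step_shift_J(2)[OF j])
  also have "i - 2 * e - c + j - e = i + j - 3 * e - c" by simp
  also have "step ?q j = of_int (if i - e \<le> c then (c - i + 2 * e) * ?n else 0) * J (i + j - 3 * e - c) G
    + b * (if c = i + j - 3 * e then of_int (j * (j - e) * (2 * e - j)) * G else 0)"
  proof (cases "?n \<le> 0")
    case True
    have arg: "j - e - (c - i + 2 * e) = i + j - 3 * e - c" by simp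
    show ?thesis
    proof (cases "c = i + j - 3 * e")
      case c: True
      show ?thesis using True j e unfolding step_point arg J_of_int unfolding c by (auto simp: algebra_simps)
    next
      case False
      then show ?thesis using True j e unfolding step_point arg J_of_int by auto
    qed
  next
    case False
    then have "step ?q j = 0" unfolding step_point by simp
    \<comment> \<open>Without the point mass the term in \<open>b * b\<close> has to vanish too:
      here \<open>j < 2 * e\<close>, so \<open>j = 0\<close> or \<open>j = e\<close>, both roots of
      the product.\<close>
    moreover have "of_int (j * (j - e) * (2 * e - j)) * G = 0" if "c = i + j - 3 * e"
    proof -
      have "j < 2 * e" using False that by simp
      then have "j = 0 \<or> j = e" using j e by auto
      then show ?thesis by auto
    qed
    ultimately show ?thesis using False by auto
  qed
  finally show ?thesis
    unfolding ad_v3_def by (simp add: algebra_simps)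
qed

text \<open>The value of \<open>v3_v2\<close> for \<open>[v3 j, v2 a]\<close> without the factor
  \<open>s\<close>, as a family in \<open>a\<close> so that \<open>step\<close> can be applied to
  it.\<close>

definition v3_v2_family :: "int \<Rightarrow> int \<Rightarrow> 'a \<Rightarrow> int \<Rightarrow> 'a" where
  "v3_v2_family C j F a = (if 0 \<le> a then (\<Sum>c\<in>{0..C}. of_int (v3_v2_coeff j a c) * J (j + a - 2 * e - c) (v2 F c))
      + b * (of_int (j * (j - e - a) + a * (e - a)) * v2 F (j + a - 2 * e)) else 0)"

lemma step_v3_v2_family:
  assumes i: "0 \<le> i" and j: "0 \<le> j" and C: "supported C (v2 F)"
  shows "fin_family (v3_v2_family C j F)"
    and "step (v3_v2_family C j F) i =
    (\<Sum>c\<in>{0..C}. double_current (\<lambda>m. if m \<le> i - e then v3_v2_coeff j (i - e - m) c else 0) (i + j - 3 * e - c) (v2 F c)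
      + b * (of_int (i * v3_v2_coeff j (i - e) c + (if j - 2 * e \<le> c
          then j * (j - e - (c - (j - 2 * e))) + (c - (j - 2 * e)) * (e - (c - (j - 2 * e))) else 0))
        * J (i + j - 3 * e - c) (v2 F c)))
    + b * (b * (of_int (i * (j * (j - e - (i - e)) + (i - e) * (e - (i - e)))) * v2 F (i + j - 3 * e)))" (is "_ = ?rhs")
proof -
  let ?\<beta> = "\<lambda>a. j * (j - e - a) + a * (e - a)"
  let ?p = "\<lambda>c a. if 0 \<le> a then of_int (v3_v2_coeff j a c) * J ((j - 2 * e - c) + a) (v2 F c) else 0"
  let ?q = "\<lambda>a. if 0 \<le> a then of_int (?\<beta> a) * v2 F (a + (j - 2 * e)) else 0"
  have q: "fin_family ?q"
    by (rule fin_family_map[OF fin_family_shift[OF fin_v2[of F], of "j - 2 * e"]]) auto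
  have p: "fin_family (?p c)" for c by (rule step_shift_J(1)[OF i])
  have v3_v2_family: "v3_v2_family C j F = (\<lambda>a. (\<Sum>c\<in>{0..C}. ?p c a) + b * ?q a)"
  proof
    fix a
    have 1: "j + a - 2 * e - c = (j - 2 * e - c) + a" for c by simp
    have 2: "j + a - 2 * e = a + (j - 2 * e)" by simp
    show "v3_v2_family C j F a = (\<Sum>c\<in>{0..C}. ?p c a) + b * ?q a"
      unfolding v3_v2_family_def 1 unfolding 2 by simp
  qed
  have bq: "fin_family (\<lambda>a. b * ?q a)" by (rule fin_family_map[OF q]) auto
  show "fin_family (v3_v2_family C j F)"
    unfolding v3_v2_family using p bq by (intro fin_family_add fin_family_sum) auto
  have "step (v3_v2_family C j F) i = step (\<lambda>a. (\<Sum>c\<in>{0..C}. ?p c a) + b * ?q a) i"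
    unfolding v3_v2_family ..
  also have "\<dots> = (\<Sum>c\<in>{0..C}. step (?p c) i) + b * step ?q i"
    using p q bq fin_family_sum[of "{0..C}" ?p]
    by (subst step_add) (simp_all only: step_scale step_sum b_K)
  also have "step ?q i = (\<Sum>c\<in>{0..C}. of_int (if j - 2 * e \<le> c then ?\<beta> (c - (j - 2 * e)) else 0) * J (i - e + (j - 2 * e) - c) (v2 F c))
    + b * (of_int (i * ?\<beta> (i - e)) * v2 F (i - e + (j - 2 * e)))"
    by (rule step_shift[OF C i])
  also have "i - e + (j - 2 * e) = i + j - 3 * e" by simp
  also have "(\<Sum>c\<in>{0..C}. step (?p c) i) = (\<Sum>c\<in>{0..C}. double_current (\<lambda>m. if m \<le> i - e then v3_v2_coeff j (i - e - m) c else 0) (i + j - 3 * e - c) (v2 F c)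
      + b * (of_int (i * v3_v2_coeff j (i - e) c) * J (i + j - 3 * e - c) (v2 F c)))"
  proof (rule sum.cong)
    fix c
    have k: "j - 2 * e - c + i - e = i + j - 3 * e - c" by simp
    show "step (?p c) i = double_current (\<lambda>m. if m \<le> i - e then v3_v2_coeff j (i - e - m) c else 0) (i + j - 3 * e - c) (v2 F c)
      + b * (of_int (i * v3_v2_coeff j (i - e) c) * J (i + j - 3 * e - c) (v2 F c))"
      using step_shift_J(2)[OF i, of "\<lambda>a. v3_v2_coeff j a c" "j - 2 * e - c" "v2 F c"] unfolding k .
  qed simp
  finally show "step (v3_v2_family C j F) i = ?rhs"
    by (simp only: of_int_add[of "i * v3_v2_coeff _ _ _"] distrib_right distrib_left sum.distrib sum_distrib_left add.assoc)
qed

text \<open>The outer weight is cut at \<open>m \<le> i + j - 2 * e\<close> because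
  \<open>v3\<close> vanishes at negative indices. For the \<open>b\<close>-term the expansion of
  \<open>v3\<close> is valid only at a nonnegative index; the first hypothesis says that otherwise
  its prefactor is 0.\<close>

lemma structure_op_v3:
  assumes ij: "0 \<le> i + j - 2 * e \<or> (i - j) * (i + j - e) = 0" and C: "supported C (v2 F)"
  shows "structure_op i j (v3 F) =
    (\<Sum>c\<in>{0..C}. double_current (\<lambda>m. if m \<le> i + j - 2 * e then structure_coeff i j m else 0) (i + j - 3 * e - c) (v2 F c)
      + b * (of_int (structure_coeff i j (i + j - 3 * e - c) * (c + e) + (i - j) * (i + j - e)) * J (i + j - 3 * e - c) (v2 F c)))
    + b * (b * (of_int ((i - j) * (i + j - e) * (i + j - 2 * e)) * v2 F (i + j - 3 * e)))"
proof -
  define N where "N = i + j - 2 * e"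
  have N': "i + j - 3 * e = N - e" by (simp add: N_def)
  let ?t = "\<lambda>m. if m \<le> N then structure_coeff i j m else 0"
  have fin1: "finite {m. of_int (?t m) * J m (J (N - e - c - m) x) \<noteq> 0}" for c x
    by (rule double_current_fin[of N]) auto
  have fin2: "finite {m. of_int (?t m * (N - m)) * J m (v2 F (N - e - m)) \<noteq> 0}"
    by (rule finite_subset[of _ "{N - e - C..N - e}"]) (use C in \<open>auto simp: not_less[symmetric]\<close>)
  have "(\<Sum>m. of_int (structure_coeff i j m) * J m (v3 F (N - m))) =
     (\<Sum>m. (\<Sum>c\<in>{0..C}. of_int (?t m) * J m (J (N - e - c - m) (v2 F c)))
       + b * (of_int (?t m * (N - m)) * J m (v2 F (N - e - m))))"
  proof (intro Sum_any.cong)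
    fix m
    have "N - m - e - c = N - e - c - m" "N - m - e = N - e - m" for c by auto
    then show "of_int (structure_coeff i j m) * J m (v3 F (N - m)) =
      (\<Sum>c\<in>{0..C}. of_int (?t m) * J m (J (N - e - c - m) (v2 F c)))
       + b * (of_int (?t m * (N - m)) * J m (v2 F (N - e - m)))"
      unfolding v3_def using C
      by (subst step_eq[of "{0..C}"]) (auto simp: J_linear J_sum sum_distrib_left algebra_simps)
  qed
  also have "\<dots> = (\<Sum>m. \<Sum>c\<in>{0..C}. of_int (?t m) * J m (J (N - e - c - m) (v2 F c)))
       + (\<Sum>m. b * (of_int (?t m * (N - m)) * J m (v2 F (N - e - m))))"
  proof (rule Sum_any.distrib)
    show "finite {m. (\<Sum>c\<in>{0..C}. of_int (?t m) * J m (J (N - e - c - m) (v2 F c))) \<noteq> 0}"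
    proof (rule finite_subset)
      show "{m. (\<Sum>c\<in>{0..C}. of_int (?t m) * J m (J (N - e - c - m) (v2 F c))) \<noteq> 0}
         \<subseteq> (\<Union>c\<in>{0..C}. {m. of_int (?t m) * J m (J (N - e - c - m) (v2 F c)) \<noteq> 0})"
        using sum.not_neutral_contains_not_neutral by fastforce
    qed (use fin1 in auto)
    show "finite {m. b * (of_int (?t m * (N - m)) * J m (v2 F (N - e - m))) \<noteq> 0}"
      by (rule finite_subset[OF _ fin2]) auto
  qed
  also have "(\<Sum>m. \<Sum>c\<in>{0..C}. of_int (?t m) * J m (J (N - e - c - m) (v2 F c))) =
      (\<Sum>c\<in>{0..C}. double_current ?t (N - e - c) (v2 F c))"
    unfolding double_current_def using fin1 by (subst Sum_any_sum) auto
  also have "(\<Sum>m. b * (of_int (?t m * (N - m)) * J m (v2 F (N - e - m)))) =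
      (\<Sum>c. b * (of_int (?t (N - e - c) * (c + e)) * J (N - e - c) (v2 F c)))"
  proof -
    have "N - (N - e - c) = c + e" "N - e - (N - e - c) = c" for c by auto
    then show ?thesis
      using Sum_any_reflect[of "\<lambda>m. b * (of_int (?t m * (N - m)) * J m (v2 F (N - e - m)))" "N - e"]
      by (simp only:)
  qed
  also have "\<dots> = (\<Sum>c\<in>{0..C}. b * (of_int (?t (N - e - c) * (c + e)) * J (N - e - c) (v2 F c)))"
    by (rule Sum_any.expand_superset) (use C in force)+
  also have "\<dots> = (\<Sum>c\<in>{0..C}. b * (of_int (structure_coeff i j (N - e - c) * (c + e)) * J (N - e - c) (v2 F c)))"
    using e by (intro sum.cong refl) auto
  finally have 1: "(\<Sum>m. of_int (structure_coeff i j m) * J m (v3 F (N - m))) =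
    (\<Sum>c\<in>{0..C}. double_current ?t (N - e - c) (v2 F c)) +
    (\<Sum>c\<in>{0..C}. b * (of_int (structure_coeff i j (N - e - c) * (c + e)) * J (N - e - c) (v2 F c)))" .
  have 2: "of_int ((i - j) * (i + j - e)) * v3 F N =
    (\<Sum>c\<in>{0..C}. of_int ((i - j) * (i + j - e)) * J (N - e - c) (v2 F c))
    + b * (of_int ((i - j) * (i + j - e) * N) * v2 F (N - e))"
    using ij
  proof
    assume "0 \<le> i + j - 2 * e"
    then have "0 \<le> N" by (simp add: N_def)
    then have "v3 F N = (\<Sum>c\<in>{0..C}. J (N - e - c) (v2 F c)) + b * (of_int N * v2 F (N - e))"
      unfolding v3_def using C by (subst step_eq[of "{0..C}"]) auto
    then show ?thesis by (simp add: distrib_left sum_distrib_left mult.left_commute mult.assoc)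
  next
    assume "(i - j) * (i + j - e) = 0"
    then show ?thesis
      by (simp only: of_int_0 mult_zero_left mult_zero_right sum.neutral_const add_0)
  qed
  show ?thesis
    unfolding structure_op_def N' N_def[symmetric] 1 2
    by (simp only: of_int_add[of "structure_coeff _ _ _ * _"] distrib_right distrib_left sum.distrib sum_distrib_left add.assoc)
qed

lemma v3_v3:
  assumes i: "0 \<le> i" and j: "0 \<le> j"
  shows "v3 (v3 F j) i - v3 (v3 F i) j = s * structure_op i j (v3 F)"
proof (cases "i = j")
  case True
  then show ?thesis by (simp add: structure_op_def)
next
  case False
  define N N' f where "N = i + j - 2 * e" and "N' = i + j - 3 * e" and "f = v2 F"
  obtain C where C: "N \<le> C" "supported C (v2 F)"
    by (rule fin_familyE[OF fin_v2[of F], where ?B0.0 = N])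
  have N'C: "N' \<le> C" using C e by (auto simp: N_def N'_def)
  have f0: "c < 0 \<Longrightarrow> f c = 0" for c by (simp add: f_def v2_neg)
  have finG: "fin_family (v3_v2_family C j F)" by (rule step_v3_v2_family(1)[OF i j C(2)])
  have finsG: "fin_family (\<lambda>a. s * v3_v2_family C j F a)" by (rule fin_family_map[OF finG]) auto
  have fin3: "fin_family (\<lambda>c. v3 (v2 F c) j)"
    by (rule fin_family_map[OF fin_v2[of F]]) auto
  have "v3 (v3 F j) i = step (\<lambda>c. v3 (v2 F c) j - s * v3_v2_family C j F c) i"
    unfolding v3_def[of "v3 F j"]
  proof (rule step_cong)
    fix a
    show "v2 (v3 F j) a = v3 (v2 F a) j - s * v3_v2_family C j F a"
    proof (cases "0 \<le> a")
      case True
      show ?thesis using v3_v2[OF j True C(2)] True by (simp add: v3_v2_family_def algebra_simps)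
    qed (simp add: v3_v2_family_def v2_neg)
  qed
  also have "\<dots> = step (\<lambda>c. v3 (v2 F c) j) i - s * step (v3_v2_family C j F) i"
    by (simp only: step_diff[OF fin3 finsG] step_scale[OF s_K finG])
  finally have 1: "v3 (v3 F j) i = step (\<lambda>c. v3 (v2 F c) j) i - s * step (v3_v2_family C j F) i" .
  have 2: "step (\<lambda>c. v3 (v2 F c) j) i - v3 (v3 F i) j = (\<Sum>c\<in>{0..C}. s * ad_v3 (i - e - c) j (v2 F c))"
    unfolding v3_def[of F]
    by (rule step_commutator) (use C i j in \<open>auto simp: v3_add v3_scale b_K v3_J\<close>)
  have 3: "v3 (v3 F j) i - v3 (v3 F i) j = s * ((\<Sum>c\<in>{0..C}. ad_v3 (i - e - c) j (v2 F c)) - step (v3_v2_family C j F) i)"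
    using 1 2 by (simp add: sum_distrib_left algebra_simps)

  \<comment> \<open>The weight \<open>i - e - c\<close> is split: the \<open>k_coeff\<close> part is
    expanded in modes and joins the other double currents, while \<open>S2\<close>, whose weight is
    antisymmetric, stays a sum of products of two \<open>v2\<close>.\<close>
  define S2 where "S2 = (\<Sum>c\<in>{0..N}. of_int (i - e - c - k_coeff i j c) * v2 (f c) (N - c))"
  define \<kappa> where "\<kappa> = (\<lambda>c m. if m \<le> N' - c \<and> c \<le> N then k_coeff i j c else 0)"
  have "(\<Sum>c\<in>{0..C}. of_int (i - e - c) * v2 (f c) (N - c)) = (\<Sum>c\<in>{0..N}. of_int (i - e - c) * v2 (f c) (N - c))"
    by (rule sum.mono_neutral_right) (use C in \<open>auto simp: v2_neg\<close>)
  also have "\<dots> = (\<Sum>c\<in>{0..N}. of_int (k_coeff i j c) * v2 (f c) (N - c)) + S2"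
    unfolding S2_def sum.distrib[symmetric] by (intro sum.cong) (auto simp: algebra_simps)
  also have "(\<Sum>c\<in>{0..N}. of_int (k_coeff i j c) * v2 (f c) (N - c)) =
    (\<Sum>c\<in>{0..C}. double_current (\<kappa> c) (N' - c) (f c)
      + b * (of_int (if c \<le> N then k_coeff i j c * (N - c) else 0) * J (N' - c) (f c)))"
  proof (rule sum.mono_neutral_cong_left)
    show "\<forall>c\<in>{0..C} - {0..N}. double_current (\<kappa> c) (N' - c) (f c)
      + b * (of_int (if c \<le> N then k_coeff i j c * (N - c) else 0) * J (N' - c) (f c)) = 0"
      by (auto simp: \<kappa>_def double_current_def)
  next
    fix c assume c: "c \<in> {0..N}"
    have k: "N - c - e = N' - c" by (simp add: N_def N'_def)
    have v: "v2 (f c) (N - c) = double_current (\<lambda>m. if m \<le> N' - c then 1 else 0) (N' - c) (f c)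
        + b * (of_int (N - c) * J (N' - c) (f c))"
      using v2_expand[of "N - c" "f c"] c unfolding k by simp
    have "of_int (k_coeff i j c) * double_current (\<lambda>m. if m \<le> N' - c then 1 else 0) (N' - c) (f c)
        = double_current (\<lambda>m. k_coeff i j c * (if m \<le> N' - c then 1 else 0)) (N' - c) (f c)"
      by (rule double_current_scale[symmetric, of "N' - c"]) auto
    also have "\<dots> = double_current (\<kappa> c) (N' - c) (f c)"
      by (rule double_current_cong) (use c in \<open>auto simp: \<kappa>_def\<close>)
    finally show "of_int (k_coeff i j c) * v2 (f c) (N - c) = double_current (\<kappa> c) (N' - c) (f c)
      + b * (of_int (if c \<le> N then k_coeff i j c * (N - c) else 0) * J (N' - c) (f c))"
      unfolding v using c by (simp add: algebra_simps)
  qed (use C in auto)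
  finally have 4: "(\<Sum>c\<in>{0..C}. of_int (i - e - c) * v2 (f c) (N - c)) =
    (\<Sum>c\<in>{0..C}. double_current (\<kappa> c) (N' - c) (f c)
      + b * (of_int (if c \<le> N then k_coeff i j c * (N - c) else 0) * J (N' - c) (f c))) + S2" .

  \<comment> \<open>From here the difference of both sides is sorted by explicit powers of
    \<open>b\<close>: \<open>dW\<close> without \<open>b\<close>, the primed weights with one
    \<open>b\<close>, and \<open>b2\<close> with two.\<close>
  define dW where "dW = (\<lambda>c. double_current (d_coeff i j c) (N' - c) (f c))"
  define b2 where "b2 = j * (j - e) * (2 * e - j)
    - i * (j * (j - e - (i - e)) + (i - e) * (e - (i - e))) - (i - j) * (i + j - e) * N"
  let ?h = "\<lambda>c m. if m \<le> j - e then h_coeff i c (j - e - m) else 0"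
  let ?P = "\<lambda>c m. if m \<le> i - e then v3_v2_coeff j (i - e - m) c else 0"
  let ?t = "\<lambda>m. if m \<le> N then structure_coeff i j m else 0"
  have dW: "dW c = double_current (?h c) (N' - c) (f c) - double_current (?P c) (N' - c) (f c) + double_current (\<kappa> c) (N' - c) (f c) - double_current ?t (N' - c) (f c)"
    if c: "0 \<le> c" for c
  proof -
    have z: "?h c m = 0" "?P c m = 0" "\<kappa> c m = 0" "?t m = 0" if "m > i + j" for m
      using that i j e c by (auto simp: \<kappa>_def N_def N'_def)
    have "dW c = double_current (\<lambda>m. ?h c m - ?P c m + \<kappa> c m - ?t m) (N' - c) (f c)"
      unfolding dW_def by (rule double_current_cong) (simp add: d_coeff_def \<kappa>_def N_def N'_def)
    also have "\<dots> = double_current (\<lambda>m. ?h c m - ?P c m + \<kappa> c m) (N' - c) (f c) - double_current ?t (N' - c) (f c)"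
      by (rule double_current_diff[of "i + j"]) (use z in auto)
    also have "double_current (\<lambda>m. ?h c m - ?P c m + \<kappa> c m) (N' - c) (f c) =
      double_current (\<lambda>m. ?h c m - ?P c m) (N' - c) (f c) + double_current (\<kappa> c) (N' - c) (f c)"
      by (rule double_current_add[of "i + j"]) (use z in auto)
    also have "double_current (\<lambda>m. ?h c m - ?P c m) (N' - c) (f c) = double_current (?h c) (N' - c) (f c) - double_current (?P c) (N' - c) (f c)"
      by (rule double_current_diff[of "i + j"]) (use z in auto)
    finally show ?thesis .
  qed
  let ?h' = "\<lambda>c. j * h_coeff i c (j - e) + (if i - e \<le> c then (c - i + 2 * e) * (i - e - c) else 0)"
  let ?P' = "\<lambda>c. i * v3_v2_coeff j (i - e) c + (if j - 2 * e \<le> c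
          then j * (j - e - (c - (j - 2 * e))) + (c - (j - 2 * e)) * (e - (c - (j - 2 * e))) else 0)"
  let ?k' = "\<lambda>c. if c \<le> N then k_coeff i j c * (N - c) else 0"
  let ?t' = "\<lambda>c. structure_coeff i j (N' - c) * (c + e) + (i - j) * (i + j - e)"
  have X: "(\<Sum>c\<in>{0..C}. ad_v3 (i - e - c) j (v2 F c)) =
    (\<Sum>c\<in>{0..C}. double_current (?h c) (N' - c) (f c) + b * (of_int (?h' c) * J (N' - c) (f c)))
    + (\<Sum>c\<in>{0..C}. of_int (i - e - c) * v2 (f c) (N - c))
    + b * (b * (of_int (j * (j - e) * (2 * e - j)) * f N'))"
  proof -
    have "(\<Sum>c\<in>{0..C}. b * (b * (if c = N' then of_int (j * (j - e) * (2 * e - j)) * f c else 0))) =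
      (\<Sum>c\<in>{0..C}. if c = N' then b * (b * (of_int (j * (j - e) * (2 * e - j)) * f c)) else 0)"
      by (intro sum.cong) auto
    also have "\<dots> = b * (b * (of_int (j * (j - e) * (2 * e - j)) * f N'))"
      using N'C f0[of N'] by (auto simp: not_le)
    finally show ?thesis
      unfolding ad_v3_expand[OF j] f_def[symmetric] N'_def[symmetric] N_def[symmetric]
      by (simp only: sum.distrib) (simp only: ac_simps)
  qed
  have D: "structure_op i j (v3 F) = (\<Sum>c\<in>{0..C}. double_current ?t (N' - c) (f c) + b * (of_int (?t' c) * J (N' - c) (f c)))
    + b * (b * (of_int ((i - j) * (i + j - e) * N) * f N'))"
    unfolding N_def N'_def f_def
  proof (rule structure_op_v3[OF _ C(2)])
    show "0 \<le> i + j - 2 * e \<or> (i - j) * (i + j - e) = 0" using e i j False by auto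
  qed
  have G: "step (v3_v2_family C j F) i = (\<Sum>c\<in>{0..C}. double_current (?P c) (N' - c) (f c) + b * (of_int (?P' c) * J (N' - c) (f c)))
    + b * (b * (of_int (i * (j * (j - e - (i - e)) + (i - e) * (e - (i - e)))) * f N'))"
    unfolding N_def N'_def f_def by (rule step_v3_v2_family(2)[OF i j C(2)])
  have b2: "b2 = 0" by (simp add: b2_def N_def algebra_simps)
  have db: "?h' c - ?P' c + ?k' c - ?t' c = 0" if "0 \<le> c" for c
    using db_coeff_eq_0[OF i j False that] unfolding db_coeff_def N_def N'_def by linarith
  have "(\<Sum>c\<in>{0..C}. ad_v3 (i - e - c) j (v2 F c)) - step (v3_v2_family C j F) i - structure_op i j (v3 F) =
    (\<Sum>c\<in>{0..C}. dW c + b * (of_int (?h' c - ?P' c + ?k' c - ?t' c) * J (N' - c) (f c)))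
    + S2 + b * (b * (of_int b2 * f N'))"
  proof -
    have "(\<Sum>c\<in>{0..C}. dW c + b * (of_int (?h' c - ?P' c + ?k' c - ?t' c) * J (N' - c) (f c))) =
      (\<Sum>c\<in>{0..C}. double_current (?h c) (N' - c) (f c) + b * (of_int (?h' c) * J (N' - c) (f c)))
      - (\<Sum>c\<in>{0..C}. double_current (?P c) (N' - c) (f c) + b * (of_int (?P' c) * J (N' - c) (f c)))
      + (\<Sum>c\<in>{0..C}. double_current (\<kappa> c) (N' - c) (f c) + b * (of_int (?k' c) * J (N' - c) (f c)))
      - (\<Sum>c\<in>{0..C}. double_current ?t (N' - c) (f c) + b * (of_int (?t' c) * J (N' - c) (f c)))"
      unfolding sum.distrib[symmetric] sum_subtractf[symmetric]
    proof (intro sum.cong refl)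
      fix c assume "c \<in> {0..C}"
      then have "0 \<le> c" by simp
      show "dW c + b * (of_int (?h' c - ?P' c + ?k' c - ?t' c) * J (N' - c) (f c)) =
       double_current (?h c) (N' - c) (f c) + b * (of_int (?h' c) * J (N' - c) (f c))
      - (double_current (?P c) (N' - c) (f c) + b * (of_int (?P' c) * J (N' - c) (f c)))
      + (double_current (\<kappa> c) (N' - c) (f c) + b * (of_int (?k' c) * J (N' - c) (f c)))
      - (double_current ?t (N' - c) (f c) + b * (of_int (?t' c) * J (N' - c) (f c)))"
        unfolding dW[OF \<open>0 \<le> c\<close>] of_int_diff[of _ "?t' c"] of_int_add[of "?h' c - ?P' c"] of_int_diff[of "?h' c"]
        by (simp only: algebra_simps)
    qed
    then show ?thesis
      unfolding X 4 D G b2_def of_int_diff[of _ "(i - j) * (i + j - e) * N"] of_int_diff[of "j * (j - e) * (2 * e - j)"]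
      by (simp only: left_diff_distrib right_diff_distrib) (simp only: algebra_simps)
  qed
  also have "\<dots> = (\<Sum>c\<in>{0..C}. dW c) + S2"
    using db b2 by simp
  finally have 5: "(\<Sum>c\<in>{0..C}. ad_v3 (i - e - c) j (v2 F c)) - step (v3_v2_family C j F) i - structure_op i j (v3 F) =
    (\<Sum>c\<in>{0..C}. dW c) + S2" .
  have dW2: "dW c + dW c = (if N' - c = 0 then
    of_int (\<Sum>m\<in>{- (i + j)..i + j}. m * d_coeff i j c m) * (s * f c) else 0)" if c: "0 \<le> c" for c
    unfolding dW_def
  proof (rule double_current_antisymmetric)
    fix m show "d_coeff i j c m + d_coeff i j c (N' - c - m) = 0"
      unfolding N'_def by (rule d_coeff_antisymmetric[OF i j False c])
  next
    fix m assume "i + j < m"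
    then show "d_coeff i j c m = 0" using i j e c by (auto simp: d_coeff_def)
  qed
  have "(\<Sum>c\<in>{0..C}. dW c) + (\<Sum>c\<in>{0..C}. dW c) =
    (\<Sum>c\<in>{0..C}. if c = N' then of_int (\<Sum>m\<in>{- (i + j)..i + j}. m * d_coeff i j N' m) * (s * f N') else 0)"
    unfolding sum.distrib[symmetric] by (intro sum.cong refl) (auto simp: dW2)
  also have "\<dots> = of_int (\<Sum>m\<in>{- (i + j)..i + j}. m * d_coeff i j N' m) * (s * f N')"
    using N'C f0[of N'] by (auto simp: not_le)
  finally have 6: "(\<Sum>c\<in>{0..C}. dW c) + (\<Sum>c\<in>{0..C}. dW c) =
    of_int (\<Sum>m\<in>{- (i + j)..i + j}. m * d_coeff i j N' m) * (s * f N')" .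
  \<comment> \<open>The weight of \<open>S2\<close> is antisymmetric because
    \<open>max 0 x - max 0 (- x) = x\<close>, for \<open>x = c + e - i\<close> and
    \<open>x = c + e - j\<close>.\<close>
  have 7: "S2 + S2 = s * (of_int (\<Sum>c\<in>{0..N}. (i - e - c - k_coeff i j c) * (N - 2 * c)) * f N')"
  proof -
    have "N - e = N'" by (simp add: N_def N'_def)
    then show ?thesis
      unfolding S2_def f_def
      using sum_antisymmetric_v2[of N "\<lambda>c. i - e - c - k_coeff i j c" F] i j e False
      by (auto simp: k_coeff_def N_def)
  qed
  have "((\<Sum>c\<in>{0..C}. dW c) + S2) + ((\<Sum>c\<in>{0..C}. dW c) + S2) =
    of_int ((\<Sum>m\<in>{- (i + j)..i + j}. m * d_coeff i j N' m) + (\<Sum>c\<in>{0..N}. (i - e - c - k_coeff i j c) * (N - 2 * c))) * (s * f N')"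
    unfolding of_int_add distrib_right 6[symmetric] using 7 by (simp add: algebra_simps)
  also have "\<dots> = 0"
  proof (cases "0 \<le> N'")
    case True
    then have "(\<Sum>m\<in>{- (i + j)..i + j}. m * d_coeff i j N' m) + (\<Sum>c\<in>{0..N}. (i - e - c - k_coeff i j c) * (N - 2 * c)) = 0"
      using central_term[OF i j False] by (simp add: N_def N'_def)
    then show ?thesis by (simp only: of_int_0 mult_zero_left)
  next
    case False
    then show ?thesis using f0[of N'] by simp
  qed
  finally have "(\<Sum>c\<in>{0..C}. dW c) + S2 = 0" by (rule torsion_free)
  then have "(\<Sum>c\<in>{0..C}. ad_v3 (i - e - c) j (v2 F c)) - step (v3_v2_family C j F) i = structure_op i j (v3 F)"
    using 5 by simp
  then show ?thesis unfolding 3 by simp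
qed

end

section \<open>The Heisenberg current on polynomials\<close>

lemma lookup_single_mult:
  "lookup (Poly_Mapping.single k c * F) (k + n) = c * lookup F n"
  for k :: "'x::cancel_comm_monoid_add" and F :: "'x \<Rightarrow>\<^sub>0 'c::semiring_0"
proof -
  have "lookup (Poly_Mapping.single k c * F) (k + n) =
    Sum_any (\<lambda>l. (c when l = k) * Sum_any (\<lambda>q. lookup F q when k + n = l + q))"
    by (simp add: lookup_mult lookup_single eq_commute[of k])
  also have "\<dots> = c * Sum_any (\<lambda>q. lookup F q when k + n = k + q)"
    by (simp add: when_mult)
  also have "Sum_any (\<lambda>q. lookup F q when k + n = k + q) = lookup F n"
    by simp
  finally show ?thesis .
qed

lemma lookup_single_mult_eq_0:
  fixes k :: "'x::cancel_comm_monoid_add" and F :: "'x \<Rightarrow>\<^sub>0 'c::semiring_0"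
  assumes "\<And>n. m \<noteq> k + n"
  shows "lookup (Poly_Mapping.single k c * F) m = 0"
proof -
  have "lookup (Poly_Mapping.single k c * F) m =
    Sum_any (\<lambda>l. (c when l = k) * Sum_any (\<lambda>q. lookup F q when m = l + q))"
    by (simp add: lookup_mult lookup_single eq_commute[of k])
  also have "\<dots> = c * Sum_any (\<lambda>q. lookup F q when m = k + q)"
    by (simp add: when_mult)
  finally show ?thesis using assms by simp
qed

abbreviation unit_monom :: "nat \<Rightarrow> (nat \<Rightarrow>\<^sub>0 nat)" where
  "unit_monom x \<equiv> Poly_Mapping.single x 1"

lemma unit_monom_minus: "lookup m x > 0 \<Longrightarrow> unit_monom x + (m - unit_monom x) = m"
  by (rule poly_mapping_eqI) (auto simp: lookup_add lookup_minus lookup_single when_def)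

lemma lookup_p_var_mult:
  "lookup (p_var j * F) m =
    (if lookup m (j - 1) > 0 then lookup F (m - unit_monom (j - 1)) else 0)"
proof (cases "lookup m (j - 1) > 0")
  case True
  have "lookup (p_var j * F) (unit_monom (j - 1) + (m - unit_monom (j - 1))) = 1 * lookup F (m - unit_monom (j - 1))"
    unfolding p_var_def by (rule lookup_single_mult)
  then show ?thesis using True unit_monom_minus[OF True] by simp
next
  case False
  have "lookup (p_var j * F) m = 0"
    unfolding p_var_def
    by (rule lookup_single_mult_eq_0) (use False in \<open>auto simp: lookup_add\<close>)
  then show ?thesis using False by simp
qed

lemma lookup_coeff_const_mult:
  "lookup (coeff_const c * F) m = c * lookup F m"
  unfolding coeff_const_def using lookup_single_mult[of 0 c F m] by simp

lemma lookup_p_deriv: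
  "lookup (p_deriv i F) n =
    of_nat (lookup n (i - 1) + 1) * lookup F (n + unit_monom (i - 1))"
proof -
  let ?e = "unit_monom (i - 1)"
  let ?c = "\<lambda>m. of_nat (lookup m (i - 1)) * lookup F m"
  have "lookup (p_deriv i F) n =
    (\<Sum>m\<in>keys F. if m = n + ?e then ?c m else 0)"
    unfolding p_deriv_def lookup_sum
  proof (intro sum.cong refl)
    fix m
    show "lookup (Poly_Mapping.single (m - ?e) (?c m)) n = (if m = n + ?e then ?c m else 0)"
    \<comment> \<open>Subtraction of exponents is truncated: a monomial without the variable is
      mapped to itself, and only its coefficient 0 removes it.\<close>
    proof (cases "lookup m (i - 1) = 0")
      case True
      then have "m \<noteq> n + ?e" by (auto simp: lookup_add)
      with True show ?thesis by simp
    next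
      case False
      then have "unit_monom (i - 1) + (m - unit_monom (i - 1)) = m" by (intro unit_monom_minus) simp
      then have "m - ?e = n \<longleftrightarrow> m = n + ?e"
        by (metis add.commute add_diff_cancel_right')
      then show ?thesis by (simp add: lookup_single when_def)
    qed
  qed
  also have "\<dots> = (if n + ?e \<in> keys F then ?c (n + ?e) else 0)"
    by simp
  also have "\<dots> = of_nat (lookup n (i - 1) + 1) * lookup F (n + ?e)"
    by (auto simp: lookup_add in_keys_iff)
  finally show ?thesis .
qed

lemma p_deriv_add: "p_deriv i (F + G) = p_deriv i F + p_deriv i G"
  by (rule poly_mapping_eqI) (simp add: lookup_p_deriv lookup_add ring_distribs)

lemma p_deriv_coeff_const: "p_deriv i (coeff_const c * F) = coeff_const c * p_deriv i F"
  by (rule poly_mapping_eqI) (unfold lookup_p_deriv lookup_coeff_const_mult, simp add: mult.left_commute)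

text \<open>The cases are split by \<open>i - 1 = j - 1\<close>, since the indices 0 and 1 address
  the same variable.\<close>

lemma p_deriv_p_deriv: "p_deriv i (p_deriv j F) = p_deriv j (p_deriv i F)"
proof (cases "i - 1 = j - 1")
  case True
  then show ?thesis unfolding p_deriv_def by simp
next
  case False
  show ?thesis
    by (rule poly_mapping_eqI)
       (use False in \<open>simp add: lookup_p_deriv lookup_add lookup_single add.commute add.left_commute mult.left_commute\<close>)
qed

lemma p_deriv_p_var:
  assumes "1 \<le> i" "1 \<le> j"
  shows "p_deriv i (p_var j * F) = p_var j * p_deriv i F + (if i = j then F else 0)"
proof (cases "i = j")
  case True
  show ?thesis
  proof (rule poly_mapping_eqI)
    fix n
    have "lookup n (i - 1) > 0 \<Longrightarrow> n - unit_monom (i - 1) + unit_monom (i - 1) = n"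
      using unit_monom_minus[of n "i - 1"] by (simp add: add.commute)
    then show "lookup (p_deriv i (p_var j * F)) n =
      lookup (p_var j * p_deriv i F + (if i = j then F else 0)) n"
      unfolding lookup_p_deriv lookup_p_var_mult lookup_add
      using True by (auto simp: lookup_minus of_nat_diff ring_distribs)
  qed
next
  case False
  then have ij: "i - 1 \<noteq> j - 1" using assms by auto
  show ?thesis
  proof (rule poly_mapping_eqI)
    fix n
    have "lookup n (j - 1) > 0 \<Longrightarrow> n + unit_monom (i - 1) - unit_monom (j - 1) = n - unit_monom (j - 1) + unit_monom (i - 1)"
      by (rule poly_mapping_eqI) (use ij in \<open>auto simp: lookup_add lookup_minus lookup_single when_def\<close>)
    then show "lookup (p_deriv i (p_var j * F)) n =
      lookup (p_var j * p_deriv i F + (if i = j then F else 0)) n"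
      using ij False by (auto simp: lookup_p_deriv lookup_p_var_mult lookup_add lookup_minus lookup_single)
  qed
qed

lemma p_deriv_finite: "\<exists>R. \<forall>i>R. p_deriv i F = 0"
proof -
  let ?V = "\<Union>m\<in>keys F. keys m"
  have "finite ?V" by auto
  then obtain R where R: "\<forall>x\<in>?V. x \<le> R" by (meson finite_nat_set_iff_bounded_le)
  have "p_deriv i F = 0" if "i > R + 1" for i
  proof (rule poly_mapping_eqI)
    fix n
    have "n + unit_monom (i - 1) \<notin> keys F"
    proof
      assume *: "n + unit_monom (i - 1) \<in> keys F"
      have "i - 1 \<in> keys (n + unit_monom (i - 1))"
        by (auto simp: in_keys_iff lookup_add)
      then have "i - 1 \<in> ?V" using * by blast
      then have "i - 1 \<le> R" using R by blast
      then show False using that by simp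
    qed
    then show "lookup (p_deriv i F) n = lookup 0 n"
      by (simp add: lookup_p_deriv in_keys_iff)
  qed
  then show ?thesis by blast
qed

section \<open>Constants, division by integers and by \<open>1 + b\<close>\<close>

lemma coeff_const_add: "coeff_const (c + d) = coeff_const c + coeff_const d"
  by (simp add: coeff_const_def single_add)
lemma coeff_const_mult: "coeff_const (c * d) = coeff_const c * coeff_const d"
  by (simp add: coeff_const_def mult_single)
lemma coeff_const_1 [simp]: "coeff_const 1 = 1"
  by (simp add: coeff_const_def)
lemma coeff_const_0 [simp]: "coeff_const 0 = 0"
  by (simp add: coeff_const_def)
lemma rat_const_mult: "rat_const (c * d) = rat_const c * rat_const d"
  by (simp add: rat_const_def mult_single)
lemma rat_const_add: "rat_const (c + d) = rat_const c + rat_const d"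
  by (simp add: rat_const_def single_add)
lemma rat_const_1 [simp]: "rat_const 1 = 1"
  by (simp add: rat_const_def)

lemma rat_const_of_nat: "rat_const (of_nat n) = of_nat n"
  by (induction n) (simp_all add: rat_const_add, simp add: rat_const_def)

lemma coeff_const_of_nat: "coeff_const (rat_const (of_nat n)) = of_nat n"
  by (induction n) (simp_all add: rat_const_add coeff_const_add, simp add: rat_const_def)

lemma of_nat_fract_neq_0: "0 < n \<Longrightarrow> (of_nat n :: rat poly fract) \<noteq> 0"
  by (simp add: Fract_of_nat_eq[symmetric] Zero_fract_def eq_fract)

lemma inverse_of_nat:
  assumes "0 < n"
  shows "coeff_const (rat_const (inverse (of_nat n))) * of_nat n = 1"
  unfolding coeff_const_of_nat[symmetric] coeff_const_mult[symmetric] rat_const_mult[symmetric]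
  using of_nat_fract_neq_0[OF assms] by simp

lemma ppoly_torsion_free: "0 < n \<Longrightarrow> of_nat n * F = 0 \<Longrightarrow> F = (0 :: 'v ppoly)"
proof -
  assume n: "0 < n" "of_nat n * F = 0"
  have "F = (coeff_const (rat_const (inverse (of_nat n))) * of_nat n) * F"
    unfolding inverse_of_nat[OF n(1)] by simp
  also have "\<dots> = 0" using n(2) by (simp only: mult.assoc mult_zero_right)
  finally show "F = 0" .
qed

definition b_unit :: "'v ppoly" where
  "b_unit = coeff_const (rat_const (inverse (1 + b_fract)))"

lemma b_unit: "(1 + b_const) * b_unit = (1 :: 'v ppoly)"
proof -
  have "1 + b_fract \<noteq> 0"
    by (simp add: b_fract_def One_fract_def Zero_fract_def eq_fract one_pCons)
  moreover have "(1 + b_const :: 'v ppoly) = coeff_const (rat_const (1 + b_fract))"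
    by (simp add: rat_const_add coeff_const_add)
  ultimately show ?thesis
    by (simp add: b_unit_def coeff_const_mult[symmetric] rat_const_mult[symmetric])
qed

text \<open>The factor \<open>1 + b\<close> sits on the derivatives alone, as in
  \<open>\<Lambda>_Y\<close>. The commutation relations leave the value of the zero mode free, hence
  the parameter \<open>z\<close>.\<close>

definition current :: "'v coeff \<Rightarrow> int \<Rightarrow> 'v ppoly \<Rightarrow> 'v ppoly" where
  "current z n F =
    (if n > 0 then (1 + b_const) * (of_int n * p_deriv (nat n) F)
     else if n < 0 then p_var (nat (- n)) * F else coeff_const z * F)"

lemma of_int_coeff_const: "\<exists>c. of_int n = (coeff_const c :: 'v ppoly)"
proof -
  have "coeff_const (- rat_const (of_nat m)) = - (of_nat m :: 'v ppoly)" for m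
    using coeff_const_add[of "rat_const (of_nat m)" "- rat_const (of_nat m)"]
    by (simp add: coeff_const_of_nat eq_neg_iff_add_eq_0 add.commute)
  note neg = this[symmetric]
  show ?thesis
  proof (cases n rule: int_cases2)
    case (nonneg m)
    then show ?thesis using coeff_const_of_nat[of m, symmetric] by auto
  next
    case (nonpos m)
    then show ?thesis using neg[of m] by auto
  qed
qed

lemma p_deriv_0 [simp]: "p_deriv i 0 = 0"
  by (simp add: p_deriv_def)

lemma current_0 [simp]: "current z m 0 = 0"
  by (simp add: current_def)

lemma p_deriv_of_int:
  fixes F :: "'v ppoly"
  shows "p_deriv i (of_int n * F) = of_int n * p_deriv i F"
proof -
  obtain c where "of_int n = (coeff_const c :: 'v ppoly)" using of_int_coeff_const by blast
  then show ?thesis by (simp only: p_deriv_coeff_const)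
qed

lemma one_plus_b: "(1 + b_const :: 'v ppoly) = coeff_const (1 + rat_const b_fract)"
  by (simp add: coeff_const_add)

lemma p_deriv_1_b: "p_deriv i ((1 + b_const) * F) = (1 + b_const) * p_deriv i F"
  unfolding one_plus_b by (rule p_deriv_coeff_const)

lemma heisenberg_current:
  fixes z :: "'v coeff"
  assumes "e = 0 \<or> e = 1"
  shows "heisenberg (current z) (range coeff_const) (1 + b_const) b_const e"
proof
  fix m n :: int and x y k :: "'v ppoly"
  show "current z m (x + y) = current z m x + current z m y"
    by (auto simp: current_def p_deriv_add algebra_simps)
  show "\<And>k. k \<in> range coeff_const \<Longrightarrow> current z m (k * x) = k * current z m x"
    by (auto simp: current_def p_deriv_coeff_const mult.left_commute)
  show "(1 + b_const :: 'v ppoly) \<in> range coeff_const" unfolding one_plus_b by blast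
  show "(b_const :: 'v ppoly) \<in> range coeff_const" by blast
  show "\<exists>R. \<forall>m>R. current z m x = 0"
  proof -
    obtain R where R: "\<forall>i>R. p_deriv i x = 0" using p_deriv_finite by blast
    show ?thesis by (rule exI[of _ "int R"]) (auto simp: current_def R)
  qed
  show "x = 0" if "x + x = 0"
    using ppoly_torsion_free[of 2 x] that by (simp add: mult_2)
  define S where "S = (1 + b_const :: 'v ppoly)"
  have dS: "p_deriv i (S * x) = S * p_deriv i x" for i and x :: "'v ppoly"
    unfolding S_def by (rule p_deriv_1_b)
  note d = dS p_deriv_of_int p_deriv_coeff_const mult.left_commute
  show "current z m (current z n x) = current z n (current z m x)
      + (if m + n = 0 then of_int m * ((1 + b_const) * x) else 0)"
    unfolding current_def S_def[symmetric]
  proof -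
    consider "m = 0" | "n = 0" "m \<noteq> 0" | "m > 0" "n > 0" | "m > 0" "n < 0" | "m < 0" "n > 0" | "m < 0" "n < 0"
      by linarith
    then show "(if 0 < m then S * (of_int m * p_deriv (nat m) (if 0 < n then S * (of_int n * p_deriv (nat n) x)
        else if n < 0 then p_var (nat (- n)) * x else coeff_const z * x))
      else if m < 0 then p_var (nat (- m)) * (if 0 < n then S * (of_int n * p_deriv (nat n) x)
        else if n < 0 then p_var (nat (- n)) * x else coeff_const z * x)
      else coeff_const z * (if 0 < n then S * (of_int n * p_deriv (nat n) x)
        else if n < 0 then p_var (nat (- n)) * x else coeff_const z * x)) =
      (if 0 < n then S * (of_int n * p_deriv (nat n) (if 0 < m then S * (of_int m * p_deriv (nat m) x)
        else if m < 0 then p_var (nat (- m)) * x else coeff_const z * x))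
      else if n < 0 then p_var (nat (- n)) * (if 0 < m then S * (of_int m * p_deriv (nat m) x)
        else if m < 0 then p_var (nat (- m)) * x else coeff_const z * x)
      else coeff_const z * (if 0 < m then S * (of_int m * p_deriv (nat m) x)
        else if m < 0 then p_var (nat (- m)) * x else coeff_const z * x))
      + (if m + n = 0 then of_int m * (S * x) else 0)"
    proof cases
      case 1
      then show ?thesis by (simp add: d)
    next
      case 2
      then show ?thesis by (simp add: d)
    next
      case 3
      then show ?thesis by (simp add: d p_deriv_p_deriv[of "nat m"])
    next
      case 4
      have p: "p_deriv (nat m) (p_var (nat (- n)) * x) = p_var (nat (- n)) * p_deriv (nat m) x
          + (if m + n = 0 then x else 0)"
        using 4 by (subst p_deriv_p_var) auto
      show ?thesis using 4 by (simp add: p distrib_left)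
    next
      case 5
      have p: "p_deriv (nat n) (p_var (nat (- m)) * x) = p_var (nat (- m)) * p_deriv (nat n) x
          + (if m + n = 0 then x else 0)"
        using 5 by (subst p_deriv_p_var) auto
      show ?thesis
      proof (cases "m + n = 0")
        case True
        then have "m = - n" by simp
        then show ?thesis using 5 p by (simp add: distrib_left, (simp add: mult.left_commute)?)
      next
        case False
        then show ?thesis using 5 p by (simp, (simp add: mult.left_commute)?)
      qed
    next
      case 6
      then show ?thesis by (simp add: mult.left_commute)
    qed
  qed
qed (use assms in auto)

section \<open>Coefficientwise operators on power series in \<open>t\<close>\<close>

definition const_linear :: "('v ppoly \<Rightarrow> 'v ppoly) \<Rightarrow> bool" where
  "const_linear A \<longleftrightarrow> (\<forall>x y. A (x + y) = A x + A y) \<and> (\<forall>c x. A (coeff_const c * x) = coeff_const c * A x)"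

text \<open>Operators in the \<open>p_n\<close> do not commute with arbitrary series, but they do
  commute with \<open>c * t ^ n\<close> for \<open>c\<close> free of the \<open>p_n\<close>. The
  coefficients \<open>\<gamma> l\<close>, the integers and \<open>1 + b\<close> are all of this
  kind.\<close>

definition t_monomial :: "'v ppoly fps \<Rightarrow> bool" where
  "t_monomial \<gamma> \<longleftrightarrow> (\<exists>c n. \<gamma> = coeff_fps c * fps_X ^ n)"

lemma t_monomial_nth:
  "fps_nth (coeff_fps c * fps_X ^ n * Z) m = (if m < n then 0 else coeff_const c * fps_nth Z (m - n))"
proof -
  have "coeff_fps c * fps_X ^ n * Z = fps_const (coeff_const c) * (fps_X ^ n * Z)"
    by (simp add: coeff_fps_def mult.assoc)
  then show ?thesis by (simp only: fps_mult_left_const_nth fps_X_power_mult_nth) auto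
qed

lemma coeffwise_nth [simp]: "fps_nth (coeffwise A Z) n = A (fps_nth Z n)"
  by (simp add: coeffwise_def)

lemma const_linear_0: "const_linear A \<Longrightarrow> A 0 = 0"
  unfolding const_linear_def by (metis add_cancel_right_right)

lemma const_linear_minus: "const_linear A \<Longrightarrow> A (- x) = - A x"
proof -
  assume A: "const_linear A"
  then have "A (x + - x) = A x + A (- x)" unfolding const_linear_def by blast
  then show ?thesis using const_linear_0[OF A] by (simp add: eq_neg_iff_add_eq_0 add.commute)
qed

lemma coeffwise_add: "const_linear A \<Longrightarrow> coeffwise A (X + Y) = coeffwise A X + coeffwise A Y"
  by (rule fps_ext) (simp add: const_linear_def)

lemma coeffwise_minus: "const_linear A \<Longrightarrow> coeffwise A (- Y) = - coeffwise A Y"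
  by (rule fps_ext) (simp add: const_linear_minus)

lemma coeffwise_monomial: "const_linear A \<Longrightarrow> t_monomial \<gamma> \<Longrightarrow> coeffwise A (\<gamma> * Y) = \<gamma> * coeffwise A Y"
proof -
  assume A: "const_linear A" and "t_monomial \<gamma>"
  then obtain c n where \<gamma>: "\<gamma> = coeff_fps c * fps_X ^ n" unfolding t_monomial_def by blast
  show ?thesis unfolding \<gamma>
    by (rule fps_ext) (use A const_linear_0[OF A] in \<open>auto simp: t_monomial_nth const_linear_def\<close>)
qed

lemma t_monomialI: "t_monomial (coeff_fps c * fps_X ^ n)"
  unfolding t_monomial_def by blast

lemma t_monomial_const: "t_monomial (coeff_fps c)"
  using t_monomialI[of c 0] by simp

lemma of_int_fps: "(of_int n :: 'v ppoly fps) = fps_const (of_int n)"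
proof -
  have "(of_nat k :: 'v ppoly fps) = fps_const (of_nat k)" for k
    by (induction k) (auto simp: fps_const_add[symmetric] simp del: fps_const_add)
  then show ?thesis by (cases n rule: int_cases2) (auto simp: fps_const_neg[symmetric] simp del: fps_const_neg)
qed

lemma t_monomial_of_int: "t_monomial (of_int n)"
  using of_int_coeff_const[of n] t_monomial_const by (metis coeff_fps_def of_int_fps)

lemma one_plus_b_fps: "1 + b_fps = coeff_fps (1 + rat_const b_fract)"
  by (simp add: b_fps_def coeff_fps_def coeff_const_add fps_const_add[symmetric] del: fps_const_add)

lemma one_plus_b_cancel: "(1 + b_fps) * X = (1 + b_fps) * Y \<Longrightarrow> X = (Y :: 'v ppoly fps)"
proof -
  assume *: "(1 + b_fps) * X = (1 + b_fps) * Y"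
  have "fps_const b_unit * (1 + b_fps) = fps_const (b_unit * (1 + b_const) :: 'v ppoly)"
    by (simp add: one_plus_b_fps coeff_fps_def one_plus_b)
  also have "\<dots> = 1" using b_unit by (simp add: mult.commute)
  finally have "X = fps_const b_unit * ((1 + b_fps) * X)" "Y = fps_const b_unit * ((1 + b_fps) * Y)"
    by (simp_all add: mult.assoc[symmetric])
  with * show ?thesis by simp
qed

text \<open>
  In \<open>model\<close>, \<open>z\<close> is the value of the central mode \<open>J\<^sub>0\<close>: it is \<open>u\<close> in family (II) and \<open>0\<close> in family (I), where the
  \<open>u\<^sub>l\<close> enter through the coefficients \<open>g l\<close>.  The coefficient of \<open>v l\<close> in the constraints is \<open>g l * t ^ r l\<close>.
\<close>

locale model =
  fixes z :: "'v coeff" and e :: int and g :: "nat \<Rightarrow> 'v coeff" and r :: "nat \<Rightarrow> nat"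
  assumes e01: "e = 0 \<or> e = 1"
    and g0: "e = 1 \<Longrightarrow> g 0 = 0"
    and r_pos: "l \<le> 3 \<Longrightarrow> 1 \<le> r l"
begin

sublocale heisenberg "current z" "range coeff_const" "1 + b_const" b_const e
  by (rule heisenberg_current[OF e01])

definition v :: "nat \<Rightarrow> 'v ppoly \<Rightarrow> int \<Rightarrow> 'v ppoly" where
  "v l F c = (if l = 0 then (if c = 0 then F else 0) else if l = 1 then v1 F c
     else if l = 2 then v2 F c else v3 F c)"

definition V :: "nat \<Rightarrow> int \<Rightarrow> 'v ppoly fps \<Rightarrow> 'v ppoly fps" where
  "V l c = coeffwise (\<lambda>F. v l F c)"

definition \<gamma> :: "nat \<Rightarrow> 'v ppoly fps" where
  "\<gamma> l = coeff_fps (g l) * fps_X ^ r l"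

text \<open>The index is \<open>i - 1\<close> because the last \<open>Y_+\<close> raises the
  \<open>y\<close>-index by one before \<open>y_i\<close> is read off; \<open>b_unit\<close> is the
  prefactor \<open>1 / (1 + b)\<close> of \<open>y_0 F\<close>.\<close>

definition L :: "int \<Rightarrow> 'v ppoly fps \<Rightarrow> 'v ppoly fps" where
  "L i Z = (if 1 \<le> i then - p_star i Z + (\<Sum>l\<le>3. \<gamma> l * coeffwise (\<lambda>F. b_unit * v l F (i - 1)) Z) else 0)"

definition structure_fps :: "int \<Rightarrow> int \<Rightarrow> (int \<Rightarrow> 'v ppoly fps) \<Rightarrow> 'v ppoly fps" where
  "structure_fps i j Q = Abs_fps (\<lambda>n. structure_op i j (\<lambda>a. fps_nth (Q a) n))"

definition fin_fps :: "(int \<Rightarrow> 'v ppoly fps) \<Rightarrow> bool" where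
  "fin_fps Q \<longleftrightarrow> (\<forall>n. fin_family (\<lambda>a. fps_nth (Q a) n))"

lemma structure_fps_nth [simp]: "fps_nth (structure_fps i j Q) n = structure_op i j (\<lambda>a. fps_nth (Q a) n)"
  by (simp add: structure_fps_def)

lemma structure_op_add:
  assumes "fin_family w" "fin_family w'"
  shows "structure_op i j (\<lambda>a. w a + w' a) = structure_op i j w + structure_op i j w'"
proof -
  obtain B where B: "supported B w" using assms(1) by (rule fin_familyE0)
  obtain B' where B': "B \<le> B'" "supported B' w'" using assms(2) by (rule fin_familyE[where ?B0.0 = B])
  have w: "supported B' w" using B B' by auto
  then have "supported B' (\<lambda>a. w a + w' a)" using B' by auto
  then show ?thesis
    by (simp only: structure_op_eq[OF w] structure_op_eq[OF B'(2)] structure_op_eq J_add distrib_left sum.distrib) (simp add: algebra_simps)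
qed

lemma structure_op_scale:
  assumes "fin_family w"
  shows "structure_op i j (\<lambda>a. coeff_const c * w a) = coeff_const c * structure_op i j w"
proof -
  obtain B where B: "supported B w" using assms(1) by (rule fin_familyE0)
  then have B': "supported B (\<lambda>a. coeff_const c * w a)" by auto
  show ?thesis
    unfolding structure_op_eq[OF B] structure_op_eq[OF B'] by (simp add: J_scale sum_distrib_left distrib_left mult.left_commute)
qed

lemma structure_op_0: "structure_op i j (\<lambda>a. 0) = 0"
  using structure_op_scale[of "\<lambda>a. 0" i j 0] by (auto simp: fin_family_def)

lemma structure_fps_add: "fin_fps Q \<Longrightarrow> fin_fps Q' \<Longrightarrow> structure_fps i j (\<lambda>a. Q a + Q' a) = structure_fps i j Q + structure_fps i j Q'"
  by (rule fps_ext) (simp add: fin_fps_def structure_op_add)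

lemma structure_fps_monomial: "t_monomial \<delta> \<Longrightarrow> fin_fps Q \<Longrightarrow> structure_fps i j (\<lambda>a. \<delta> * Q a) = \<delta> * structure_fps i j Q"
proof -
  assume "t_monomial \<delta>" and Q: "fin_fps Q"
  then obtain c n where \<delta>: "\<delta> = coeff_fps c * fps_X ^ n" unfolding t_monomial_def by blast
  show ?thesis unfolding \<delta>
    by (rule fps_ext) (use Q in \<open>auto simp: t_monomial_nth fin_fps_def structure_op_scale structure_op_0\<close>)
qed

lemma fin_fps_add: "fin_fps Q \<Longrightarrow> fin_fps Q' \<Longrightarrow> fin_fps (\<lambda>a. Q a + Q' a)"
  by (simp add: fin_fps_def fin_family_add)

lemma fin_fps_monomial:
  assumes "t_monomial \<delta>" "fin_fps Q"
  shows "fin_fps (\<lambda>a. \<delta> * Q a)"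
proof -
  from assms(1) obtain c n where \<delta>: "\<delta> = coeff_fps c * fps_X ^ n" unfolding t_monomial_def by blast
  show ?thesis unfolding fin_fps_def
  proof
    fix m
    from assms(2) have "fin_family (\<lambda>a. fps_nth (Q a) (m - n))" by (simp add: fin_fps_def)
    then show "fin_family (\<lambda>a. fps_nth (\<delta> * Q a) m)"
      by (rule fin_family_map) (simp add: \<delta> t_monomial_nth)
  qed
qed

lemma t_monomial_\<gamma>: "t_monomial (\<gamma> l)"
  unfolding \<gamma>_def by (rule t_monomialI)

lemma const_linear_v: "const_linear (\<lambda>F. v l F c)"
  by (auto simp: const_linear_def v_def v1_add v2_add v3_add v1_scale v2_scale v3_scale)

lemma fin_v: "fin_family (v l F)"
proof -
  have "fin_family (\<lambda>c. if c = 0 then F else 0)" by (rule fin_familyI[of _ 0]) auto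
  then show ?thesis using fin_v1[of F] fin_v2[of F] fin_v3[of F]
    by (cases "l = 0"; cases "l = 1"; cases "l = 2"; simp add: v_def[abs_def])
qed

lemmas V_linear =
  coeffwise_add[OF const_linear_v, folded V_def]
  coeffwise_minus[OF const_linear_v, folded V_def]
  coeffwise_monomial[OF const_linear_v t_monomial_\<gamma>, folded V_def]

lemma V_nth [simp]: "fps_nth (V l c Z) n = v l (fps_nth Z n) c"
  by (simp add: V_def)

lemma fin_V: "fin_fps (\<lambda>a. V l a Z)"
  by (simp add: fin_fps_def fin_v)

lemma fin_V_shift: "fin_fps (\<lambda>a. if 0 \<le> a then V l (a + k) Z else 0)"
proof -
  have "(\<lambda>a. fps_nth (if 0 \<le> a then V l (a + k) Z else 0) n) = (\<lambda>a. if 0 \<le> a then v l (fps_nth Z n) (a + k) else 0)" for n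
    by auto
  then show ?thesis unfolding fin_fps_def using fin_family_shift[OF fin_v] by simp
qed

lemma V_neg: "a < 0 \<Longrightarrow> V l a Z = 0"
  by (rule fps_ext) (simp add: v_def v1_neg v2_neg v3_neg)

lemma of_int_mult_nth: "fps_nth (of_int k * X) n = of_int k * fps_nth X n" for X :: "'v ppoly fps"
  by (simp add: of_int_fps)

lemma S_mult_nth: "fps_nth ((1 + b_fps) * X) n = (1 + b_const) * fps_nth X n" for X :: "'v ppoly fps"
  by (simp add: one_plus_b_fps coeff_fps_def one_plus_b)

lemma V33:
  assumes "0 \<le> i" "0 \<le> j"
  shows "V 3 i (V 3 j Z) - V 3 j (V 3 i Z) = (1 + b_fps) * structure_fps i j (\<lambda>a. V 3 a Z)"
  by (rule fps_ext) (use v3_v3[OF assms] in \<open>simp add: v_def S_mult_nth\<close>)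

lemma V32:
  assumes "0 \<le> i" "0 \<le> j"
  shows "V 3 i (V 2 j Z) - V 2 j (V 3 i Z) + (V 2 i (V 3 j Z) - V 3 j (V 2 i Z)) =
    (1 + b_fps) * (structure_fps i j (\<lambda>a. V 2 a Z) + of_int (i - j) * V 3 (i + j - e) Z)"
  by (rule fps_ext)
     (use v3_v2_mixed[OF assms] in \<open>simp add: v_def S_mult_nth of_int_mult_nth del: of_int_diff\<close>)

lemma V22:
  assumes "0 \<le> i" "0 \<le> j"
  shows "V 2 i (V 2 j Z) - V 2 j (V 2 i Z) = (1 + b_fps) * (of_int (i - j) * V 2 (i + j - e) Z)"
  by (rule fps_ext)
     (use v2_v2[OF assms] in \<open>simp add: v_def S_mult_nth of_int_mult_nth del: of_int_diff\<close>)

lemma V3_linear: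
  assumes "0 \<le> i" "0 \<le> j" "k = 0 \<or> k = 1"
  shows "V 3 i (V 1 (j + k) Z) - V 1 (j + k) (V 3 i Z) + (V 1 (i + k) (V 3 j Z) - V 3 j (V 1 (i + k) Z)) =
    (1 + b_fps) * structure_fps i j (\<lambda>a. if 0 \<le> a then V 1 (a + k) Z else 0)"
proof (rule fps_ext)
  fix n
  have *: "(\<lambda>a. fps_nth (if 0 \<le> a then V 1 (a + k) Z else 0) n) =
    (\<lambda>a. if 0 \<le> a then v1 (fps_nth Z n) (a + k) else 0)"
    by (auto simp: v_def)
  show "fps_nth (V 3 i (V 1 (j + k) Z) - V 1 (j + k) (V 3 i Z) + (V 1 (i + k) (V 3 j Z) - V 3 j (V 1 (i + k) Z))) n =
    fps_nth ((1 + b_fps) * structure_fps i j (\<lambda>a. if 0 \<le> a then V 1 (a + k) Z else 0)) n"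
    using v3_v1_mixed[OF assms] unfolding S_mult_nth structure_fps_nth * by (simp add: v_def)
qed

lemma V2_linear:
  assumes "0 \<le> i" "0 \<le> j" "k = 0 \<or> k = 1"
  shows "V 2 i (V 1 (j + k) Z) - V 1 (j + k) (V 2 i Z) + (V 1 (i + k) (V 2 j Z) - V 2 j (V 1 (i + k) Z)) =
    (1 + b_fps) * (of_int (i - j) * (if 0 \<le> i + j - e then V 1 (i + j - e + k) Z else 0))"
  by (rule fps_ext)
     (use v2_v1_mixed[OF assms(1,2), of k] assms(3) in \<open>auto simp: v_def S_mult_nth of_int_mult_nth simp del: of_int_diff\<close>)

lemma V11: "0 \<le> i \<Longrightarrow> 0 \<le> j \<Longrightarrow> V 1 i (V 1 j Z) = V 1 j (V 1 i Z)"
  by (rule fps_ext) (simp add: v_def v1_v1)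

lemma V0: "V 0 i Z = (if i = 0 then Z else 0)"
  by (rule fps_ext) (simp add: v_def)

lemma V_0 [simp]: "V l i 0 = 0"
  by (rule fps_ext) (simp add: const_linear_0[OF const_linear_v])

lemma V0_commute: "V 0 i (V l j Z) = V l j (V 0 i Z)"
  by (simp add: V0)

text \<open>The constant \<open>\<gamma> 0\<close> commutes with everything, so it must also drop
  out of the right-hand side of the bracket. For \<open>e = 0\<close>,
  \<open>structure_coeff\<close> vanishes at \<open>m = i + j\<close> and the \<open>b\<close>-term
  is read at the index \<open>i + j\<close>, nonzero unless \<open>i = j\<close>; for
  \<open>e = 1\<close> the constant is absent.\<close>

lemma structure_fps_V0:
  assumes "0 \<le> i" "0 \<le> j"
  shows "\<gamma> 0 * structure_fps i j (\<lambda>a. V 0 a Z) = 0"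
  using e01
proof
  assume e: "e = 0"
  have t: "structure_coeff i j (i + j - 2 * e) = 0" unfolding structure_coeff_def using assms e by auto
  have "structure_op i j (v 0 F) = 0" for F
  proof -
    have "supported 0 (v 0 F)" by (simp add: v_def)
    from structure_op_eq[OF this] have "structure_op i j (v 0 F) =
      b_const * (of_int ((i - j) * (i + j - e)) * v 0 F (i + j - 2 * e))" by (simp add: t del: of_int_mult)
    also have "of_int ((i - j) * (i + j - e)) * v 0 F (i + j - 2 * e) = 0"
    proof (cases "i = j")
      case False
      then have "i + j - 2 * e \<noteq> 0" using assms e by auto
      then show ?thesis by (simp add: v_def)
    qed simp
    finally show ?thesis by simp
  qed
  then have "structure_fps i j (\<lambda>a. V 0 a Z) = 0"
    by (intro fps_ext) simp
  then show ?thesis by simp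
next
  assume "e = 1"
  then show ?thesis by (simp add: \<gamma>_def g0 coeff_fps_def)
qed

lemma V0_diff:
  assumes "0 \<le> i" "0 \<le> j"
  shows "\<gamma> 0 * (of_int (i - j) * V 0 (i + j - e) Z) = 0"
  using e01
proof
  assume e: "e = 0"
  show ?thesis
  proof (cases "i = j")
    case False
    then have "i + j - e \<noteq> 0" using assms e by auto
    then show ?thesis by (simp add: V0)
  qed simp
next
  assume "e = 1"
  then show ?thesis by (simp add: \<gamma>_def g0 coeff_fps_def)
qed

section \<open>The bracket of two constraints\<close>

definition scaled_L :: "int \<Rightarrow> 'v ppoly fps \<Rightarrow> 'v ppoly fps" where
  "scaled_L a Z = - V 1 (a + 1) Z + \<gamma> 0 * V 0 a Z + \<gamma> 1 * V 1 a Z + \<gamma> 2 * V 2 a Z + \<gamma> 3 * V 3 a Z"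

text \<open>Bilinear expansion. The linear terms commute among themselves and \<open>V 0\<close>
  commutes with everything, so only the pure quadratic and cubic brackets and the mixed combinations
  remain, each with its own lemma above. \<open>S_L\<close> below identifies
  \<open>scaled_L a\<close> with \<open>(1 + b) * L (a + 1)\<close>.\<close>

lemma scaled_L_commutator:
  assumes i: "0 \<le> i" and j: "0 \<le> j"
  shows "scaled_L i (scaled_L j Z) - scaled_L j (scaled_L i Z) = (1 + b_fps) * (\<gamma> 3 * structure_fps i j (\<lambda>a. if 0 \<le> a then scaled_L a Z else 0)
    + \<gamma> 2 * (of_int (i - j) * (if 0 \<le> i + j - e then scaled_L (i + j - e) Z else 0)))"
proof -
  note f1 = fin_fps_monomial[OF t_monomial_of_int fin_V_shift]
  note f = fin_fps_monomial[OF t_monomial_\<gamma> fin_V]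
  have Q: "(\<lambda>a. if 0 \<le> a then scaled_L a Z else 0) = (\<lambda>a. of_int (-1) * (if 0 \<le> a then V 1 (a + 1) Z else 0)
     + \<gamma> 0 * V 0 a Z + \<gamma> 1 * V 1 a Z + \<gamma> 2 * V 2 a Z + \<gamma> 3 * V 3 a Z)"
    by (auto simp: scaled_L_def V_neg)
  have "structure_fps i j (\<lambda>a. if 0 \<le> a then scaled_L a Z else 0) =
     - structure_fps i j (\<lambda>a. if 0 \<le> a then V 1 (a + 1) Z else 0) + \<gamma> 0 * structure_fps i j (\<lambda>a. V 0 a Z) + \<gamma> 1 * structure_fps i j (\<lambda>a. V 1 a Z)
     + \<gamma> 2 * structure_fps i j (\<lambda>a. V 2 a Z) + \<gamma> 3 * structure_fps i j (\<lambda>a. V 3 a Z)"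
    unfolding Q
    by (simp only: structure_fps_add fin_fps_add f1 f structure_fps_monomial[OF t_monomial_\<gamma> fin_V]
        structure_fps_monomial[OF t_monomial_of_int fin_V_shift])
       (simp only: of_int_minus of_int_1 mult_minus1)
  then have D: "\<gamma> 3 * structure_fps i j (\<lambda>a. if 0 \<le> a then scaled_L a Z else 0) = \<gamma> 3 *
     (- structure_fps i j (\<lambda>a. if 0 \<le> a then V 1 (a + 1) Z else 0) + \<gamma> 1 * structure_fps i j (\<lambda>a. V 1 a Z)
     + \<gamma> 2 * structure_fps i j (\<lambda>a. V 2 a Z) + \<gamma> 3 * structure_fps i j (\<lambda>a. V 3 a Z))"
    using structure_fps_V0[OF i j, of Z] by simp
  have W1: "(\<lambda>a. if 0 \<le> a then V 1 (a + 0) Z else 0) = (\<lambda>a. V 1 a Z)"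
    by (auto simp: V_neg)
  have V1: "(if 0 \<le> i + j - e then V 1 (i + j - e + 0) Z else 0) = V 1 (i + j - e) Z"
    by (simp add: V_neg)
  have E: "of_int (i - j) * (if 0 \<le> i + j - e then scaled_L (i + j - e) Z else 0) =
     of_int (i - j) * (- (if 0 \<le> i + j - e then V 1 (i + j - e + 1) Z else 0))
     + \<gamma> 1 * (of_int (i - j) * V 1 (i + j - e) Z) + \<gamma> 2 * (of_int (i - j) * V 2 (i + j - e) Z)
     + \<gamma> 3 * (of_int (i - j) * V 3 (i + j - e) Z)"
    using V0_diff[OF i j, of Z] by (auto simp: scaled_L_def V_neg algebra_simps)
  have X: "scaled_L i (scaled_L j Z) - scaled_L j (scaled_L i Z) =
      \<gamma> 3 * (\<gamma> 3 * (V 3 i (V 3 j Z) - V 3 j (V 3 i Z)))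
    + \<gamma> 3 * (\<gamma> 2 * (V 3 i (V 2 j Z) - V 2 j (V 3 i Z) + (V 2 i (V 3 j Z) - V 3 j (V 2 i Z))))
    + \<gamma> 3 * (\<gamma> 1 * (V 3 i (V 1 (j + 0) Z) - V 1 (j + 0) (V 3 i Z) + (V 1 (i + 0) (V 3 j Z) - V 3 j (V 1 (i + 0) Z))))
    - \<gamma> 3 * (V 3 i (V 1 (j + 1) Z) - V 1 (j + 1) (V 3 i Z) + (V 1 (i + 1) (V 3 j Z) - V 3 j (V 1 (i + 1) Z)))
    + \<gamma> 2 * (\<gamma> 2 * (V 2 i (V 2 j Z) - V 2 j (V 2 i Z)))
    + \<gamma> 2 * (\<gamma> 1 * (V 2 i (V 1 (j + 0) Z) - V 1 (j + 0) (V 2 i Z) + (V 1 (i + 0) (V 2 j Z) - V 2 j (V 1 (i + 0) Z))))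
    - \<gamma> 2 * (V 2 i (V 1 (j + 1) Z) - V 1 (j + 1) (V 2 i Z) + (V 1 (i + 1) (V 2 j Z) - V 2 j (V 1 (i + 1) Z)))"
    unfolding scaled_L_def V_linear V0_commute[of _ 1] V0_commute[of _ 2] V0_commute[of _ 3]
      V0_commute[of j 0 i]
    using V11[OF i j, of Z] V11[of "i + 1" j Z] V11[of i "j + 1" Z] V11[of "i + 1" "j + 1" Z] i j
    by (simp add: algebra_simps)
  show ?thesis
    unfolding X D E V33[OF i j] V32[OF i j] V22[OF i j]
      V3_linear[OF i j disjI1[OF refl]] V3_linear[OF i j disjI2[OF refl]]
      V2_linear[OF i j disjI1[OF refl]] V2_linear[OF i j disjI2[OF refl]] W1 V1
    by (simp add: algebra_simps)
qed

end

lemma sum'_eq_sum: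
  fixes f :: "'i \<Rightarrow> 'a::comm_monoid_add"
  assumes "finite S" "S \<subseteq> I" "\<And>i. i \<in> I - S \<Longrightarrow> f i = 0"
  shows "sum' f I = sum f S"
proof -
  have "sum' f I = sum' f S"
    by (rule sum.mono_neutral_right') (use assms in auto)
  then show ?thesis using assms(1) by (simp add: sum.eq_sum)
qed

lemma const_linear_p_deriv: "const_linear (p_deriv i)"
  by (simp add: const_linear_def p_deriv_add p_deriv_coeff_const)

lemma p_star_monomial: "t_monomial \<gamma> \<Longrightarrow> p_star i (\<gamma> * Z) = \<gamma> * p_star i Z"
  by (simp add: p_star_def coeffwise_monomial[OF const_linear_p_deriv] mult.left_commute)

lemma p_star_nth: "fps_nth (p_star i Z) n = (if 1 \<le> i then of_int i * p_deriv (nat i) (fps_nth Z n) else 0)"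
  by (simp add: p_star_def of_int_fps)

lemma weyl_scale: "A \<in> weyl \<Longrightarrow> (\<lambda>F. G * A F) \<in> weyl"
  using weyl.comp[OF weyl.mult[of G], of A] by (simp add: comp_def)

lemma weyl_0: "(\<lambda>F :: 'v ppoly. 0 :: 'v ppoly) \<in> weyl"
proof -
  have "(*) 0 = (\<lambda>F :: 'v ppoly. 0)" by auto
  then show ?thesis using weyl.mult[of "0 :: 'v ppoly"] by simp
qed

lemma weyl_if: "(P \<Longrightarrow> A \<in> weyl) \<Longrightarrow> (\<lambda>F. if P then A F else 0) \<in> weyl"
  by (cases P) (simp_all add: weyl_0)

context model
begin

abbreviation "S_fps \<equiv> 1 + b_fps :: 'v ppoly fps"

lemma t_monomial_S: "t_monomial S_fps"
  unfolding one_plus_b_fps by (rule t_monomial_const)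

lemma const_linear_bv: "const_linear (\<lambda>F. b_unit * v l F c)"
  using const_linear_v[of l c] by (auto simp: const_linear_def algebra_simps)

lemma L_monomial: "t_monomial \<delta> \<Longrightarrow> L i (\<delta> * Z) = \<delta> * L i Z"
  by (simp add: L_def p_star_monomial coeffwise_monomial[OF const_linear_bv] sum_distrib_left
      right_diff_distrib mult.left_commute)

lemma S_L:
  assumes "0 \<le> a"
  shows "S_fps * L (a + 1) Z = scaled_L a Z"
proof -
  have 1: "S_fps * p_star (a + 1) Z = V 1 (a + 1) Z"
    by (rule fps_ext) (use assms in \<open>simp add: S_mult_nth p_star_nth v_def v1_def current_def\<close>)
  have 2: "S_fps * coeffwise (\<lambda>F. b_unit * v l F a) Z = V l a Z" for l
    by (rule fps_ext) (simp add: S_mult_nth mult.assoc[symmetric] b_unit)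
  have "S_fps * L (a + 1) Z = - (S_fps * p_star (a + 1) Z)
    + (\<Sum>l\<le>3. \<gamma> l * (S_fps * coeffwise (\<lambda>F. b_unit * v l F a) Z))"
  proof -
    have L: "L (a + 1) Z = - p_star (a + 1) Z + (\<Sum>l\<le>3. \<gamma> l * coeffwise (\<lambda>F. b_unit * v l F a) Z)"
      using assms by (simp add: L_def)
    show ?thesis
      unfolding L distrib_left mult_minus_right sum_distrib_left by (simp only: mult.left_commute)
  qed
  then show ?thesis
    unfolding 1 2 by (simp add: scaled_L_def eval_nat_numeral algebra_simps)
qed

lemma L_nonpos: "i \<le> 0 \<Longrightarrow> L i Z = 0"
  by (simp add: L_def)

lemma fin_L: "fin_fps (\<lambda>a. L (a + 1) Z)"
proof -
  have "(\<lambda>a. if 0 \<le> a then scaled_L a Z else 0) = (\<lambda>a. of_int (-1) * (if 0 \<le> a then V 1 (a + 1) Z else 0)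
     + \<gamma> 0 * V 0 a Z + \<gamma> 1 * V 1 a Z + \<gamma> 2 * V 2 a Z + \<gamma> 3 * V 3 a Z)"
    by (auto simp: scaled_L_def V_neg)
  then have 1: "fin_fps (\<lambda>a. if 0 \<le> a then scaled_L a Z else 0)"
    by (simp only: fin_fps_add fin_fps_monomial[OF t_monomial_of_int fin_V_shift]
        fin_fps_monomial[OF t_monomial_\<gamma> fin_V])
  have 2: "L (a + 1) Z = coeff_fps (rat_const (inverse (1 + b_fract))) * (if 0 \<le> a then scaled_L a Z else 0)" for a
  proof (cases "0 \<le> a")
    case True
    have "coeff_fps (rat_const (inverse (1 + b_fract))) * S_fps = fps_const (b_unit * (1 + b_const) :: 'v ppoly)"
      by (simp add: one_plus_b_fps coeff_fps_def one_plus_b b_unit_def)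
    also have "\<dots> = 1" using b_unit by (simp add: mult.commute)
    finally have "L (a + 1) Z = (coeff_fps (rat_const (inverse (1 + b_fract))) * S_fps) * L (a + 1) Z"
      by simp
    then show ?thesis using True by (simp only: mult.assoc S_L[OF True] if_True)
  qed (simp add: L_nonpos)
  show ?thesis unfolding 2 by (rule fin_fps_monomial[OF t_monomial_const 1])
qed

lemma L_commutator:
  assumes "1 \<le> i" "1 \<le> j"
  shows "commutator (L i) (L j) Z = \<gamma> 3 * structure_fps (i - 1) (j - 1) (\<lambda>a. L (a + 1) Z)
    + \<gamma> 2 * (of_int (i - j) * L (i + j - 1 - e) Z)"
proof -
  have ij: "0 \<le> i - 1" "0 \<le> j - 1" using assms by auto
  have l: "(if 0 \<le> a then scaled_L a Z else 0) = S_fps * L (a + 1) Z" for a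
    by (simp add: S_L L_nonpos)
  have k: "i - 1 + 1 = i" "j - 1 + 1 = j" "i - 1 - (j - 1) = i - j" "i - 1 + (j - 1) - e + 1 = i + j - 1 - e" by auto
  have "S_fps * (S_fps * commutator (L i) (L j) Z) = scaled_L (i - 1) (scaled_L (j - 1) Z) - scaled_L (j - 1) (scaled_L (i - 1) Z)"
    unfolding S_L[OF ij(1), symmetric] S_L[OF ij(2), symmetric] k L_monomial[OF t_monomial_S] commutator_def
    by (simp only: right_diff_distrib)
  also have "\<dots> = S_fps * (\<gamma> 3 * (S_fps * structure_fps (i - 1) (j - 1) (\<lambda>a. L (a + 1) Z))
     + \<gamma> 2 * (of_int (i - j) * (S_fps * L (i + j - 1 - e) Z)))"
    unfolding scaled_L_commutator[OF ij] l k structure_fps_monomial[OF t_monomial_S fin_L] ..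
  also have "\<dots> = S_fps * (S_fps * (\<gamma> 3 * structure_fps (i - 1) (j - 1) (\<lambda>a. L (a + 1) Z)
    + \<gamma> 2 * (of_int (i - j) * L (i + j - 1 - e) Z)))"
    by (simp only: distrib_left mult.left_commute)
  finally show ?thesis by (rule one_plus_b_cancel[OF one_plus_b_cancel])
qed

section \<open>The operators \<open>D\<close> of the bracket formula\<close>

definition base_index :: "int \<Rightarrow> int \<Rightarrow> int" where "base_index i j = i + j - 2 - 2 * e"

text \<open>The summand of \<open>structure_op\<close> that acts on the constraint of index
  \<open>l\<close>. Families start at 0 and constraints at 1, so the mode index is
  \<open>base_index i j - (l - 1)\<close>.\<close>

definition bracket_coeff3 :: "int \<Rightarrow> int \<Rightarrow> int \<Rightarrow> 'v ppoly \<Rightarrow> 'v ppoly" where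
  "bracket_coeff3 i j l F = coeff_const (g 3) * (of_int (structure_coeff (i - 1) (j - 1) (base_index i j - (l - 1))) * current z (base_index i j - (l - 1)) F
    + (if l - 1 = base_index i j then b_const * (of_int ((i - j) * (i + j - 2 - e)) * F) else 0))"

definition bracket_coeff2 :: "int \<Rightarrow> int \<Rightarrow> int \<Rightarrow> 'v ppoly \<Rightarrow> 'v ppoly" where
  "bracket_coeff2 i j l F = coeff_const (g 2) * (if l = i + j - 1 - e then of_int (i - j) * F else 0)"

text \<open>The exponents are lowered by one because a factor \<open>t\<close> stands in front of
  the sum; \<open>r_pos\<close> makes this exact.\<close>

definition bracket_coeff :: "int \<Rightarrow> int \<Rightarrow> int \<Rightarrow> 'v ppoly fps \<Rightarrow> 'v ppoly fps" where
  "bracket_coeff i j l Z = fps_X ^ (r 3 - 1) * coeffwise (bracket_coeff3 i j l) Z + fps_X ^ (r 2 - 1) * coeffwise (bracket_coeff2 i j l) Z"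

lemma weyl_current: "current z n \<in> weyl"
proof -
  consider "n > 0" | "n < 0" | "n = 0" by linarith
  then show ?thesis
  proof cases
    case 1
    then have "current z n = (\<lambda>F. (1 + b_const) * (of_int n * p_deriv (nat n) F))"
      by (auto simp: current_def)
    then show ?thesis using 1 by (auto intro!: weyl_scale weyl.deriv)
  next
    case 2
    then have "current z n = (\<lambda>F. p_var (nat (- n)) * F)" by (auto simp: current_def)
    then show ?thesis by (simp add: weyl.mult)
  next
    case 3
    then have "current z n = (\<lambda>F. coeff_const z * F)" by (auto simp: current_def)
    then show ?thesis by (simp add: weyl.mult)
  qed
qed

lemma weyl_bracket_coeff3: "bracket_coeff3 i j l \<in> weyl"
  unfolding bracket_coeff3_def[abs_def]
  by (intro weyl_scale weyl.add weyl_current weyl_if weyl.mult)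

lemma weyl_bracket_coeff2: "bracket_coeff2 i j l \<in> weyl"
  unfolding bracket_coeff2_def[abs_def] by (intro weyl_scale weyl_if weyl.mult)

lemma bracket_coeff_t_polynomial: "bracket_coeff i j l \<in> t_polynomials weyl"
proof -
  \<comment> \<open>A sum of two indicators, because the exponents \<open>r 3 - 1\<close> and
    \<open>r 2 - 1\<close> may coincide, as they do in family (I).\<close>
  let ?A = "\<lambda>m F. (if m = r 3 - 1 then bracket_coeff3 i j l F else 0) + (if m = r 2 - 1 then bracket_coeff2 i j l F else 0)"
  have "?A m \<in> weyl" for m
    by (intro weyl.add weyl_if weyl_bracket_coeff3 weyl_bracket_coeff2)
  moreover have "bracket_coeff i j l Z = (\<Sum>m\<le>max (r 3) (r 2). fps_X ^ m * coeffwise (?A m) Z)" for Z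
  proof -
    have "fps_X ^ m * coeffwise (?A m) Z =
      (if m = r 3 - 1 then fps_X ^ m * coeffwise (bracket_coeff3 i j l) Z else 0)
      + (if m = r 2 - 1 then fps_X ^ m * coeffwise (bracket_coeff2 i j l) Z else 0)" for m
      by (rule fps_ext) (auto simp: fps_X_power_mult_nth)
    moreover have "r 3 - 1 \<le> max (r 3) (r 2)" "r 2 - 1 \<le> max (r 3) (r 2)" by auto
    ultimately show ?thesis by (simp add: sum.distrib bracket_coeff_def)
  qed
  ultimately show ?thesis unfolding t_polynomials_def
    by (intro CollectI exI[of _ "max (r 3) (r 2)"] exI[of _ ?A] conjI allI impI)
qed

lemma bracket_coeff_nth: "fps_nth (bracket_coeff i j l Z) n =
    (if r 3 - 1 \<le> n then bracket_coeff3 i j l (fps_nth Z (n - (r 3 - 1))) else 0)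
    + (if r 2 - 1 \<le> n then bracket_coeff2 i j l (fps_nth Z (n - (r 2 - 1))) else 0)"
  by (auto simp: bracket_coeff_def fps_X_power_mult_nth)

lemma bracket_coeff3_0 [simp]: "bracket_coeff3 i j l 0 = 0" and bracket_coeff2_0 [simp]: "bracket_coeff2 i j l 0 = 0"
  by (simp_all add: bracket_coeff3_def bracket_coeff2_def)

lemma L_support_nth:
  obtains C where "C0 \<le> C" "\<And>l. l > C + 1 \<Longrightarrow> fps_nth (L l Z) m = 0"
proof -
  have "fin_family (\<lambda>a. fps_nth (L (a + 1) Z) m)" using fin_L unfolding fin_fps_def by blast
  then obtain C where C: "C0 \<le> C" "supported C (\<lambda>a. fps_nth (L (a + 1) Z) m)"
    by (rule fin_familyE[where ?B0.0 = C0])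
  have "fps_nth (L l Z) m = 0" if "l > C + 1" for l
    using C(2)[rule_format, of "l - 1"] that by simp
  with C(1) show ?thesis using that by blast
qed

text \<open>The coefficient of \<open>t ^ n\<close> in \<open>bracket_coeff i j l (L l Z)\<close>
  involves coefficients of \<open>L l Z\<close> of lower order, so the bound on \<open>l\<close>
  must serve all \<open>m \<le> n\<close> at once.\<close>

lemma L_support:
  obtains C where "C0 \<le> C" "\<And>l m. l > C + 1 \<Longrightarrow> m \<le> n \<Longrightarrow> fps_nth (L l Z) m = 0"
proof -
  have "\<exists>C. C0 \<le> C \<and> (\<forall>m\<le>n. \<forall>l>C + 1. fps_nth (L l Z) m = 0)" for n
  proof (induction n)
    case 0
    obtain C where "C0 \<le> C" "\<And>l. l > C + 1 \<Longrightarrow> fps_nth (L l Z) 0 = 0"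
      by (rule L_support_nth[of C0 Z 0]) blast
    then show ?case by auto
  next
    case (Suc n)
    then obtain B where B: "C0 \<le> B" "\<forall>m\<le>n. \<forall>l>B + 1. fps_nth (L l Z) m = 0" by blast
    obtain C where "B \<le> C" "\<And>l. l > C + 1 \<Longrightarrow> fps_nth (L l Z) (Suc n) = 0"
      by (rule L_support_nth[of B Z "Suc n"]) blast
    with B show ?case by (intro exI[of _ C]) (auto simp: le_Suc_eq)
  qed
  then show ?thesis using that by blast
qed

lemma bracket_coeff_finite: "finite {l. l \<ge> 1 \<and> fps_nth (bracket_coeff i j l (L l Z)) n \<noteq> 0}"
proof -
  obtain C where "\<And>l m. l > C + 1 \<Longrightarrow> m \<le> n \<Longrightarrow> fps_nth (L l Z) m = 0"
    by (rule L_support[of 0 n Z]) blast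
  then have "{l. l \<ge> 1 \<and> fps_nth (bracket_coeff i j l (L l Z)) n \<noteq> 0} \<subseteq> {1..C + 1}"
    by (auto simp: bracket_coeff_nth not_less[symmetric])
  then show ?thesis by (rule finite_subset) simp
qed

lemma L_commutator_bracket_coeff:
  assumes ij: "1 \<le> i" "1 \<le> j"
  shows "commutator (L i) (L j) Z = fps_X * fps_sum (\<lambda>l. bracket_coeff i j l (L l Z)) {1..}"
proof (rule fps_ext)
  fix n
  define N where "N = base_index i j"
  obtain C where C: "max N (i + j) \<le> C" "\<And>l m. l > C + 1 \<Longrightarrow> m \<le> n \<Longrightarrow> fps_nth (L l Z) m = 0"
    by (rule L_support[of "max N (i + j)" n Z]) blast
  have D3_sum: "(\<Sum>l\<in>{1..C + 1}. bracket_coeff3 i j l (fps_nth (L l Z) m)) =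
    coeff_const (g 3) * structure_op (i - 1) (j - 1) (\<lambda>a. fps_nth (L (a + 1) Z) m)" if "m \<le> n" for m
  proof -
    have s: "supported C (\<lambda>a. fps_nth (L (a + 1) Z) m)" using C that by (auto simp: L_nonpos)
    have N: "i - 1 + (j - 1) - 2 * e = N" by (simp add: N_def base_index_def)
    have "(\<Sum>l\<in>{1..C + 1}. bracket_coeff3 i j l (fps_nth (L l Z) m)) = (\<Sum>c\<in>{0..C}. bracket_coeff3 i j (c + 1) (fps_nth (L (c + 1) Z) m))"
      by (rule sum.reindex_bij_witness[of _ "\<lambda>c. c + 1" "\<lambda>l. l - 1"]) auto
    also have "\<dots> = coeff_const (g 3) * ((\<Sum>c\<in>{0..C}. of_int (structure_coeff (i - 1) (j - 1) (N - c)) * current z (N - c) (fps_nth (L (c + 1) Z) m))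
       + (\<Sum>c\<in>{0..C}. if c = N then b_const * (of_int ((i - j) * (i + j - 2 - e)) * fps_nth (L (c + 1) Z) m) else 0))"
      unfolding bracket_coeff3_def N_def[symmetric] sum_distrib_left[symmetric] sum.distrib by simp
    also have "(\<Sum>c\<in>{0..C}. if c = N then b_const * (of_int ((i - j) * (i + j - 2 - e)) * fps_nth (L (c + 1) Z) m) else 0)
      = b_const * (of_int ((i - j) * (i + j - 2 - e)) * fps_nth (L (N + 1) Z) m)"
      using C by (auto simp: L_nonpos)
    finally show ?thesis
      unfolding structure_op_eq[OF s] N by (simp add: algebra_simps)
  qed
  have D2_sum: "(\<Sum>l\<in>{1..C + 1}. bracket_coeff2 i j l (fps_nth (L l Z) m)) =
    coeff_const (g 2) * (of_int (i - j) * fps_nth (L (i + j - 1 - e) Z) m)" for m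
  proof -
    have "(\<Sum>l\<in>{1..C + 1}. bracket_coeff2 i j l (fps_nth (L l Z) m)) = coeff_const (g 2) *
      (\<Sum>l\<in>{1..C + 1}. if l = i + j - 1 - e then of_int (i - j) * fps_nth (L l Z) m else 0)"
      unfolding bracket_coeff2_def sum_distrib_left ..
    also have "(\<Sum>l\<in>{1..C + 1}. if l = i + j - 1 - e then of_int (i - j) * fps_nth (L l Z) m else 0) =
      of_int (i - j) * fps_nth (L (i + j - 1 - e) Z) m"
    proof (cases "1 \<le> i + j - 1 - e")
      case True
      then show ?thesis using C e01 by auto
    next
      case False
      then have "(\<Sum>l\<in>{1..C + 1}. if l = i + j - 1 - e then of_int (i - j) * fps_nth (L l Z) m else 0) = 0"
        by (intro sum.neutral) auto
      then show ?thesis using False by (simp add: L_nonpos)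
    qed
    finally show ?thesis .
  qed
  have sum: "fps_nth (fps_sum (\<lambda>l. bracket_coeff i j l (L l Z)) {1..}) k =
    (if r 3 - 1 \<le> k then coeff_const (g 3) * structure_op (i - 1) (j - 1) (\<lambda>a. fps_nth (L (a + 1) Z) (k - (r 3 - 1))) else 0)
    + (if r 2 - 1 \<le> k then coeff_const (g 2) * (of_int (i - j) * fps_nth (L (i + j - 1 - e) Z) (k - (r 2 - 1))) else 0)"
    if "k \<le> n" for k
  proof -
    have "fps_nth (fps_sum (\<lambda>l. bracket_coeff i j l (L l Z)) {1..}) k = (\<Sum>l\<in>{1..C + 1}. fps_nth (bracket_coeff i j l (L l Z)) k)"
      unfolding fps_sum_def fps_nth_Abs_fps
      by (rule sum'_eq_sum) (use C that in \<open>auto simp: bracket_coeff_nth\<close>)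
    also have "\<dots> = (if r 3 - 1 \<le> k then \<Sum>l\<in>{1..C + 1}. bracket_coeff3 i j l (fps_nth (L l Z) (k - (r 3 - 1))) else 0)
      + (if r 2 - 1 \<le> k then \<Sum>l\<in>{1..C + 1}. bracket_coeff2 i j l (fps_nth (L l Z) (k - (r 2 - 1))) else 0)"
      unfolding bracket_coeff_nth sum.distrib by auto
    finally show ?thesis using D3_sum D2_sum that by auto
  qed
  have r: "1 \<le> r 3" "1 \<le> r 2" using r_pos[of 3] r_pos[of 2] by auto
  show "fps_nth (commutator (L i) (L j) Z) n = fps_nth (fps_X * fps_sum (\<lambda>l. bracket_coeff i j l (L l Z)) {1..}) n"
  proof (cases n)
    case 0
    then show ?thesis using r
      unfolding L_commutator[OF ij] fps_add_nth \<gamma>_def t_monomial_nth by auto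
  next
    case (Suc k)
    then have "k \<le> n" "n - 1 = k" by auto
    moreover have "Suc k - r l = k - (r l - 1)" "Suc k < r l \<longleftrightarrow> \<not> r l - 1 \<le> k" if "1 \<le> r l" for l
      using that by auto
    ultimately show ?thesis using r Suc
      unfolding L_commutator[OF ij] fps_add_nth \<gamma>_def t_monomial_nth
      by (simp add: sum of_int_mult_nth del: of_int_diff)
  qed
qed

end

section \<open>Limits of Weyl algebra operators\<close>

text \<open>An eventually constant sequence of operators is the telescoping sum of its differences, hence \<open>weyl_limit\<close> implies \<open>weyl_inf\<close>.\<close>

definition weyl_limit :: "('v ppoly \<Rightarrow> 'v ppoly) \<Rightarrow> bool" where
  "weyl_limit A \<longleftrightarrow> (\<exists>B. (\<forall>N::nat. B N \<in> weyl) \<and> (\<forall>F. \<exists>N0. \<forall>N\<ge>N0. B N F = A F))"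

lemma weyl_limitE:
  assumes "weyl_limit A"
  obtains B where "\<forall>N::nat. B N \<in> weyl" "\<forall>F. \<exists>N0. \<forall>N\<ge>N0. B N F = A F"
proof -
  from assms[unfolded weyl_limit_def] obtain B
    where "(\<forall>N::nat. B N \<in> weyl) \<and> (\<forall>F. \<exists>N0. \<forall>N\<ge>N0. B N F = A F)" ..
  then show ?thesis by (intro that[of B]) simp_all
qed

lemma weyl_limitI:
  assumes "\<And>N::nat. B N \<in> weyl" "\<And>F. \<exists>N0. \<forall>N\<ge>N0. B N F = A F"
  shows "weyl_limit A"
  unfolding weyl_limit_def by (rule exI[of _ B]) (use assms in simp)

lemma weyl_limit_inf:
  fixes A :: "'v ppoly \<Rightarrow> 'v ppoly"
  assumes "weyl_limit A"
  shows "A \<in> weyl_inf"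
proof -
  obtain B where B0: "\<forall>N::nat. B N \<in> weyl" "\<forall>F. \<exists>N0. \<forall>N\<ge>N0. B N F = A F"
    by (rule weyl_limitE[OF assms])
  note B = B0[rule_format]
  define C where "C n = (case n of 0 \<Rightarrow> B 0 | Suc m \<Rightarrow> (\<lambda>F. B n F + (- 1) * B m F))" for n :: nat
  have C_0: "C 0 = B 0" and C_Suc: "C (Suc m) = (\<lambda>F. B (Suc m) F + (- 1) * B m F)" for m
    by (simp_all add: C_def)
  have C_weyl: "C n \<in> weyl" for n
  proof (cases n)
    case 0
    then show ?thesis using B(1)[of 0] by (simp only: C_0)
  next
    case (Suc m)
    then show ?thesis
      using weyl.add[OF B(1)[of "Suc m"] weyl_scale[OF B(1)[of m], of "- 1"]] by (simp only: C_Suc)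
  qed
  have C_sum: "finite {n. C n F \<noteq> 0} \<and> A F = sum' (\<lambda>n. C n F) UNIV" for F
  proof -
    obtain N0 where N0: "\<forall>N\<ge>N0. B N F = A F" using B(2)[of F] by blast
    have z: "C n F = 0" if "n > N0" for n
    proof (cases n)
      case (Suc m)
      then have "B (Suc m) F = A F" "B m F = A F" using that N0 by auto
      then show ?thesis by (simp add: Suc C_Suc)
    qed (use that in simp)
    have "(\<Sum>n\<le>N. C n F) = B N F" for N
    proof (induction N)
      case (Suc N)
      have "(\<Sum>n\<le>Suc N. C n F) = B N F + (B (Suc N) F + - 1 * B N F)"
        using Suc by (simp only: sum.atMost_Suc C_Suc)
      then show ?case by simp
    qed (simp add: C_0)
    moreover have "sum' (\<lambda>n. C n F) UNIV = (\<Sum>n\<le>N0. C n F)"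
      by (rule sum'_eq_sum) (use z in auto)
    moreover have "finite {n. C n F \<noteq> 0}"
    proof (rule finite_subset[of _ "{..N0}"], rule subsetI)
      fix n assume "n \<in> {n. C n F \<noteq> 0}"
      then have "\<not> N0 < n" using z[of n] by auto
      then show "n \<in> {..N0}" by simp
    qed simp
    moreover have "B N0 F = A F" using N0 by simp
    ultimately show ?thesis by simp
  qed
  show ?thesis unfolding weyl_inf_def
    by (intro CollectI exI[of _ C] conjI allI C_weyl C_sum[THEN conjunct1] C_sum[THEN conjunct2])
qed

lemma weyl_limit_weyl: "A \<in> weyl \<Longrightarrow> weyl_limit A"
  by (rule weyl_limitI[of "\<lambda>_. A"]) simp_all

lemma weyl_limit_add:
  assumes "weyl_limit A" "weyl_limit A'"
  shows "weyl_limit (\<lambda>F. A F + A' F)"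
proof -
  obtain B where B0: "\<forall>N::nat. B N \<in> weyl" "\<forall>F. \<exists>N0. \<forall>N\<ge>N0. B N F = A F"
    by (rule weyl_limitE[OF assms(1)])
  note B = B0[rule_format]
  obtain B' where B'0: "\<forall>N::nat. B' N \<in> weyl" "\<forall>F. \<exists>N0. \<forall>N\<ge>N0. B' N F = A' F"
    by (rule weyl_limitE[OF assms(2)])
  note B' = B'0[rule_format]
  have "\<exists>N0. \<forall>N\<ge>N0. B N F + B' N F = A F + A' F" for F
  proof -
    obtain N0 N1 where "\<forall>N\<ge>N0. B N F = A F" "\<forall>N\<ge>N1. B' N F = A' F" using B(2)[of F] B'(2)[of F] by blast
    then show ?thesis by (intro exI[of _ "max N0 N1"]) auto
  qed
  with weyl.add[OF B(1) B'(1)] show ?thesis by (rule weyl_limitI)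
qed

lemma weyl_limit_scale:
  assumes "weyl_limit A"
  shows "weyl_limit (\<lambda>F. G * A F)"
proof -
  obtain B where B0: "\<forall>N::nat. B N \<in> weyl" "\<forall>F. \<exists>N0. \<forall>N\<ge>N0. B N F = A F"
    by (rule weyl_limitE[OF assms(1)])
  note B = B0[rule_format]
  have "(\<lambda>F. G * B N F) \<in> weyl" for N
    using weyl.comp[OF weyl.mult[of G] B(1)[of N]] by (simp add: comp_def)
  moreover have "\<exists>N0. \<forall>N\<ge>N0. G * B N F = G * A F" for F
  proof -
    obtain N0 where "\<forall>N\<ge>N0. B N F = A F" using B(2)[of F] by blast
    then show ?thesis by (intro exI[of _ N0]) simp
  qed
  ultimately show ?thesis by (rule weyl_limitI)
qed

context model
begin

lemma weyl_sum: "(\<And>x. x \<in> S \<Longrightarrow> A x \<in> weyl) \<Longrightarrow> (\<lambda>F. \<Sum>x\<in>S. A x F :: 'v ppoly) \<in> weyl"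
proof (induction S rule: infinite_finite_induct)
  case (insert x F)
  then have "(\<lambda>G. A x G + (\<Sum>x\<in>F. A x G)) \<in> weyl" by (intro weyl.add) simp_all
  with insert show ?case by simp
qed (simp_all add: weyl_0)

text \<open>The threshold \<open>N0\<close> must not depend on the index \<open>c\<close>, since one
  value of \<open>step\<close> uses the family at all indices.\<close>

definition family_limit :: "('v ppoly \<Rightarrow> int \<Rightarrow> 'v ppoly) \<Rightarrow> bool" where
  "family_limit A \<longleftrightarrow> (\<exists>B. (\<forall>N::nat. \<forall>c. (\<lambda>F. B N F c) \<in> weyl) \<and> (\<forall>F. \<exists>N0. \<forall>N\<ge>N0. \<forall>c. B N F c = A F c))"

lemma family_limit_weyl_limit: "family_limit A \<Longrightarrow> weyl_limit (\<lambda>F. A F c)"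
proof -
  assume "family_limit A"
  then obtain B where B: "(\<forall>N::nat. \<forall>c. (\<lambda>F. B N F c) \<in> weyl) \<and> (\<forall>F. \<exists>N0. \<forall>N\<ge>N0. \<forall>c. B N F c = A F c)"
    unfolding family_limit_def ..
  have "\<exists>N0. \<forall>N\<ge>N0. B N F c = A F c" for F
    using B[THEN conjunct2, rule_format, of F] by blast
  with B[THEN conjunct1, rule_format] show ?thesis by (rule weyl_limitI)
qed

lemma family_limit_v1: "family_limit v1"
  unfolding family_limit_def
proof (rule exI[of _ "\<lambda>N F c. if 0 \<le> c \<and> c \<le> int N then current z c F else 0"], intro conjI allI)
  fix N :: nat and c :: int
  show "(\<lambda>F. if 0 \<le> c \<and> c \<le> int N then current z c F else 0) \<in> weyl"
    by (intro weyl_if weyl_current)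
next
  fix F :: "'v ppoly"
  obtain B where B: "0 \<le> B" "supported B (v1 F)" by (rule fin_familyE[OF fin_v1[of F], where ?B0.0 = 0])
  have "(if 0 \<le> c \<and> c \<le> int N then current z c F else 0) = v1 F c" if "nat B \<le> N" for N c
  proof (cases "0 \<le> c \<and> c \<le> int N")
    case False
    then show ?thesis using B(2)[rule_format, of c] that by auto
  qed (simp add: v1_def)
  then show "\<exists>N0. \<forall>N\<ge>N0. \<forall>c. (if 0 \<le> c \<and> c \<le> int N then current z c F else 0) = v1 F c" by blast
qed

lemma family_limit_step:
  assumes "family_limit A" and A: "\<And>F. fin_family (A F)"
  shows "family_limit (\<lambda>F. step (A F))"
proof -
  obtain B where "(\<forall>N::nat. \<forall>c. (\<lambda>F. B N F c) \<in> weyl) \<and> (\<forall>F. \<exists>N0. \<forall>N\<ge>N0. \<forall>c. B N F c = A F c)"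
    using assms(1) unfolding family_limit_def ..
  note B = this[THEN conjunct1, rule_format] this[THEN conjunct2, rule_format]
  show ?thesis unfolding family_limit_def
  proof (rule exI[of _ "\<lambda>N F c. if 0 \<le> c \<and> c \<le> int N then (\<Sum>a\<in>{0..int N}. current z (c - e - a) (B N F a))
        + b_const * (of_int c * B N F (c - e)) else 0"], intro conjI allI)
    fix N :: nat and c :: int
    have "(\<lambda>F. current z n (B N F a)) \<in> weyl" for n a
      using weyl.comp[OF weyl_current[of n] B(1)[of N a]] by (simp add: comp_def)
    then show "(\<lambda>F. if 0 \<le> c \<and> c \<le> int N then (\<Sum>a\<in>{0..int N}. current z (c - e - a) (B N F a))
        + b_const * (of_int c * B N F (c - e)) else 0) \<in> weyl"
      by (intro weyl_if weyl.add weyl_sum weyl_scale B)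
  next
    fix F :: "'v ppoly"
    obtain N0 where N0: "\<forall>N\<ge>N0. \<forall>c. B N F c = A F c" using B(2)[of F] by blast
    obtain C where C: "0 \<le> C" "supported C (A F)" by (rule fin_familyE[OF A[of F], where ?B0.0 = 0])
    obtain C' where C': "C \<le> C'" "supported C' (step (A F))"
      by (rule fin_familyE[OF fin_family_step[OF A[of F]], where ?B0.0 = C])
    have "(if 0 \<le> c \<and> c \<le> int N then (\<Sum>a\<in>{0..int N}. current z (c - e - a) (B N F a))
        + b_const * (of_int c * B N F (c - e)) else 0) = step (A F) c" if N: "N \<ge> max N0 (nat C')" for N c
    proof (cases "0 \<le> c \<and> c \<le> int N")
      case True
      have "c \<notin> {0..int N} \<Longrightarrow> A F c = 0" for c using C C' N by auto
      then show ?thesis using True N N0 by (subst step_eq[of "{0..int N}"]) auto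
    next
      case False
      then have "step (A F) c = 0" using C'(2) N by auto
      then show ?thesis using False by auto
    qed
    then show "\<exists>N0. \<forall>N\<ge>N0. \<forall>c. (if 0 \<le> c \<and> c \<le> int N then (\<Sum>a\<in>{0..int N}. current z (c - e - a) (B N F a))
        + b_const * (of_int c * B N F (c - e)) else 0) = step (A F) c" by blast
  qed
qed

lemma weyl_limit_v: "weyl_limit (\<lambda>F. v l F c)"
proof -
  have v2: "family_limit v2" unfolding v2_def[abs_def] by (intro family_limit_step family_limit_v1 fin_v1)
  have v3: "family_limit v3" unfolding v3_def[abs_def] by (intro family_limit_step v2 fin_v2)
  have "(*) 1 = (\<lambda>F :: 'v ppoly. F)" by auto
  then have "(\<lambda>F :: 'v ppoly. F) \<in> weyl" using weyl.mult[of "1 :: 'v ppoly"] by simp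
  then have "(\<lambda>F. if c = 0 then F else 0 :: 'v ppoly) \<in> weyl" by (intro weyl_if)
  then show ?thesis
    using family_limit_weyl_limit[OF family_limit_v1, of c] family_limit_weyl_limit[OF v2, of c]
      family_limit_weyl_limit[OF v3, of c]
    by (cases "l = 0"; cases "l = 1"; cases "l = 2"; simp add: v_def weyl_limit_weyl)
qed

section \<open>The bracket in explicit form\<close>

lemma Sum_any_three:
  fixes f :: "int \<Rightarrow> 'v ppoly"
  assumes "\<And>m. m > B \<Longrightarrow> f m = 0" "\<And>m. m < - R \<Longrightarrow> f m = 0" "0 \<le> B" "0 \<le> R"
  shows "Sum_any f = (\<Sum>m\<in>{1..R}. f (- m)) + f 0 + (\<Sum>m\<in>{1..B}. f m)"
proof -
  have "Sum_any f = sum f {- R..B}"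
    by (rule Sum_any.expand_superset) (use assms in \<open>auto simp: not_less[symmetric]\<close>)
  also have "{- R..B} = {- R..-1} \<union> {0} \<union> {1..B}" using assms by auto
  also have "sum f \<dots> = sum f {- R..-1} + f 0 + sum f {1..B}"
    by (subst sum.union_disjoint) (auto simp: sum.union_disjoint)
  also have "sum f {- R..-1} = (\<Sum>m\<in>{1..R}. f (- m))"
    by (rule sum.reindex_bij_witness[of _ uminus uminus]) auto
  finally show ?thesis .
qed

text \<open>The sum over modes is split by sign: negative modes multiply by \<open>p_n\<close> with
  the constant weight \<open>2 * (i - j)\<close>, the mode 0 multiplies by \<open>z\<close>,
  positive modes are \<open>(1 + b) * p_n^*\<close>.\<close>

lemma structure_fps_formula:
  assumes ij: "1 \<le> i" "1 \<le> j" and B: "0 \<le> B" "\<And>m. m > B \<Longrightarrow> structure_coeff (i - 1) (j - 1) m = 0"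
  shows "structure_fps (i - 1) (j - 1) (\<lambda>a. L (a + 1) Z) =
    2 * of_int (i - j) * fps_sum (\<lambda>n. p_mult n (L (base_index i j + 1 + n) Z)) {1..}
    + b_fps * of_int (i - j) * of_int (i + j - 2 - e) * L (base_index i j + 1) Z
    + of_int (structure_coeff (i - 1) (j - 1) 0) * coeff_fps z * L (base_index i j + 1) Z
    + S_fps * (\<Sum>m\<in>{1..B}. of_int (structure_coeff (i - 1) (j - 1) m) * p_star m (L (base_index i j + 1 - m) Z))"
proof (rule fps_ext)
  fix n
  define N where "N = base_index i j"
  let ?t = "structure_coeff (i - 1) (j - 1)"
  define w where "w a = fps_nth (L (a + 1) Z) n" for a
  have N: "i - 1 + (j - 1) - 2 * e = N" by (simp add: N_def base_index_def)
  have "fin_family w" using fin_L[of Z] by (simp add: fin_fps_def w_def[abs_def])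
  then obtain C where C: "N \<le> C" "supported C w" by (rule fin_familyE[where ?B0.0 = N])
  define R where "R = C - N"
  have R: "0 \<le> R" using C by (simp add: R_def)
  have w0: "w (N + m) = 0" if "m > R" for m using C that by (auto simp: R_def)
  have "Sum_any (\<lambda>m. of_int (?t m) * current z m (w (N - m))) =
     (\<Sum>m\<in>{1..R}. of_int (?t (- m)) * current z (- m) (w (N - - m))) + of_int (?t 0) * current z 0 (w (N - 0))
     + (\<Sum>m\<in>{1..B}. of_int (?t m) * current z m (w (N - m)))"
    by (rule Sum_any_three) (use B R w0[of "- _"] in auto)
  also have "(\<Sum>m\<in>{1..R}. of_int (?t (- m)) * current z (- m) (w (N - - m))) =
     of_int (2 * (i - j)) * (\<Sum>m\<in>{1..R}. p_var (nat m) * w (N + m))"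
    unfolding sum_distrib_left by (intro sum.cong) (auto simp: structure_coeff_def current_def)
  also have "(\<Sum>m\<in>{1..R}. p_var (nat m) * w (N + m)) =
     fps_nth (fps_sum (\<lambda>n. p_mult n (L (N + 1 + n) Z)) {1..}) n"
  proof -
    have "fps_nth (fps_sum (\<lambda>n. p_mult n (L (N + 1 + n) Z)) {1..}) n =
      sum' (\<lambda>m. p_var (nat m) * w (N + m)) {1..}"
      by (simp add: fps_sum_def p_mult_def w_def ac_simps)
    also have "\<dots> = (\<Sum>m\<in>{1..R}. p_var (nat m) * w (N + m))"
      by (rule sum'_eq_sum) (use w0 in auto)
    finally show ?thesis by simp
  qed
  also have "(\<Sum>m\<in>{1..B}. of_int (?t m) * current z m (w (N - m))) =
    fps_nth (S_fps * (\<Sum>m\<in>{1..B}. of_int (?t m) * p_star m (L (N + 1 - m) Z))) n"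
    unfolding S_mult_nth fps_sum_nth sum_distrib_left of_int_mult_nth
  proof (intro sum.cong refl)
    fix m assume m: "m \<in> {1..B}"
    have a: "N - m + 1 = N + 1 - m" by simp
    have w: "w (N - m) = fps_nth (L (N + 1 - m) Z) n" unfolding w_def a ..
    show "of_int (?t m) * current z m (w (N - m)) =
      (1 + b_const) * (of_int (?t m) * fps_nth (p_star m (L (N + 1 - m) Z)) n)"
      unfolding w using m by (simp add: current_def p_star_nth mult.left_commute)
  qed
  finally have 1: "Sum_any (\<lambda>m. of_int (?t m) * current z m (w (N - m))) =
     of_int (2 * (i - j)) * fps_nth (fps_sum (\<lambda>n. p_mult n (L (N + 1 + n) Z)) {1..}) n
     + of_int (?t 0) * (coeff_const z * w N)
     + fps_nth (S_fps * (\<Sum>m\<in>{1..B}. of_int (?t m) * p_star m (L (N + 1 - m) Z))) n"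
    by (simp add: current_def)
  have k: "i - 1 - (j - 1) = i - j" "i - 1 + (j - 1) - e = i + j - 2 - e" by auto
  have c1: "fps_nth (2 * of_int (i - j) * X) n = of_int (2 * (i - j)) * fps_nth X n" for X :: "'v ppoly fps"
    using of_int_mult_nth[of "2 * (i - j)" X n] by simp
  have c2: "fps_nth (b_fps * of_int (i - j) * of_int k * X) n = b_const * (of_int ((i - j) * k) * fps_nth X n)"
    for X :: "'v ppoly fps" and k
  proof -
    have "b_fps * of_int (i - j) * of_int k * X = fps_const b_const * (of_int ((i - j) * k) * X)"
      by (simp add: b_fps_def coeff_fps_def mult.assoc)
    then show ?thesis by (simp only: fps_mult_left_const_nth of_int_mult_nth)
  qed
  have c3: "fps_nth (of_int k * coeff_fps z * X) n = of_int k * (coeff_const z * fps_nth X n)"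
    for X :: "'v ppoly fps" and k
    unfolding mult.assoc of_int_mult_nth by (simp add: coeff_fps_def)
  show "fps_nth (structure_fps (i - 1) (j - 1) (\<lambda>a. L (a + 1) Z)) n = fps_nth
    (2 * of_int (i - j) * fps_sum (\<lambda>n. p_mult n (L (base_index i j + 1 + n) Z)) {1..}
    + b_fps * of_int (i - j) * of_int (i + j - 2 - e) * L (base_index i j + 1) Z
    + of_int (?t 0) * coeff_fps z * L (base_index i j + 1) Z
    + S_fps * (\<Sum>m\<in>{1..B}. of_int (?t m) * p_star m (L (base_index i j + 1 - m) Z))) n"
    unfolding structure_fps_nth w_def[symmetric] structure_op_def N k 1 fps_add_nth c1 c2 c3 N_def[symmetric]
    by (simp only: ac_simps)
qed

text \<open>For \<open>m < min i j - e\<close> both branches of \<open>structure_coeff\<close> are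
  active and differ by \<open>3 * (i - j)\<close>; up to \<open>max i j - 1 - e\<close> only that of
  the larger index is. For \<open>e = 1\<close> and \<open>min i j = 1\<close> the second range
  starts at 0. There the hypothesis on \<open>h\<close> applies, as \<open>p_0^* = 0\<close>; the
  mode 0 is accounted for separately with \<open>z\<close>.\<close>

lemma structure_coeff_sum:
  fixes h :: "int \<Rightarrow> 'v ppoly fps"
  assumes ij: "1 \<le> i" "1 \<le> j" and h: "\<And>m. m \<le> 0 \<Longrightarrow> h m = 0"
  shows "(\<Sum>m\<in>{1..max i j - 1}. of_int (structure_coeff (i - 1) (j - 1) m) * h m) =
    3 * of_int (i - j) * (\<Sum>m\<in>{1..min i j - 1 - e}. h m)
    + of_int (sgn (i - j)) * (\<Sum>m\<in>{min i j - e..max i j - 1 - e}. of_int (2 * max i j - 2 * m - min i j - 1 - 2 * e) * h m)"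
proof -
  let ?A = "{1..max i j - 1}"
  have 1: "3 * of_int (i - j) * (\<Sum>m\<in>{1..min i j - 1 - e}. h m) =
    (\<Sum>m\<in>?A. of_int (if m \<le> min i j - 1 - e then 3 * (i - j) else 0) * h m)"
    unfolding sum_distrib_left
    by (rule sum.mono_neutral_cong_left) (use e01 in auto)
  have 2: "of_int (sgn (i - j)) * (\<Sum>m\<in>{min i j - e..max i j - 1 - e}. of_int (2 * max i j - 2 * m - min i j - 1 - 2 * e) * h m)
    = (\<Sum>m\<in>?A. of_int (if min i j - e \<le> m \<and> m \<le> max i j - 1 - e
        then sgn (i - j) * (2 * max i j - 2 * m - min i j - 1 - 2 * e) else 0) * h m)"
    unfolding sum_distrib_left
    by (rule sum.mono_neutral_cong) (use e01 ij h in \<open>auto simp: mult.assoc\<close>)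
  show ?thesis
    unfolding 1 2 sum.distrib[symmetric] distrib_right[symmetric] of_int_add[symmetric]
  proof (intro sum.cong refl arg_cong2[where f = "(*)"] arg_cong[where f = of_int])
    fix m assume "m \<in> {1..max i j - 1}"
    then show "structure_coeff (i - 1) (j - 1) m = (if m \<le> min i j - 1 - e then 3 * (i - j) else 0)
      + (if min i j - e \<le> m \<and> m \<le> max i j - 1 - e
        then sgn (i - j) * (2 * max i j - 2 * m - min i j - 1 - 2 * e) else 0)"
      using e01 by (auto simp: structure_coeff_def max_def min_def sgn_if)
  qed
qed

end

section \<open>The evolution equation\<close>

definition weight :: "(nat \<Rightarrow>\<^sub>0 nat) \<Rightarrow> nat" where
  "weight m = (\<Sum>x\<in>keys m. (x + 1) * lookup m x)"

lemma weight_superset: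
  "finite A \<Longrightarrow> keys m \<subseteq> A \<Longrightarrow> weight m = (\<Sum>x\<in>A. (x + 1) * lookup m x)"
  unfolding weight_def by (rule sum.mono_neutral_left) (auto simp: in_keys_iff)

lemma weight_add_unit_monom: "weight (m + unit_monom x) = weight m + (x + 1)"
proof -
  let ?A = "insert x (keys m)"
  have "weight (m + unit_monom x) = (\<Sum>y\<in>?A. (y + 1) * lookup (m + unit_monom x) y)"
    by (rule weight_superset) (auto simp: in_keys_iff lookup_add lookup_single when_def split: if_splits)
  also have "\<dots> = (\<Sum>y\<in>?A. (y + 1) * lookup m y) + (\<Sum>y\<in>?A. if y = x then x + 1 else 0)"
    unfolding sum.distrib[symmetric]
    by (intro sum.cong) (auto simp: lookup_add lookup_single when_def)
  also have "(\<Sum>y\<in>?A. (y + 1) * lookup m y) = weight m"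
    by (rule weight_superset[symmetric]) auto
  finally show ?thesis by simp
qed

text \<open>The degree is an integer because the operators lower it, possibly below 0, where only
  the zero polynomial is homogeneous.\<close>

definition hom_degree :: "int \<Rightarrow> 'v ppoly \<Rightarrow> bool" where
  "hom_degree n F \<longleftrightarrow> (\<forall>m. lookup F m \<noteq> 0 \<longrightarrow> int (weight m) = n)"

lemma homogeneous_hom_degree: "homogeneous n F \<longleftrightarrow> hom_degree (int n) F"
  unfolding homogeneous_def hom_degree_def weight_def[symmetric] by (auto simp: in_keys_iff)

lemma hom_0 [simp]: "hom_degree n 0" by (simp add: hom_degree_def)
lemma hom_add: "hom_degree n F \<Longrightarrow> hom_degree n G \<Longrightarrow> hom_degree n (F + G)"
  by (auto simp: hom_degree_def lookup_add) (metis add.right_neutral)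
lemma hom_coeff_const: "hom_degree n F \<Longrightarrow> hom_degree n (coeff_const c * F)"
  unfolding hom_degree_def lookup_coeff_const_mult by (metis mult_zero_right)
lemma hom_sum: "(\<And>x. x \<in> S \<Longrightarrow> hom_degree n (f x)) \<Longrightarrow> hom_degree n (sum f S)"
  by (induction S rule: infinite_finite_induct) (auto intro: hom_add)
lemma hom_of_int: "hom_degree n F \<Longrightarrow> hom_degree n (of_int k * F :: 'v ppoly)"
proof -
  obtain c where c: "of_int k = (coeff_const c :: 'v ppoly)" using of_int_coeff_const by blast
  show "hom_degree n F \<Longrightarrow> ?thesis" unfolding c by (rule hom_coeff_const)
qed

lemma hom_p_var: "1 \<le> i \<Longrightarrow> hom_degree n F \<Longrightarrow> hom_degree (n + int i) (p_var i * F)"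
  unfolding hom_degree_def
proof (intro allI impI)
  fix m assume i: "1 \<le> i" and F: "\<forall>m. lookup F m \<noteq> 0 \<longrightarrow> int (weight m) = n"
    and "lookup (p_var i * F) m \<noteq> 0"
  then have *: "lookup m (i - 1) > 0" "lookup F (m - unit_monom (i - 1)) \<noteq> 0"
    by (auto simp: lookup_p_var_mult split: if_splits)
  have "weight m = weight (m - unit_monom (i - 1)) + i"
    using weight_add_unit_monom[of "m - unit_monom (i - 1)" "i - 1"] unit_monom_minus[OF *(1)] i
    by (simp add: add.commute)
  then show "int (weight m) = n + int i" using F *(2) by auto
qed

lemma hom_p_deriv: "1 \<le> i \<Longrightarrow> hom_degree n F \<Longrightarrow> hom_degree (n - int i) (p_deriv i F)"
  unfolding hom_degree_def
proof (intro allI impI)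
  fix m assume i: "1 \<le> i" and F: "\<forall>m. lookup F m \<noteq> 0 \<longrightarrow> int (weight m) = n"
    and "lookup (p_deriv i F) m \<noteq> 0"
  then have "lookup F (m + unit_monom (i - 1)) \<noteq> 0" by (auto simp: lookup_p_deriv)
  then have "int (weight (m + unit_monom (i - 1))) = n" using F by blast
  then show "int (weight m) = n - int i" using i weight_add_unit_monom[of m "i - 1"] by simp
qed

lemma hom_current:
  assumes "hom_degree n F"
  shows "hom_degree (n - k) (current z k F)"
proof -
  consider "k > 0" | "k < 0" | "k = 0" by linarith
  then show ?thesis
  proof cases
    case 1
    have "hom_degree (n - int (nat k)) (p_deriv (nat k) F)" using 1 assms by (intro hom_p_deriv) auto
    then show ?thesis
      using 1 unfolding current_def one_plus_b by (auto intro!: hom_coeff_const hom_of_int)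
  next
    case 2
    then show ?thesis using hom_p_var[of "nat (- k)" n F] assms by (simp add: current_def)
  next
    case 3
    then show ?thesis using assms by (simp add: current_def hom_coeff_const)
  qed
qed

lemma coeff_torsion_free: "0 < n \<Longrightarrow> of_nat n * c = 0 \<Longrightarrow> c = (0 :: 'v coeff)"
proof -
  assume n: "0 < n" "of_nat n * c = 0"
  have "coeff_const c * of_nat n = (0 :: 'v ppoly)"
    unfolding coeff_const_of_nat[symmetric]
  proof -
    show "coeff_const c * coeff_const (rat_const (of_nat n)) = (0 :: 'v ppoly)"
      using n(2) by (simp add: rat_const_of_nat coeff_const_mult[symmetric] mult.commute)
  qed
  then have "coeff_const c = (0 :: 'v ppoly)" using ppoly_torsion_free[OF n(1), of "coeff_const c"]
    by (simp add: mult.commute)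
  then have "lookup (coeff_const c :: 'v ppoly) 0 = 0" by simp
  then show "c = 0" by (simp add: coeff_const_def)
qed

lemma Euler_lookup:
  assumes "\<And>i. i > R \<Longrightarrow> p_deriv i F = 0"
  shows "lookup (\<Sum>i\<in>{1..R}. p_var i * (of_nat i * p_deriv i F)) m =
    of_nat (weight m) * lookup F m"
proof -
  have p: "lookup (p_var i * p_deriv i F) m = of_nat (lookup m (i - 1)) * lookup F m" for i
  proof (cases "lookup m (i - 1) > 0")
    case True
    have "m - unit_monom (i - 1) + unit_monom (i - 1) = m" using unit_monom_minus[OF True] by (simp add: add.commute)
    moreover have "lookup (m - unit_monom (i - 1)) (i - 1) + 1 = lookup m (i - 1)"
      using True by (simp add: lookup_minus)
    ultimately show ?thesis using True unfolding lookup_p_var_mult lookup_p_deriv by simp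
  qed (simp add: lookup_p_var_mult)
  \<comment> \<open>\<open>R'\<close> also exceeds every variable of the monomial \<open>m\<close>,
    which need not occur in \<open>F\<close>.\<close>
  define R' where "R' = R + Suc (Max (insert 0 (keys m)))"
  have R': "keys m \<subseteq> {..<R'}" "R \<le> R'"
    by (auto simp: R'_def less_Suc_eq_le intro!: trans_le_add2)
  have "(\<Sum>i\<in>{1..R}. p_var i * (of_nat i * p_deriv i F)) = (\<Sum>i\<in>{1..R'}. p_var i * (of_nat i * p_deriv i F))"
    by (rule sum.mono_neutral_left) (use assms R' in auto)
  also have "lookup \<dots> m = (\<Sum>i\<in>{1..R'}. of_nat (i * lookup m (i - 1)) * lookup F m)"
    unfolding lookup_sum
  proof (intro sum.cong refl)
    fix i
    have "p_var i * (of_nat i * p_deriv i F) = coeff_const (rat_const (of_nat i)) * (p_var i * p_deriv i F)"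
      by (simp add: coeff_const_of_nat mult.left_commute)
    then show "lookup (p_var i * (of_nat i * p_deriv i F)) m =
      of_nat (i * lookup m (i - 1)) * lookup F m"
      by (simp add: rat_const_of_nat lookup_coeff_const_mult p mult.assoc)
  qed
  also have "\<dots> = of_nat (\<Sum>i\<in>{1..R'}. i * lookup m (i - 1)) * lookup F m"
    by (simp add: sum_distrib_right)
  also have "(\<Sum>i\<in>{1..R'}. i * lookup m (i - 1)) = (\<Sum>x\<in>{..<R'}. (x + 1) * lookup m x)"
    by (rule sum.reindex_bij_witness[of _ "\<lambda>x. x + 1" "\<lambda>i. i - 1"]) auto
  also have "\<dots> = weight m" by (rule weight_superset[symmetric]) (use R' in auto)
  finally show ?thesis .
qed

lemma Euler_hom:
  assumes "\<And>i. i > R \<Longrightarrow> p_deriv i F = 0" "hom_degree (int n) F"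
  shows "(\<Sum>i\<in>{1..R}. p_var i * (of_nat i * p_deriv i F)) = of_nat n * (F :: 'v ppoly)"
proof (rule poly_mapping_eqI)
  fix m
  have "lookup (of_nat n * F) m = of_nat n * lookup F m"
    unfolding coeff_const_of_nat[symmetric] lookup_coeff_const_mult rat_const_of_nat ..
  moreover have "lookup F m = 0 \<or> weight m = n"
    using assms(2) by (auto simp: hom_degree_def)
  moreover have "lookup (\<Sum>i\<in>{1..R}. p_var i * (of_nat i * p_deriv i F)) m =
    of_nat (weight m) * lookup F m"
    by (rule Euler_lookup) (rule assms(1))
  ultimately show "lookup (\<Sum>i\<in>{1..R}. p_var i * (of_nat i * p_deriv i F)) m = lookup (of_nat n * F) m"
    by auto
qed

lemma Euler_inj:
  fixes F :: "'v ppoly"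
  assumes "\<And>i. i > R \<Longrightarrow> p_deriv i F = 0" "1 \<le> j"
    and "(\<Sum>i\<in>{1..R}. p_var i * (of_nat i * p_deriv i F)) + of_nat j * F = 0"
  shows "F = 0"
proof (rule poly_mapping_eqI)
  fix m
  have "lookup (of_nat j * F) m = of_nat j * lookup F m"
    unfolding coeff_const_of_nat[symmetric] lookup_coeff_const_mult rat_const_of_nat ..
  then have "lookup ((\<Sum>i\<in>{1..R}. p_var i * (of_nat i * p_deriv i F)) + of_nat j * F) m
    = of_nat (weight m + j) * lookup F m"
    unfolding lookup_add using Euler_lookup[of R F m, OF assms(1)] by (simp add: distrib_right)
  then have "of_nat (weight m + j) * lookup F m = 0" unfolding assms(3) by simp
  then show "lookup F m = lookup 0 m"
    using coeff_torsion_free[of "weight m + j" "lookup F m"] assms(2) by simp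
qed

text \<open>The hypotheses say that the 1-form with components \<open>x i / i\<close> is closed and
  that its contraction with the Euler field is 0. By Cartan's formula its Lie derivative along the
  Euler field vanishes, and that derivative multiplies each monomial of \<open>x j\<close> by a
  positive number.\<close>

lemma integrable_family_0:
  fixes x :: "nat \<Rightarrow> 'v ppoly"
  assumes R: "\<And>i. i > R \<Longrightarrow> x i = 0" and sum: "(\<Sum>i\<in>{1..R}. p_var i * x i) = 0"
    and sym: "\<And>i j. 1 \<le> i \<Longrightarrow> 1 \<le> j \<Longrightarrow> of_nat j * p_deriv j (x i) = of_nat i * p_deriv i (x j)"
    and j: "1 \<le> j"
  shows "x j = 0"
proof -
  obtain R0 where R0: "\<forall>i>R0. p_deriv i (x j) = 0" using p_deriv_finite by blast
  define R' where "R' = max (max R R0) j"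
  have R': "R \<le> R'" "R0 \<le> R'" "j \<le> R'" by (auto simp: R'_def)
  have sum': "(\<Sum>i\<in>{1..R'}. p_var i * x i) = 0"
    unfolding sum[symmetric] by (rule sum.mono_neutral_right) (use R R' in auto)
  have dsum: "p_deriv j (sum f S) = (\<Sum>i\<in>S. p_deriv j (f i))" for f :: "nat \<Rightarrow> 'v ppoly" and S
    by (induction S rule: infinite_finite_induct) (auto simp: p_deriv_add)
  have "0 = of_nat j * p_deriv j (\<Sum>i\<in>{1..R'}. p_var i * x i)" unfolding sum' by simp
  also have "\<dots> = (\<Sum>i\<in>{1..R'}. p_var i * (of_nat i * p_deriv i (x j)) + (if i = j then of_nat j * x j else 0))"
    unfolding dsum sum_distrib_left
  proof (intro sum.cong refl)
    fix i assume i: "i \<in> {1..R'}"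
    have "of_nat j * p_deriv j (p_var i * x i) = p_var i * (of_nat j * p_deriv j (x i)) + (if i = j then of_nat j * x j else 0)"
      using i j by (subst p_deriv_p_var) (auto simp: distrib_left mult.left_commute)
    then show "of_nat j * p_deriv j (p_var i * x i) = p_var i * (of_nat i * p_deriv i (x j)) + (if i = j then of_nat j * x j else 0)"
      using sym[of i j] i j by simp
  qed
  also have "\<dots> = (\<Sum>i\<in>{1..R'}. p_var i * (of_nat i * p_deriv i (x j))) + of_nat j * x j"
    using j R' by (simp add: sum.distrib)
  finally show ?thesis
    using Euler_inj[of R' "x j" j] R0 R' j by simp
qed

section \<open>The recursion that solves the evolution equation\<close>

fun evolve :: "nat \<Rightarrow> (nat \<Rightarrow> 'v coeff) \<Rightarrow> (nat \<Rightarrow> 'v ppoly \<Rightarrow> 'v ppoly) \<Rightarrow> nat \<Rightarrow> 'v ppoly" where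
  "evolve d q H 0 = 1"
| "evolve d q H (Suc n) = coeff_const (rat_const (inverse (of_nat (Suc n)))) *
    (\<Sum>m\<in>{1..d}. if m \<le> Suc n then coeff_const (q m) * H m (evolve d q H (Suc n - m)) else 0)"

definition evolution_op :: "nat \<Rightarrow> (nat \<Rightarrow> 'v coeff) \<Rightarrow> nat \<Rightarrow> 'v ppoly \<Rightarrow> 'v ppoly" where
  "evolution_op k u m F = sum' (\<lambda>i. p_var i * M_op k m u i F) {1..}"

lemma M_op_finite: "\<exists>R. \<forall>i>R. M_op k m u i F = 0"
proof -
  let ?G = "((Y_plus \<circ> Lambda_Y_prod k u) ^^ m)
        (Poly_Mapping.single 0 (coeff_const (rat_const (inverse (1 + b_fract))) * F))"
  obtain R where "\<forall>i\<in>keys ?G. i \<le> R"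
    using finite_nat_set_iff_bounded_le finite_keys by blast
  then have "\<forall>i>R. M_op k m u i F = 0"
    unfolding M_op_def by (metis in_keys_iff not_le)
  then show ?thesis by blast
qed

lemma evolution_op_eq: "(\<And>i. i > R \<Longrightarrow> M_op k m u i F = 0) \<Longrightarrow> evolution_op k u m F = (\<Sum>i\<in>{1..R}. p_var i * M_op k m u i F)"
  unfolding evolution_op_def by (rule sum'_eq_sum) auto

lemma common_bound:
  assumes "\<And>m::nat. \<exists>R::nat. \<forall>i>R. P m i"
  shows "\<exists>R. \<forall>m\<le>n. \<forall>i>R. P m i"
proof (induction n)
  case 0
  then show ?case using assms[of 0] by auto
next
  case (Suc n)
  then obtain R where R: "\<forall>m\<le>n. \<forall>i>R. P m i" by blast
  obtain R' where R': "\<forall>i>R'. P (Suc n) i" using assms by blast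
  show ?case
    by (rule exI[of _ "max R R'"]) (use R R' in \<open>auto simp: le_Suc_eq\<close>)
qed

section \<open>The evolution equation against the constraints\<close>

lemma L_op_nth:
  assumes "1 \<le> i"
  shows "fps_nth (L_op k d u q (int i) Z) n = - (of_nat i * p_deriv i (fps_nth Z n))
    + (\<Sum>m\<in>{1..d}. if m \<le> n then coeff_const (q m) * M_op k m u i (fps_nth Z (n - m)) else 0)"
proof -
  have "fps_nth (\<Sum>m=1..d. coeff_fps (q m) * fps_X ^ m * coeffwise (M_op k m u i) Z) n
    = (\<Sum>m\<in>{1..d}. if m \<le> n then coeff_const (q m) * M_op k m u i (fps_nth Z (n - m)) else 0)"
    unfolding fps_sum_nth t_monomial_nth by (intro sum.cong) auto
  moreover have "fps_nth (p_star (int i) Z) n = of_nat i * p_deriv i (fps_nth Z n)"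
    using assms by (simp add: p_star_nth)
  moreover have "L_op k d u q (int i) Z = - p_star (int i) Z + (\<Sum>m=1..d. coeff_fps (q m) * fps_X ^ m * coeffwise (M_op k m u i) Z)"
    using assms by (simp add: L_op_def)
  ultimately show ?thesis by simp
qed

lemma evolution_nth:
  "evolution k d u q \<tau> \<longleftrightarrow> fps_nth \<tau> 0 = 1 \<and> (\<forall>n. of_nat (Suc n) * fps_nth \<tau> (Suc n) =
    (\<Sum>m\<in>{1..d}. if m \<le> Suc n then coeff_const (q m) * evolution_op k u m (fps_nth \<tau> (Suc n - m)) else 0))"
proof -
  have "fps_nth (\<Sum>m=1..d. coeff_fps (q m) * fps_X ^ (m - 1) *
       coeffwise (\<lambda>F. sum' (\<lambda>i. p_var i * M_op k m u i F) {1..}) \<tau>) n =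
    (\<Sum>m\<in>{1..d}. if m \<le> Suc n then coeff_const (q m) * evolution_op k u m (fps_nth \<tau> (Suc n - m)) else 0)" for n
    unfolding fps_sum_nth t_monomial_nth by (intro sum.cong) (auto simp: evolution_op_def)
  then show ?thesis
    unfolding evolution_def fps_eq_iff by (simp add: add.commute)
qed

lemma evolution_exists:
  fixes u q :: "nat \<Rightarrow> 'v coeff"
  shows "evolution k d u q (Abs_fps (evolve d q (evolution_op k u)))"
  unfolding evolution_nth
proof (intro conjI allI)
  fix n
  have "of_nat (Suc n) * coeff_const (rat_const (inverse (of_nat (Suc n)))) = (1 :: 'v ppoly)"
    using inverse_of_nat[of "Suc n"] by (simp add: mult.commute)
  then show "of_nat (Suc n) * fps_nth (Abs_fps (evolve d q (evolution_op k u))) (Suc n) =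
    (\<Sum>m\<in>{1..d}. if m \<le> Suc n then coeff_const (q m) * evolution_op k u m (fps_nth (Abs_fps (evolve d q (evolution_op k u))) (Suc n - m)) else 0)"
    unfolding fps_nth_Abs_fps evolve.simps mult.assoc[symmetric] by (simp only: mult_1_left)
qed simp

lemma evolution_unique:
  assumes "evolution k d u q \<tau>" "evolution k d u q \<tau>'"
  shows "\<tau> = \<tau>'"
proof (rule fps_ext)
  fix n
  show "fps_nth \<tau> n = fps_nth \<tau>' n"
  proof (induction n rule: less_induct)
    case (less n)
    show ?case
    proof (cases n)
      case 0
      then show ?thesis using assms by (simp add: evolution_nth)
    next
      case (Suc l)
      have "of_nat (Suc l) * fps_nth \<tau> (Suc l) = of_nat (Suc l) * fps_nth \<tau>' (Suc l)"
      proof -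
        have "(\<Sum>m\<in>{1..d}. if m \<le> Suc l then coeff_const (q m) * evolution_op k u m (fps_nth \<tau> (Suc l - m)) else 0) =
          (\<Sum>m\<in>{1..d}. if m \<le> Suc l then coeff_const (q m) * evolution_op k u m (fps_nth \<tau>' (Suc l - m)) else 0)"
          using less Suc by (intro sum.cong) auto
        moreover note assms[unfolded evolution_nth, THEN conjunct2, rule_format, of l]
        ultimately show ?thesis by (simp only:)
      qed
      then have "of_nat (Suc l) * (fps_nth \<tau> (Suc l) - fps_nth \<tau>' (Suc l)) = 0"
        by (simp only: right_diff_distrib diff_self)
      then show ?thesis using ppoly_torsion_free[of "Suc l"] Suc by fastforce
    qed
  qed
qed

text \<open>Three facts about the model enter: \<open>M_op k m u i\<close> has degree
  \<open>m - i\<close>, it kills 0, and a bracket vanishes at order \<open>n\<close> in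
  \<open>t\<close> once all constraints vanish below that order.\<close>

lemma tau_constraints:
  fixes k d :: nat and u q :: "nat \<Rightarrow> 'v coeff"
  assumes homM: "\<And>m i n F. m \<in> {1..d} \<Longrightarrow> 1 \<le> i \<Longrightarrow> hom_degree n F \<Longrightarrow> hom_degree (n + int m - int i) (M_op k m u i F)"
    and M0: "\<And>m i. m \<in> {1..d} \<Longrightarrow> 1 \<le> i \<Longrightarrow> M_op k m u i 0 = 0"
    and comm: "\<And>i j n Z. 1 \<le> i \<Longrightarrow> 1 \<le> j \<Longrightarrow> (\<And>l m. 1 \<le> l \<Longrightarrow> m < n \<Longrightarrow> fps_nth (L_op k d u q l Z) m = 0) \<Longrightarrow>
      fps_nth (commutator (L_op k d u q i) (L_op k d u q j) Z) n = 0"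
    and ev: "evolution k d u q \<tau>"
  shows "(\<forall>i\<ge>1. L_op k d u q i \<tau> = 0) \<and> (\<forall>Z. constraints k d u q Z \<longleftrightarrow> Z = \<tau>)"
proof -
  let ?rhs = "\<lambda>Z n. \<Sum>m\<in>{1..d}. if m \<le> n then coeff_const (q m) * evolution_op k u m (fps_nth Z (n - m)) else 0"
  have homH: "hom_degree (n + int m) (evolution_op k u m F)" if "m \<in> {1..d}" "hom_degree n F" for m n F
  proof -
    obtain R where "\<forall>i>R. M_op k m u i F = 0" using M_op_finite by blast
    then have "evolution_op k u m F = (\<Sum>i\<in>{1..R}. p_var i * M_op k m u i F)" by (intro evolution_op_eq) auto
    moreover have "hom_degree (n + int m - int i + int i) (p_var i * M_op k m u i F)" if "i \<in> {1..R}" for i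
      by (rule hom_p_var) (use that \<open>m \<in> {1..d}\<close> \<open>hom_degree n F\<close> homM in auto)
    ultimately show ?thesis by (auto intro!: hom_sum)
  qed
  have hom_tau: "hom_degree (int n) (fps_nth \<tau> n)" for n
  proof (induction n rule: less_induct)
    case (less n)
    show ?case
    proof (cases n)
      case 0
      have "hom_degree 0 (1 :: 'v ppoly)" by (auto simp: hom_degree_def lookup_one weight_def when_def)
      then show ?thesis using 0 ev by (simp add: evolution_nth)
    next
      case (Suc l)
      have "hom_degree (int (Suc l)) (?rhs \<tau> (Suc l))"
      proof (rule hom_sum)
        fix m assume m: "m \<in> {1..d}"
        show "hom_degree (int (Suc l)) (if m \<le> Suc l then coeff_const (q m) * evolution_op k u m (fps_nth \<tau> (Suc l - m)) else 0)"
        proof (cases "m \<le> Suc l")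
          case True
          have "hom_degree (int (Suc l - m) + int m) (evolution_op k u m (fps_nth \<tau> (Suc l - m)))"
            using m Suc by (intro homH less) auto
          then show ?thesis using True by (simp add: hom_coeff_const of_nat_diff)
        qed simp
      qed
      then have "hom_degree (int (Suc l)) (coeff_const (rat_const (inverse (of_nat (Suc l)))) * (of_nat (Suc l) * fps_nth \<tau> (Suc l)))"
        using ev[unfolded evolution_nth, THEN conjunct2, rule_format, of l] by (simp only: hom_coeff_const)
      then show ?thesis
        unfolding mult.assoc[symmetric] inverse_of_nat[OF zero_less_Suc] mult_1_left
        using Suc by (simp only:)
    qed
  qed
  \<comment> \<open>Multiplying by \<open>p_i\<close> and summing turns the \<open>p_i^*\<close>
    into the Euler operator, that is, into \<open>n\<close> at order \<open>n\<close>. So this sum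
    vanishes exactly when the evolution equation holds at that order; this is read in one direction
    for \<open>\<tau>\<close> and in the other for \<open>Z\<close>.\<close>
  have Euler: "\<exists>R. (\<forall>i>R. fps_nth (L_op k d u q (int i) Z) n = 0) \<and>
      (\<Sum>i\<in>{1..R}. p_var i * fps_nth (L_op k d u q (int i) Z) n) = - (of_nat n * fps_nth Z n) + ?rhs Z n"
    if Z: "hom_degree (int n) (fps_nth Z n)" for Z n
  proof -
    obtain R1 where R1: "\<forall>i>R1. p_deriv i (fps_nth Z n) = 0" using p_deriv_finite by blast
    obtain R2 where R2: "\<forall>m\<le>d. \<forall>i>R2. M_op k m u i (fps_nth Z (n - m)) = 0"
      using common_bound[of "\<lambda>m i. M_op k m u i (fps_nth Z (n - m)) = 0" d] M_op_finite by blast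
    define R where "R = max R1 R2"
    have "fps_nth (L_op k d u q (int i) Z) n = 0" if "i > R" for i
    proof -
      have "1 \<le> i" using that by simp
      then show ?thesis
        unfolding L_op_nth[OF \<open>1 \<le> i\<close>]
        using R1 R2 that by (auto simp: R_def intro!: sum.neutral)
    qed
    moreover have "(\<Sum>i\<in>{1..R}. p_var i * fps_nth (L_op k d u q (int i) Z) n) = - (of_nat n * fps_nth Z n) + ?rhs Z n"
    proof -
      have "(\<Sum>i\<in>{1..R}. p_var i * fps_nth (L_op k d u q (int i) Z) n) =
        (\<Sum>i\<in>{1..R}. - (p_var i * (of_nat i * p_deriv i (fps_nth Z n))) +
          (\<Sum>m\<in>{1..d}. if m \<le> n then coeff_const (q m) * (p_var i * M_op k m u i (fps_nth Z (n - m))) else 0))"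
      proof (intro sum.cong refl)
        fix i assume "i \<in> {1..R}"
        then have i: "1 \<le> i" by simp
        show "p_var i * fps_nth (L_op k d u q (int i) Z) n = - (p_var i * (of_nat i * p_deriv i (fps_nth Z n))) +
          (\<Sum>m\<in>{1..d}. if m \<le> n then coeff_const (q m) * (p_var i * M_op k m u i (fps_nth Z (n - m))) else 0)"
          unfolding L_op_nth[OF i] distrib_left sum_distrib_left mult_minus_right
          by (intro arg_cong2[where f = "(+)"] refl sum.cong) (auto simp: mult.left_commute)
      qed
      also have "\<dots> = - (\<Sum>i\<in>{1..R}. p_var i * (of_nat i * p_deriv i (fps_nth Z n))) +
        (\<Sum>m\<in>{1..d}. \<Sum>i\<in>{1..R}. if m \<le> n then coeff_const (q m) * (p_var i * M_op k m u i (fps_nth Z (n - m))) else 0)"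
        unfolding sum.distrib sum_negf by (subst (2) sum.swap) (rule refl)
      also have "(\<Sum>i\<in>{1..R}. p_var i * (of_nat i * p_deriv i (fps_nth Z n))) = of_nat n * fps_nth Z n"
        by (rule Euler_hom) (use R1 Z in \<open>auto simp: R_def\<close>)
      also have "(\<Sum>m\<in>{1..d}. \<Sum>i\<in>{1..R}. if m \<le> n then coeff_const (q m) * (p_var i * M_op k m u i (fps_nth Z (n - m))) else 0)
        = ?rhs Z n"
      proof (intro sum.cong refl)
        fix m assume m: "m \<in> {1..d}"
        have "evolution_op k u m (fps_nth Z (n - m)) = (\<Sum>i\<in>{1..R}. p_var i * M_op k m u i (fps_nth Z (n - m)))"
          by (rule evolution_op_eq) (use R2 m in \<open>auto simp: R_def\<close>)
        then show "(\<Sum>i\<in>{1..R}. if m \<le> n then coeff_const (q m) * (p_var i * M_op k m u i (fps_nth Z (n - m))) else 0) =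
          (if m \<le> n then coeff_const (q m) * evolution_op k u m (fps_nth Z (n - m)) else 0)"
          by (simp add: sum_distrib_left)
      qed
      finally show ?thesis .
    qed
    ultimately show ?thesis by (intro exI[of _ R]) simp
  qed
  have zero: "\<forall>j\<ge>1. fps_nth (L_op k d u q (int j) \<tau>) n = 0" for n
  proof (induction n rule: less_induct)
    case (less n)
    have low: "fps_nth (L_op k d u q l \<tau>) m = 0" if "1 \<le> l" "m < n" for l m
      using less[rule_format, of m "nat l"] that by simp
    let ?x = "\<lambda>i. fps_nth (L_op k d u q (int i) \<tau>) n"
    obtain R where R: "\<forall>i>R. ?x i = 0" "(\<Sum>i\<in>{1..R}. p_var i * ?x i) = - (of_nat n * fps_nth \<tau> n) + ?rhs \<tau> n"
      using Euler[OF hom_tau[of n]] by blast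
    have "- (of_nat n * fps_nth \<tau> n) + ?rhs \<tau> n = 0"
    proof (cases n)
      case 0
      then show ?thesis by (auto intro: sum.neutral)
    next
      case (Suc l)
      then show ?thesis
        using ev[unfolded evolution_nth, THEN conjunct2, rule_format, of l] by (simp only: Suc) simp
    qed
    then have sum: "(\<Sum>i\<in>{1..R}. p_var i * ?x i) = 0" using R(2) by simp
    \<comment> \<open>Every \<open>M\<close>-term carries \<open>t ^ m\<close> with
      \<open>m \<ge> 1\<close> and sees only coefficients of \<open>L j \<tau>\<close> of lower
      order, which are 0 by induction.\<close>
    have LL: "fps_nth (L_op k d u q (int i) (L_op k d u q (int j) \<tau>)) n = - (of_nat i * p_deriv i (?x j))"
      if "1 \<le> i" "1 \<le> j" for i j
    proof -
      have "(\<Sum>m\<in>{1..d}. if m \<le> n then coeff_const (q m) * M_op k m u i (fps_nth (L_op k d u q (int j) \<tau>) (n - m)) else 0) = 0"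
        using that low M0 by (intro sum.neutral) auto
      then show ?thesis unfolding L_op_nth[OF that(1)] by simp
    qed
    have sym: "of_nat j * p_deriv j (?x i) = of_nat i * p_deriv i (?x j)" if "1 \<le> i" "1 \<le> j" for i j
    proof -
      have "fps_nth (commutator (L_op k d u q (int i)) (L_op k d u q (int j)) \<tau>) n = 0"
        by (rule comm) (use that low in auto)
      then show ?thesis using that by (simp add: commutator_def LL)
    qed
    show ?case
    proof (intro allI impI)
      fix j :: nat assume "1 \<le> j"
      then show "?x j = 0"
        using integrable_family_0[of R ?x j] R(1) sum sym by blast
    qed
  qed
  have L0: "L_op k d u q i \<tau> = 0" if "1 \<le> i" for i
    by (rule fps_ext) (use zero[rule_format, of "nat i"] that in simp)
  moreover have "constraints k d u q \<tau>"
    unfolding constraints_def using ev hom_tau L0 by (auto simp: evolution_nth homogeneous_hom_degree)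
  moreover have "Z = \<tau>" if Z: "constraints k d u q Z" for Z
  proof (rule evolution_unique[OF _ ev])
    show "evolution k d u q Z" unfolding evolution_nth
    proof (intro conjI allI)
      show "fps_nth Z 0 = 1" using Z by (simp add: constraints_def)
    next
      fix n
      have "hom_degree (int (Suc n)) (fps_nth Z (Suc n))" using Z by (simp add: constraints_def homogeneous_hom_degree del: of_nat_Suc)
      from Euler[OF this] obtain R where
        "(\<Sum>i\<in>{1..R}. p_var i * fps_nth (L_op k d u q (int i) Z) (Suc n)) = - (of_nat (Suc n) * fps_nth Z (Suc n)) + ?rhs Z (Suc n)"
        by blast
      moreover have "(\<Sum>i\<in>{1..R}. p_var i * fps_nth (L_op k d u q (int i) Z) (Suc n)) = 0"
        using Z by (intro sum.neutral) (auto simp: constraints_def)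
      ultimately show "of_nat (Suc n) * fps_nth Z (Suc n) = ?rhs Z (Suc n)"
        by (simp only: eq_neg_iff_add_eq_0 neg_eq_iff_add_eq_0 add.commute) simp
    qed
  qed
  ultimately show ?thesis by blast
qed

section \<open>The operators \<open>M\<close>\<close>

definition y_coeff :: "'v yexpr \<Rightarrow> int \<Rightarrow> 'v ppoly" where
  "y_coeff G c = (if 0 \<le> c then lookup G (nat c) else 0)"

text \<open>The \<open>step\<close> of shift 0 outside the locale, with the value of the zero mode
  as a parameter.\<close>

definition Lambda_coeff :: "'v coeff \<Rightarrow> (int \<Rightarrow> 'v ppoly) \<Rightarrow> int \<Rightarrow> 'v ppoly" where
  "Lambda_coeff z g i = (if 0 \<le> i then Sum_any (\<lambda>c. current z (i - c) (g c)) + b_const * (of_int i * g i) else 0)"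

lemma fin_y_coeff: "fin_family (y_coeff G)"
proof -
  obtain n where n: "\<forall>c\<in>keys G. c \<le> n"
    using finite_nat_set_iff_bounded_le finite_keys by blast
  have "supported (int n) (y_coeff G)"
  proof (intro allI impI)
    fix c assume "c \<notin> {0..int n}"
    then have "c < 0 \<or> nat c \<notin> keys G" using n by force
    then show "y_coeff G c = 0" by (auto simp: y_coeff_def in_keys_iff)
  qed
  then show ?thesis by (rule fin_familyI')
qed

text \<open>The three sums of \<open>\<Lambda>_Y\<close> become the positive modes, the negative
  modes and the diagonal \<open>b\<close>-term. Each is cut to a finite index range outside of which
  its terms vanish on \<open>G\<close>.\<close>

lemma Lambda_Y_raising:
  assumes n': "\<forall>c>n. lookup G c = 0"
  shows "lookup (sum' (\<lambda>(i, j). ydy (i + j - 1) (j - 1) (\<lambda>F. (1 + b_const) * of_nat i * p_deriv i F) G)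
       ({1..} \<times> {1..})) a =
    (\<Sum>c\<le>n. if c < a then (1 + b_const) * of_nat (a - c) * p_deriv (a - c) (lookup G c) else 0)"
proof -
  note n = n'[rule_format]
  let ?X = "\<lambda>i c. (1 + b_const) * of_nat i * p_deriv i (lookup G c)"
  obtain R0 where R0: "\<forall>c\<le>n. \<forall>i>R0. p_deriv i (lookup G c) = 0"
    using common_bound[of "\<lambda>c i. p_deriv i (lookup G c) = 0" n] p_deriv_finite by blast
  define R where "R = max R0 a"
  have R: "p_deriv i (lookup G c) = 0" if "i > R" for i c
    using R0 n[of c] that by (cases "c \<le> n") (auto simp: R_def)
  have eq: "sum' (\<lambda>(i, j). ydy (i + j - 1) (j - 1) (\<lambda>F. (1 + b_const) * of_nat i * p_deriv i F) G) ({1..} \<times> {1..}) =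
    (\<Sum>(i, j)\<in>{1..R} \<times> {1..Suc n}. Poly_Mapping.single (i + j - 1) (?X i (j - 1)))"
    unfolding ydy_def
  proof (rule sum'_eq_sum)
    fix x :: "nat \<times> nat" assume x: "x \<in> {1..} \<times> {1..} - {1..R} \<times> {1..Suc n}"
    obtain i j where ij: "x = (i, j)" by (cases x)
    have "i > R \<or> j - 1 > n" using x ij by auto
    then have "p_deriv i (lookup G (j - 1)) = 0" using R[of i "j - 1"] n[of "j - 1"] by auto
    then show "(case x of (i, j) \<Rightarrow> Poly_Mapping.single (i + j - 1) (?X i (j - 1))) = 0" using ij by simp
  qed auto
  have "lookup (sum' (\<lambda>(i, j). ydy (i + j - 1) (j - 1) (\<lambda>F. (1 + b_const) * of_nat i * p_deriv i F) G)
       ({1..} \<times> {1..})) a = (\<Sum>(i, j)\<in>{1..R} \<times> {1..Suc n}. if i + j - 1 = a then ?X i (j - 1) else 0)"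
    unfolding eq lookup_sum by (intro sum.cong) (auto simp: lookup_single when_def)
  also have "\<dots> = (\<Sum>j\<in>{1..Suc n}. \<Sum>i\<in>{1..R}. if i + j - 1 = a then ?X i (j - 1) else 0)"
    by (rule trans[OF sum.cartesian_product[symmetric] sum.swap])
  also have "\<dots> = (\<Sum>j\<in>{1..Suc n}. if j - 1 < a then ?X (a - (j - 1)) (j - 1) else 0)"
  proof (intro sum.cong refl)
    fix j assume j: "j \<in> {1..Suc n}"
    have "(\<Sum>i\<in>{1..R}. if i + j - 1 = a then ?X i (j - 1) else 0) =
      (\<Sum>i\<in>{1..R}. if i = a - (j - 1) then ?X (a - (j - 1)) (j - 1) else 0)"
      using j by (intro sum.cong) auto
    also have "\<dots> = (if j - 1 < a then ?X (a - (j - 1)) (j - 1) else 0)"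
      by (auto simp: R_def)
    finally show "(\<Sum>i\<in>{1..R}. if i + j - 1 = a then ?X i (j - 1) else 0) = (if j - 1 < a then ?X (a - (j - 1)) (j - 1) else 0)" .
  qed
  also have "\<dots> = (\<Sum>c\<le>n. if c < a then ?X (a - c) c else 0)"
    by (rule sum.reindex_bij_witness[of _ Suc "\<lambda>j. j - 1"]) auto
  finally show ?thesis .
qed

lemma Lambda_Y_lowering:
  assumes n': "\<forall>c>n. lookup G c = 0"
  shows "lookup (sum' (\<lambda>(i, j). ydy (j - 1) (i + j - 1) (\<lambda>F. p_var i * F) G) ({1..} \<times> {1..})) a =
    (\<Sum>c\<le>n. if a < c then p_var (c - a) * lookup G c else 0)"
proof -
  note n = n'[rule_format]
  have eq: "sum' (\<lambda>(i, j). ydy (j - 1) (i + j - 1) (\<lambda>F. p_var i * F) G) ({1..} \<times> {1..}) =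
    (\<Sum>(i, j)\<in>{1..Suc n} \<times> {1..Suc (n + a)}. Poly_Mapping.single (j - 1) (p_var i * lookup G (i + j - 1)))"
    unfolding ydy_def
  proof (rule sum'_eq_sum)
    fix x :: "nat \<times> nat" assume x: "x \<in> {1..} \<times> {1..} - {1..Suc n} \<times> {1..Suc (n + a)}"
    obtain i j where ij: "x = (i, j)" by (cases x)
    have "i + j - 1 > n" using x ij by auto
    then have "lookup G (i + j - 1) = 0" by (rule n)
    then show "(case x of (i, j) \<Rightarrow> Poly_Mapping.single (j - 1) (p_var i * lookup G (i + j - 1))) = 0"
      using ij by simp
  qed auto
  have "lookup (sum' (\<lambda>(i, j). ydy (j - 1) (i + j - 1) (\<lambda>F. p_var i * F) G) ({1..} \<times> {1..})) a
    = (\<Sum>(i, j)\<in>{1..Suc n} \<times> {1..Suc (n + a)}. if j = Suc a then p_var i * lookup G (i + a) else 0)"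
    unfolding eq lookup_sum by (intro sum.cong) (auto simp: lookup_single when_def)
  also have "\<dots> = (\<Sum>i\<in>{1..Suc n}. \<Sum>j\<in>{1..Suc (n + a)}. if j = Suc a then p_var i * lookup G (i + a) else 0)"
    by (rule sum.cartesian_product[symmetric])
  also have "\<dots> = (\<Sum>i\<in>{1..Suc n}. p_var i * lookup G (i + a))"
    by (intro sum.cong) auto
  also have "\<dots> = (\<Sum>c\<le>n. if a < c then p_var (c - a) * lookup G c else 0)"
    \<comment> \<open>\<open>S'\<close> and \<open>T'\<close> are the indices without a partner on
      the other side; on \<open>S'\<close> the coefficient of \<open>G\<close> is 0, on
      \<open>T'\<close> the conditional is.\<close>
    by (rule sum.reindex_bij_witness_not_neutral[where i = "\<lambda>c. c - a" and j = "\<lambda>i. i + a"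
          and S' = "{i \<in> {1..Suc n}. n < i + a}" and T' = "{c. c \<le> a}"])
       (use n in auto)
  finally show ?thesis .
qed

lemma Lambda_Y_diagonal:
  assumes n': "\<forall>c>n. lookup G c = 0"
  shows "lookup (sum' (\<lambda>i. ydy i i (\<lambda>F. b_const * of_nat i * F) G) {1..}) a =
    b_const * of_nat a * lookup G a"
proof -
  note n = n'[rule_format]
  have eq: "sum' (\<lambda>i. ydy i i (\<lambda>F. b_const * of_nat i * F) G) {1..} =
    (\<Sum>i\<in>{1..max n a}. Poly_Mapping.single i (b_const * of_nat i * lookup G i))"
    unfolding ydy_def
    by (rule sum'_eq_sum) (use n in \<open>auto simp: not_le Suc_le_eq\<close>)
  have "lookup (sum' (\<lambda>i. ydy i i (\<lambda>F. b_const * of_nat i * F) G) {1..}) a = (\<Sum>i\<in>{1..max n a}. if i = a then b_const * of_nat a * lookup G a else 0)"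
    unfolding eq lookup_sum by (intro sum.cong) (auto simp: lookup_single when_def)
  also have "\<dots> = b_const * of_nat a * lookup G a" by (cases "a = 0") auto
  finally show ?thesis .
qed

lemma y_coeff_Lambda_Y: "y_coeff (Lambda_Y G) i = Lambda_coeff 0 (y_coeff G) i"
proof (cases "0 \<le> i")
  case True
  obtain n where n: "\<And>c. c > n \<Longrightarrow> lookup G c = 0"
    using finite_nat_set_iff_bounded_le[of "keys G"] by (metis finite_keys in_keys_iff not_le)
  have n': "\<forall>c>n. lookup G c = 0" using n by blast
  define a where "a = nat i"
  have i: "i = int a" using True by (simp add: a_def)
  have "y_coeff (Lambda_Y G) i =
    (\<Sum>c\<le>n. (if c < a then (1 + b_const) * of_nat (a - c) * p_deriv (a - c) (lookup G c) else 0)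
      + (if a < c then p_var (c - a) * lookup G c else 0)) + b_const * of_nat a * lookup G a"
    unfolding y_coeff_def Lambda_Y_def lookup_add Lambda_Y_raising[OF n'] Lambda_Y_lowering[OF n']
      Lambda_Y_diagonal[OF n'] sum.distrib unfolding i nat_int by simp
  also have "(\<Sum>c\<le>n. (if c < a then (1 + b_const) * of_nat (a - c) * p_deriv (a - c) (lookup G c) else 0)
      + (if a < c then p_var (c - a) * lookup G c else 0)) =
      (\<Sum>c\<in>{0..int n}. current 0 (i - c) (y_coeff G c))"
  proof (rule sum.reindex_bij_witness[of _ nat int])
    fix c assume "c \<in> {..n}"
    have "nat (int a - int c) = a - c" by simp
    moreover have "nat (int c - int a) = c - a" by simp
    ultimately show "current 0 (i - int c) (y_coeff G (int c)) = (if c < a then (1 + b_const) * of_nat (a - c) * p_deriv (a - c) (lookup G c) else 0)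
      + (if a < c then p_var (c - a) * lookup G c else 0)"
      unfolding i by (auto simp: current_def y_coeff_def mult.assoc)
  qed auto
  also have "\<dots> = Sum_any (\<lambda>c. current 0 (i - c) (y_coeff G c))"
  proof (rule Sum_any.expand_superset[symmetric])
    have "y_coeff G c = 0" if "c \<notin> {0..int n}" for c
      using that n[of "nat c"] by (auto simp: y_coeff_def)
    then show "{c. current 0 (i - c) (y_coeff G c) \<noteq> 0} \<subseteq> {0..int n}" by (metis (mono_tags, lifting) current_0 mem_Collect_eq subsetI)
  qed simp
  finally show ?thesis by (simp add: Lambda_coeff_def y_coeff_def i mult.assoc)
qed (simp add: y_coeff_def Lambda_coeff_def)

lemma y_coeff_Lambda_Y_shift: "y_coeff (Lambda_Y_shift u G) i = Lambda_coeff 0 (y_coeff G) i + coeff_const u * y_coeff G i"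
proof -
  have "lookup (Poly_Mapping.map (\<lambda>F. coeff_const u * F) G) a = coeff_const u * lookup G a" for a
    by (simp add: Poly_Mapping.map.rep_eq when_def)
  then have "y_coeff (Lambda_Y_shift u G) i = y_coeff (Lambda_Y G) i + coeff_const u * y_coeff G i"
    by (simp add: Lambda_Y_shift_def y_coeff_def lookup_add)
  then show ?thesis by (simp add: y_coeff_Lambda_Y)
qed

text \<open>Only the summand \<open>c = i\<close> meets the zero mode, so adding \<open>u\<close> to
  \<open>\<Lambda>_Y\<close> amounts to giving that mode the value \<open>u\<close>.\<close>

lemma Lambda_coeff_shift:
  assumes "fin_family g"
  shows "Lambda_coeff z g i = Lambda_coeff 0 g i + coeff_const z * g i"
proof (cases "0 \<le> i")
  case True
  obtain C where C: "i \<le> C" "supported C g" by (rule fin_familyE[OF assms, where ?B0.0 = i])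
  have *: "Sum_any (\<lambda>c. current x (i - c) (g c)) = (\<Sum>c\<in>{0..C}. current x (i - c) (g c))" for x
    by (rule Sum_any.expand_superset) (use C in force)+
  have "(\<Sum>c\<in>{0..C}. current z (i - c) (g c)) = (\<Sum>c\<in>{0..C}. current 0 (i - c) (g c)) + (\<Sum>c\<in>{0..C}. if c = i then coeff_const z * g i else 0)"
    unfolding sum.distrib[symmetric] by (intro sum.cong) (auto simp: current_def)
  then show ?thesis using True C by (simp add: Lambda_coeff_def *)
next
  case False
  then have "g i = 0" using assms by (simp add: fin_family_neg)
  then show ?thesis using False by (simp add: Lambda_coeff_def)
qed

lemma y_coeff_Y_plus: "y_coeff (Y_plus G) c = y_coeff G (c - 1)"
proof (cases "1 \<le> c")
  case True
  obtain n where n: "\<And>c. c > n \<Longrightarrow> lookup G c = 0"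
    using finite_nat_set_iff_bounded_le[of "keys G"] by (metis finite_keys in_keys_iff not_le)
  define a where "a = nat c"
  have "Y_plus G = (\<Sum>j\<in>{1..max a (Suc n)}. Poly_Mapping.single j (lookup G (j - 1)))"
    unfolding Y_plus_def ydy_def
    by (rule sum'_eq_sum) (use n in \<open>auto simp: not_le Suc_le_eq\<close>)
  then have "lookup (Y_plus G) a = (\<Sum>j\<in>{1..max a (Suc n)}. if j = a then lookup G (a - 1) else 0)"
    unfolding \<open>Y_plus G = _\<close> lookup_sum by (intro sum.cong) (auto simp: lookup_single when_def)
  also have "\<dots> = lookup G (a - 1)" using True by (auto simp: a_def)
  also have "a - 1 = nat (c - 1)" using True by (simp add: a_def nat_diff_distrib)
  finally show ?thesis using True by (simp add: y_coeff_def a_def)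
next
  case False
  have "lookup (Y_plus G) 0 = 0"
  proof -
    obtain n where n: "\<And>c. c > n \<Longrightarrow> lookup G c = 0"
      using finite_nat_set_iff_bounded_le[of "keys G"] by (metis finite_keys in_keys_iff not_le)
    have "Y_plus G = (\<Sum>j\<in>{1..Suc n}. Poly_Mapping.single j (lookup G (j - 1)))"
      unfolding Y_plus_def ydy_def
      by (rule sum'_eq_sum) (use n in \<open>auto simp: not_le Suc_le_eq\<close>)
    then show ?thesis unfolding \<open>Y_plus G = _\<close> lookup_sum
      by (intro sum.neutral) (auto simp: lookup_single when_def)
  qed
  then show ?thesis using False by (auto simp: y_coeff_def)
qed

lemma y_coeff_single: "y_coeff (Poly_Mapping.single 0 F) c = (if c = 0 then F else 0)"
  by (auto simp: y_coeff_def lookup_single when_def)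

lemma Sum_any_shift: "Sum_any (\<lambda>x::int. g (x + k)) = Sum_any g"
proof (rule Sum_any.reindex_cong[symmetric, where l = "\<lambda>x. x + k"])
  show "bij (\<lambda>x. x + k)"
    by (rule bij_betw_byWitness[where f' = "\<lambda>x. x - k"]) auto
qed (auto simp: fun_eq_iff)

section \<open>From \<open>M_op\<close> to the iterates\<close>

context model
begin

lemma step_eq_Lambda_coeff: "step w = Lambda_coeff z (\<lambda>c. w (c - e))"
proof
  fix i
  have "Sum_any (\<lambda>c. current z (i - c) (w (c - e))) = Sum_any (\<lambda>c. current z (i - (c + e)) (w (c + e - e)))"
    by (rule Sum_any_shift[symmetric])
  also have "\<dots> = Sum_any (\<lambda>c. current z (i - e - c) (w c))" by (simp add: algebra_simps)
  finally show "step w i = Lambda_coeff z (\<lambda>c. w (c - e)) i" by (simp add: step_def Lambda_coeff_def)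
qed

lemma step_v:
  "1 \<le> l \<Longrightarrow> l \<le> 2 \<Longrightarrow> step (v l F) = v (Suc l) F"
proof -
  assume "1 \<le> l" "l \<le> 2"
  then have "l = 1 \<or> l = 2" by auto
  then show ?thesis
    by (auto simp: v_def[abs_def] v2_def v3_def)
qed

lemma step_v0: "e = 0 \<Longrightarrow> step (v 0 F) i = v 1 F i"
proof -
  assume e: "e = 0"
  have 0: "v 0 F c = (if c = 0 then F else 0)" for c by (simp add: v_def)
  have 1: "v 1 F i = (if 0 \<le> i then current z i F else 0)" by (simp add: v_def v1_def)
  have step: "step (v 0 F) i = (if 0 \<le> i then current z (i - e) F + b_const * (of_int i * (if i = e then F else 0)) else 0)"
    by (subst step_eq[of "{0}"]) (simp_all add: 0)
  show ?thesis unfolding step 1 using e by auto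
qed

lemma v_b_unit: "v l (b_unit * F) c = b_unit * v l F c"
  using const_linear_v[of l c] unfolding const_linear_def b_unit_def by blast

lemma hom_step:
  assumes "\<And>c. hom_degree (n - c) (w c)"
  shows "hom_degree (n - c + e) (step w c)"
proof -
  have "hom_degree (n - c + e) (Sum_any (\<lambda>a. current z (c - e - a) (w a)))"
    unfolding Sum_any.expand_set
  proof (rule hom_sum)
    fix a
    have "hom_degree (n - a - (c - e - a)) (current z (c - e - a) (w a))" by (rule hom_current) (rule assms)
    then show "hom_degree (n - c + e) (current z (c - e - a) (w a))" by (simp add: algebra_simps)
  qed
  moreover have "hom_degree (n - c + e) (b_const * (of_int c * w (c - e)))"
    using assms[of "c - e"] by (intro hom_coeff_const hom_of_int) (simp add: algebra_simps)
  ultimately show ?thesis unfolding step_def by (auto intro: hom_add)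
qed

lemma hom_v:
  assumes "hom_degree n F" "l \<le> 3"
  shows "hom_degree (n - c + (if l = 0 then 0 else (int l - 1) * e)) (v l F c)"
proof -
  have 1: "hom_degree (n - c) (v1 F c)" for c
    using assms(1) by (auto simp: v1_def intro: hom_current)
  have 2: "hom_degree (n + e - c) (v2 F c)" for c
    using hom_step[of n "v1 F" c] 1 by (simp add: v2_def algebra_simps)
  have 3: "hom_degree (n + e - c + e) (v3 F c)" for c
    using hom_step[of "n + e" "v2 F" c] 2 by (simp add: v3_def)
  consider "l = 0" | "l = 1" | "l = 2" | "l = 3" using assms(2) by linarith
  then show ?thesis
  proof cases
    case 1
    then show ?thesis using assms(1) by (simp add: v_def)
  next
    case 2
    then show ?thesis using 1[of c] by (simp add: v_def)
  next
    case 3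
    then show ?thesis using 2[of c] by (simp add: v_def algebra_simps)
  next
    case 4
    then show ?thesis using 3[of c] by (simp add: v_def algebra_simps)
  qed
qed

text \<open>\<open>h m l\<close> is the coefficient of the \<open>l\<close>-th iterate in
  \<open>M_op k m u\<close>. The condition on \<open>h\<close> states that each iterate that occurs
  has degree \<open>m - i\<close>, because \<open>v l F (i - 1)\<close> changes the degree by
  \<open>1 - i + (l - 1) * e\<close> for \<open>l \<ge> 1\<close>.\<close>

lemma model_theorem:
  fixes k d :: nat and u q :: "nat \<Rightarrow> 'v coeff" and h :: "nat \<Rightarrow> nat \<Rightarrow> 'v coeff"
  assumes LL: "L_op k d u q = L"
    and M: "\<And>m i F. m \<in> {1..d} \<Longrightarrow> 1 \<le> i \<Longrightarrow>
      M_op k m u i F = b_unit * (\<Sum>l\<le>3. coeff_const (h m l) * v l F (int i - 1))"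
    and h: "\<And>m l. l \<le> 3 \<Longrightarrow> m \<in> {1..d} \<Longrightarrow> h m l \<noteq> 0 \<Longrightarrow> int m = 1 + (if l = 0 then 0 else (int l - 1) * e)"
  shows "(\<exists>M. \<forall>i\<ge>1. M i \<in> t_polynomials weyl_inf \<and>
        (\<forall>Z. - L i Z = of_int i * coeffwise (p_deriv (nat i)) Z - fps_X ^ 1 * M i Z)) \<and>
     (\<exists>!\<tau>. evolution k d u q \<tau>) \<and>
     (\<forall>\<tau>. evolution k d u q \<tau> \<longrightarrow>
        (\<forall>i\<ge>1. L i \<tau> = 0) \<and> (\<forall>Z. constraints k d u q Z \<longleftrightarrow> Z = \<tau>)) \<and>
     (\<exists>bracket_coeff. \<forall>i\<ge>1. \<forall>j\<ge>1.
        (\<forall>l\<ge>1. bracket_coeff i j l \<in> t_polynomials weyl) \<and>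
        (\<forall>Z. (\<forall>n. finite {l. l \<ge> 1 \<and> fps_nth (bracket_coeff i j l (L l Z)) n \<noteq> 0}) \<and>
           commutator (L i) (L j) Z = fps_X * fps_sum (\<lambda>l. bracket_coeff i j l (L l Z)) {1..}))"
proof (intro conjI)
  have wM: "weyl_limit (\<lambda>F. coeff_const c * M_op k m u i F)" if "m \<in> {1..d}" "1 \<le> i" for m i c
  proof -
    have "weyl_limit (\<lambda>F. \<Sum>l\<in>S. coeff_const (h m l) * v l F (int i - 1))" for S :: "nat set"
    proof (induction S rule: infinite_finite_induct)
      case (insert l S)
      then have "weyl_limit (\<lambda>F. coeff_const (h m l) * v l F (int i - 1) + (\<Sum>l\<in>S. coeff_const (h m l) * v l F (int i - 1)))"
        by (intro weyl_limit_add weyl_limit_scale weyl_limit_v)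
      with insert show ?case by simp
    qed (simp_all add: weyl_limit_weyl weyl_0)
    then show ?thesis unfolding M[OF that] by (intro weyl_limit_scale)
  qed
  let ?M = "\<lambda>i Z. \<Sum>m\<in>{1..d}. coeff_fps (q m) * fps_X ^ (m - 1) * coeffwise (M_op k m u (nat i)) Z"
  have "?M i \<in> t_polynomials weyl_inf \<and>
        (\<forall>Z. - L i Z = of_int i * coeffwise (p_deriv (nat i)) Z - fps_X ^ 1 * ?M i Z)" if i: "i \<ge> 1" for i :: int
  proof (intro conjI allI)
    let ?A = "\<lambda>m F. if m < d then coeff_const (q (Suc m)) * M_op k (Suc m) u (nat i) F else 0"
    have "?A m \<in> weyl_inf" for m
    proof (cases "m < d")
      case True
      then have "weyl_limit (?A m)" using wM[of "Suc m" "nat i" "q (Suc m)"] i by simp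
      then show ?thesis by (rule weyl_limit_inf)
    next
      case False
      then show ?thesis using weyl_limit_inf[OF weyl_limit_weyl[OF weyl_0]] by simp
    qed
    moreover have "?M i Z = (\<Sum>m\<le>d. fps_X ^ m * coeffwise (?A m) Z)" for Z
    proof -
      have "?M i Z = (\<Sum>m<d. coeff_fps (q (Suc m)) * fps_X ^ m * coeffwise (M_op k (Suc m) u (nat i)) Z)"
        by (rule sum.reindex_bij_witness[of _ Suc "\<lambda>m. m - 1"]) auto
      also have "\<dots> = (\<Sum>m\<le>d. fps_X ^ m * coeffwise (?A m) Z)"
      proof (rule sum.mono_neutral_cong_left)
        show "\<forall>m\<in>{..d} - {..<d}. fps_X ^ m * coeffwise (?A m) Z = 0"
          by (intro ballI fps_ext) (auto simp: fps_X_power_mult_nth)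
      next
        fix m assume "m \<in> {..<d}"
        then show "coeff_fps (q (Suc m)) * fps_X ^ m * coeffwise (M_op k (Suc m) u (nat i)) Z = fps_X ^ m * coeffwise (?A m) Z"
          by (intro fps_ext) (auto simp: t_monomial_nth fps_X_power_mult_nth)
      qed auto
      finally show ?thesis .
    qed
    ultimately show "?M i \<in> t_polynomials weyl_inf" unfolding t_polynomials_def
      by (intro CollectI exI[of _ d] exI[of _ ?A] conjI allI impI)
    fix Z
    have "fps_X ^ 1 * ?M i Z = (\<Sum>m\<in>{1..d}. coeff_fps (q m) * fps_X ^ m * coeffwise (M_op k m u (nat i)) Z)"
      unfolding sum_distrib_left
    proof (intro sum.cong refl)
      fix m assume "m \<in> {1..d}"
      then obtain m' where "m = Suc m'" by (cases m) auto
      then show "fps_X ^ 1 * (coeff_fps (q m) * fps_X ^ (m - 1) * coeffwise (M_op k m u (nat i)) Z) =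
        coeff_fps (q m) * fps_X ^ m * coeffwise (M_op k m u (nat i)) Z" by (simp add: mult.assoc mult.left_commute)
    qed
    moreover have "L i Z = - p_star i Z + (\<Sum>m\<in>{1..d}. coeff_fps (q m) * fps_X ^ m * coeffwise (M_op k m u (nat i)) Z)"
      unfolding LL[symmetric] using i by (simp add: L_op_def)
    ultimately show "- L i Z = of_int i * coeffwise (p_deriv (nat i)) Z - fps_X ^ 1 * ?M i Z"
      using i by (simp add: p_star_def)
  qed
  then show "\<exists>M. \<forall>i\<ge>1. M i \<in> t_polynomials weyl_inf \<and>
        (\<forall>Z. - L i Z = of_int i * coeffwise (p_deriv (nat i)) Z - fps_X ^ 1 * M i Z)"
    by (intro exI[of _ ?M]) blast
  show "\<exists>!\<tau>. evolution k d u q \<tau>"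
    using evolution_exists evolution_unique by blast
  show "\<exists>bracket_coeff. \<forall>i\<ge>1. \<forall>j\<ge>1.
        (\<forall>l\<ge>1. bracket_coeff i j l \<in> t_polynomials weyl) \<and>
        (\<forall>Z. (\<forall>n. finite {l. l \<ge> 1 \<and> fps_nth (bracket_coeff i j l (L l Z)) n \<noteq> 0}) \<and>
           commutator (L i) (L j) Z = fps_X * fps_sum (\<lambda>l. bracket_coeff i j l (L l Z)) {1..})"
    by (rule exI[of _ bracket_coeff]) (use bracket_coeff_t_polynomial bracket_coeff_finite L_commutator_bracket_coeff in auto)
  have M0: "M_op k m u i 0 = 0" if "m \<in> {1..d}" "1 \<le> i" for m i
    unfolding M[OF that] using const_linear_0[OF const_linear_v] by simp
  have homM: "hom_degree (n + int m - int i) (M_op k m u i F)" if "m \<in> {1..d}" "1 \<le> i" "hom_degree n F" for m i n F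
    unfolding M[OF that(1,2)] b_unit_def
  proof (rule hom_coeff_const, rule hom_sum)
    fix l :: nat assume l: "l \<in> {..3}"
    show "hom_degree (n + int m - int i) (coeff_const (h m l) * v l F (int i - 1))"
    proof (cases "h m l = 0")
      case False
      have "hom_degree (n - (int i - 1) + (if l = 0 then 0 else (int l - 1) * e)) (v l F (int i - 1))"
        by (rule hom_v) (use that l in auto)
      moreover have "n - (int i - 1) + (if l = 0 then 0 else (int l - 1) * e) = n + int m - int i"
        using h[of l m] l that False by simp
      ultimately show ?thesis by (intro hom_coeff_const) (simp only:)
    qed simp
  qed
  \<comment> \<open>The factor \<open>t\<close> in the bracket formula makes order \<open>n\<close>
    depend only on orders below \<open>n\<close> of the constraints.\<close>
  have comm: "fps_nth (commutator (L_op k d u q i) (L_op k d u q j) Z) n = 0"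
    if ij: "1 \<le> i" "1 \<le> j" and low: "\<And>l m. 1 \<le> l \<Longrightarrow> m < n \<Longrightarrow> fps_nth (L_op k d u q l Z) m = 0" for i j n Z
  proof (cases n)
    case 0
    then show ?thesis unfolding LL L_commutator_bracket_coeff[OF ij] by simp
  next
    case (Suc p)
    have "fps_nth (bracket_coeff i j l (L l Z)) p = 0" if "1 \<le> l" for l
      using low[OF that] Suc by (auto simp: bracket_coeff_nth LL)
    then have "fps_nth (fps_sum (\<lambda>l. bracket_coeff i j l (L l Z)) {1..}) p = 0"
      unfolding fps_sum_def fps_nth_Abs_fps by (subst sum'_eq_sum[of "{}"]) auto
    then show ?thesis unfolding LL L_commutator_bracket_coeff[OF ij] using Suc by simp
  qed
  show "\<forall>\<tau>. evolution k d u q \<tau> \<longrightarrow>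
        (\<forall>i\<ge>1. L i \<tau> = 0) \<and> (\<forall>Z. constraints k d u q Z \<longleftrightarrow> Z = \<tau>)"
    unfolding LL[symmetric]
    by (intro allI impI tau_constraints) (use homM M0 comm in auto)
qed

lemma L_op_eq_L:
  fixes h :: "nat \<Rightarrow> nat \<Rightarrow> 'v coeff"
  assumes M: "\<And>m i F. m \<in> {1..d} \<Longrightarrow> 1 \<le> i \<Longrightarrow>
      M_op k m u i F = b_unit * (\<Sum>l\<le>3. coeff_const (h m l) * v l F (int i - 1))"
    and h: "\<And>l. l \<le> 3 \<Longrightarrow> \<gamma> l = (\<Sum>m\<in>{1..d}. coeff_fps (q m * h m l) * fps_X ^ m)"
  shows "L_op k d u q = L"
proof (intro ext)
  fix i and Z :: "'v ppoly fps"
  show "L_op k d u q i Z = L i Z"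
  proof (cases "1 \<le> i")
    case True
    have "(\<Sum>m=1..d. coeff_fps (q m) * fps_X ^ m * coeffwise (M_op k m u (nat i)) Z) =
      (\<Sum>m=1..d. \<Sum>l\<le>3. coeff_fps (q m * h m l) * fps_X ^ m * coeffwise (\<lambda>F. b_unit * v l F (i - 1)) Z)"
    proof (intro sum.cong refl fps_ext)
      fix m n assume m: "m \<in> {1..d}"
      have "int (nat i) - 1 = i - 1" using True by simp
      then have "M_op k m u (nat i) F = (\<Sum>l\<le>3. coeff_const (h m l) * (b_unit * v l F (i - 1)))" for F
        using M[OF m, of "nat i"] True by (simp add: sum_distrib_left mult.left_commute)
      then show "fps_nth (coeff_fps (q m) * fps_X ^ m * coeffwise (M_op k m u (nat i)) Z) n =
        fps_nth (\<Sum>l\<le>3. coeff_fps (q m * h m l) * fps_X ^ m * coeffwise (\<lambda>F. b_unit * v l F (i - 1)) Z) n"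
        unfolding fps_sum_nth t_monomial_nth by (simp add: sum_distrib_left coeff_const_mult mult.assoc)
    qed
    also have "\<dots> = (\<Sum>l\<le>3. \<gamma> l * coeffwise (\<lambda>F. b_unit * v l F (i - 1)) Z)"
      by (subst sum.swap) (simp add: h sum_distrib_right)
    finally show ?thesis using True by (simp add: L_op_def L_def)
  qed (simp add: L_op_def L_def)
qed

lemma bracket:
  assumes ij: "1 \<le> i" "1 \<le> j"
  shows "commutator (L i) (L j) Z = \<gamma> 3 *
    (2 * of_int (i - j) * fps_sum (\<lambda>n. p_mult n (L (i + j + n - 1 - 2 * e) Z)) {1..}
    + b_fps * of_int (i - j) * of_int (i + j - 2 - e) * L (i + j - 1 - 2 * e) Z
    + of_int (structure_coeff (i - 1) (j - 1) 0) * coeff_fps z * L (i + j - 1 - 2 * e) Z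
    + S_fps * (3 * of_int (i - j) * (\<Sum>n\<in>{1..min i j - 1 - e}. p_star n (L (i + j - 1 - 2 * e - n) Z))
      + of_int (sgn (i - j)) * (\<Sum>n\<in>{min i j - e..max i j - 1 - e}.
        of_int (2 * max i j - 2 * n - min i j - 1 - 2 * e) * p_star n (L (i + j - 1 - 2 * e - n) Z))))
    + \<gamma> 2 * (of_int (i - j) * L (i + j - 1 - e) Z)"
proof -
  have N: "base_index i j + 1 = i + j - 1 - 2 * e" by (simp add: base_index_def)
  have N': "i + j - 1 - 2 * e + n = i + j + n - 1 - 2 * e" for n by simp
  show ?thesis
    unfolding L_commutator[OF ij]
  proof (subst structure_fps_formula[OF ij, of "max i j - 1"])
    show "0 \<le> max i j - 1" using ij by simp
    show "structure_coeff (i - 1) (j - 1) m = 0" if "max i j - 1 < m" for m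
      using that e01 ij by (auto simp: structure_coeff_def)
    have "(\<Sum>m\<in>{1..max i j - 1}. of_int (structure_coeff (i - 1) (j - 1) m) * p_star m (L (i + j - 1 - 2 * e - m) Z)) =
      3 * of_int (i - j) * (\<Sum>n\<in>{1..min i j - 1 - e}. p_star n (L (i + j - 1 - 2 * e - n) Z))
      + of_int (sgn (i - j)) * (\<Sum>n\<in>{min i j - e..max i j - 1 - e}.
        of_int (2 * max i j - 2 * n - min i j - 1 - 2 * e) * p_star n (L (i + j - 1 - 2 * e - n) Z))"
      by (rule structure_coeff_sum[OF ij]) (simp add: p_star_def)
    then show "\<gamma> 3 *
      (2 * of_int (i - j) * fps_sum (\<lambda>n. p_mult n (L (base_index i j + 1 + n) Z)) {1..}
      + b_fps * of_int (i - j) * of_int (i + j - 2 - e) * L (base_index i j + 1) Z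
      + of_int (structure_coeff (i - 1) (j - 1) 0) * coeff_fps z * L (base_index i j + 1) Z
      + S_fps * (\<Sum>m = 1..max i j - 1. of_int (structure_coeff (i - 1) (j - 1) m) * p_star m (L (base_index i j + 1 - m) Z)))
      + \<gamma> 2 * (of_int (i - j) * L (i + j - 1 - e) Z) = \<gamma> 3 *
    (2 * of_int (i - j) * fps_sum (\<lambda>n. p_mult n (L (i + j + n - 1 - 2 * e) Z)) {1..}
    + b_fps * of_int (i - j) * of_int (i + j - 2 - e) * L (i + j - 1 - 2 * e) Z
    + of_int (structure_coeff (i - 1) (j - 1) 0) * coeff_fps z * L (i + j - 1 - 2 * e) Z
    + S_fps * (3 * of_int (i - j) * (\<Sum>n\<in>{1..min i j - 1 - e}. p_star n (L (i + j - 1 - 2 * e - n) Z))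
      + of_int (sgn (i - j)) * (\<Sum>n\<in>{min i j - e..max i j - 1 - e}.
        of_int (2 * max i j - 2 * n - min i j - 1 - 2 * e) * p_star n (L (i + j - 1 - 2 * e - n) Z))))
    + \<gamma> 2 * (of_int (i - j) * L (i + j - 1 - e) Z)"
      unfolding N N' by (simp only:)
  qed
qed

text \<open>For \<open>e = 0\<close> and zero mode 0, \<open>\<Lambda>_Y\<close> sends each iterate
  to the next, so the coefficients evolve as under multiplication of a polynomial in one variable
  \<open>X\<close> by \<open>X + x\<close>.\<close>

lemma y_coeff_Lambda_Y_shift_step:
  assumes ze: "z = 0" "e = 0"
    and G: "y_coeff G = (\<lambda>c. coeff_const a0 * v 0 F c + coeff_const a1 * v 1 F c + coeff_const a2 * v 2 F c)"
  shows "y_coeff (Lambda_Y_shift x G) = (\<lambda>c. coeff_const (x * a0) * v 0 F c + coeff_const (a0 + x * a1) * v 1 F c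
    + coeff_const (a1 + x * a2) * v 2 F c + coeff_const a2 * v 3 F c)"
proof
  fix i
  have step: "step w i = Lambda_coeff 0 w i" for w unfolding step_eq_Lambda_coeff using ze by simp
  have f: "fin_family (\<lambda>c. coeff_const a * v l F c)" for a l
    by (rule fin_family_map[OF fin_v[of l F]]) auto
  have K: "coeff_const a \<in> range coeff_const" for a :: "'v coeff" by blast
  have "Lambda_coeff 0 (y_coeff G) i = coeff_const a0 * step (v 0 F) i + coeff_const a1 * step (v 1 F) i + coeff_const a2 * step (v 2 F) i"
    unfolding step[symmetric] G
    by (subst step_add[OF fin_family_add[OF f f] f], subst step_add[OF f f])
       (simp only: step_scale[OF K fin_v])
  also have "\<dots> = coeff_const a0 * v 1 F i + coeff_const a1 * v 2 F i + coeff_const a2 * v 3 F i"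
    using step_v[of 1 F] step_v[of 2 F] step_v0[OF ze(2), of F i] by (simp add: eval_nat_numeral)
  finally show "y_coeff (Lambda_Y_shift x G) i = coeff_const (x * a0) * v 0 F i + coeff_const (a0 + x * a1) * v 1 F i
    + coeff_const (a1 + x * a2) * v 2 F i + coeff_const a2 * v 3 F i"
    unfolding y_coeff_Lambda_Y_shift G by (simp add: coeff_const_add coeff_const_mult algebra_simps)
qed

end

text \<open>The elementary symmetric polynomials: the coefficient of \<open>X ^ l\<close> in the
  product of the \<open>X + u i\<close>.\<close>

definition constellation_coeff :: "nat \<Rightarrow> (nat \<Rightarrow> 'v coeff) \<Rightarrow> nat \<Rightarrow> 'v coeff" where
  "constellation_coeff k u l = (if k = 1 then (if l = 0 then u 1 else if l = 1 then 1 else 0)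
    else if k = 2 then (if l = 0 then u 1 * u 2 else if l = 1 then u 1 + u 2 else if l = 2 then 1 else 0)
    else (if l = 0 then u 1 * u 2 * u 3 else if l = 1 then u 1 * u 2 + u 1 * u 3 + u 2 * u 3
      else if l = 2 then u 1 + u 2 + u 3 else if l = 3 then 1 else 0))"

section \<open>The two families of models\<close>

lemma M_op_y_coeff:
  "M_op k m u i F = y_coeff (((Y_plus \<circ> Lambda_Y_prod k u) ^^ m) (Poly_Mapping.single 0 (b_unit * F))) (int i)"
  by (simp add: M_op_def y_coeff_def b_unit_def)

lemma M_op_I:
  fixes u :: "nat \<Rightarrow> 'v coeff"
  assumes k: "k \<in> {1, 2, 3}" and i: "1 \<le> i"
  shows "M_op k 1 u i F = b_unit * (\<Sum>l\<le>3. coeff_const (constellation_coeff k u l) * model.v 0 0 l F (int i - 1))"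
proof -
  \<comment> \<open>The iterates depend on the zero mode and on the shift only; the two functions
    are placeholders.\<close>
  interpret model "0 :: 'v coeff" 0 "\<lambda>l. 0" "\<lambda>l. 1" by unfold_locales auto
  let ?F = "b_unit * F"
  have 0: "y_coeff (Poly_Mapping.single 0 ?F) = (\<lambda>c. coeff_const 1 * v 0 ?F c + coeff_const 0 * v 1 ?F c + coeff_const 0 * v 2 ?F c)"
    by (auto simp: fun_eq_iff y_coeff_single v_def)
  have y1: "y_coeff (Lambda_Y_shift x (Poly_Mapping.single 0 ?F)) = (\<lambda>c. coeff_const x * v 0 ?F c + coeff_const 1 * v 1 ?F c + coeff_const 0 * v 2 ?F c)"
    for x using y_coeff_Lambda_Y_shift_step[OF refl refl 0, of x] by simp
  have y2: "y_coeff (Lambda_Y_shift y (Lambda_Y_shift x (Poly_Mapping.single 0 ?F))) =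
    (\<lambda>c. coeff_const (y * x) * v 0 ?F c + coeff_const (x + y) * v 1 ?F c + coeff_const 1 * v 2 ?F c)"
    for x y using y_coeff_Lambda_Y_shift_step[OF refl refl y1[of x], of y] by simp
  have y3: "y_coeff (Lambda_Y_shift w (Lambda_Y_shift y (Lambda_Y_shift x (Poly_Mapping.single 0 ?F)))) =
    (\<lambda>c. coeff_const (w * (y * x)) * v 0 ?F c + coeff_const (y * x + w * (x + y)) * v 1 ?F c + coeff_const (x + y + w) * v 2 ?F c + coeff_const 1 * v 3 ?F c)"
    for x y w using y_coeff_Lambda_Y_shift_step[OF refl refl y2[of y x], of w] by simp
  have M: "M_op k 1 u i F = y_coeff (Lambda_Y_prod k u (Poly_Mapping.single 0 ?F)) (int i - 1)"
    by (simp add: M_op_y_coeff y_coeff_Y_plus)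
  have S: "(\<Sum>l\<le>3. f l) = f 0 + f 1 + f 2 + f 3" for f :: "nat \<Rightarrow> 'v ppoly"
    by (simp add: eval_nat_numeral)
  from k consider "k = 1" | "k = 2" | "k = 3" by auto
  then have "M_op k 1 u i F = (\<Sum>l\<le>3. coeff_const (constellation_coeff k u l) * v l ?F (int i - 1))"
  proof cases
    case 1
    have "Lambda_Y_prod 1 u G = Lambda_Y_shift (u 1) G" for G by (simp add: Lambda_Y_prod_def)
    then show ?thesis unfolding M S unfolding 1 by (simp add: y1 constellation_coeff_def)
  next
    case 2
    have "Lambda_Y_prod 2 u G = Lambda_Y_shift (u 1) (Lambda_Y_shift (u 2) G)" for G
      by (simp add: Lambda_Y_prod_def upt_rec numeral_2_eq_2)
    then show ?thesis unfolding M S unfolding 2 by (simp add: y2 constellation_coeff_def add.commute)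
  next
    case 3
    have "Lambda_Y_prod 3 u G = Lambda_Y_shift (u 1) (Lambda_Y_shift (u 2) (Lambda_Y_shift (u 3) G))" for G
      by (simp add: Lambda_Y_prod_def upt_rec numeral_2_eq_2 numeral_3_eq_3)
    then show ?thesis unfolding M S unfolding 3 by (simp add: y3 constellation_coeff_def) (simp add: distrib_left ac_simps)
  qed
  then show ?thesis unfolding v_b_unit by (simp add: sum_distrib_left mult.left_commute)
qed

text \<open>Each factor \<open>Y_+ (\<Lambda>_Y + u)\<close> is one \<open>step\<close> with
  \<open>e = 1\<close> and zero mode \<open>u\<close>, so no iterates are mixed and
  \<open>M_op 1 m u\<close> is the \<open>m\<close>-th one up to \<open>b_unit\<close>.\<close>

lemma M_op_II:
  fixes u :: "nat \<Rightarrow> 'v coeff"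
  assumes m: "m \<in> {1..3}" and i: "1 \<le> i"
  shows "M_op 1 m u i F = b_unit * (\<Sum>l\<le>3. coeff_const (if l = m then 1 else 0) * model.v (u 1) 1 l F (int i - 1))"
proof -
  obtain z where z: "u 1 = z" by simp
  interpret model z 1 "\<lambda>l. 0" "\<lambda>l. 1" by unfold_locales auto
  let ?F = "b_unit * F"
  have prod: "Lambda_Y_prod 1 u G = Lambda_Y_shift z G" for G
    using z by (simp add: Lambda_Y_prod_def)
  have step: "y_coeff (Y_plus (Lambda_Y_shift z G)) c = Lambda_coeff z (y_coeff G) (c - 1)" for G c
    unfolding y_coeff_Y_plus y_coeff_Lambda_Y_shift Lambda_coeff_shift[OF fin_y_coeff, of z] ..
  have v1: "y_coeff (Y_plus (Lambda_Y_shift z (Poly_Mapping.single 0 ?F))) = (\<lambda>c. v 1 ?F (c - 1))"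
  proof
    fix c
    have "Sum_any (\<lambda>a. current z (c - 1 - a) (if a = 0 then ?F else 0)) = current z (c - 1) ?F"
      by (subst Sum_any.expand_superset[of "{0}"]) auto
    then show "y_coeff (Y_plus (Lambda_Y_shift z (Poly_Mapping.single 0 ?F))) c = v 1 ?F (c - 1)"
      unfolding step Lambda_coeff_def y_coeff_single by (simp add: v_def v1_def)
  qed
  have next_v: "y_coeff (Y_plus (Lambda_Y_shift z G)) = (\<lambda>c. v (Suc l) ?F (c - 1))"
    if "y_coeff G = (\<lambda>c. v l ?F (c - 1))" "1 \<le> l" "l \<le> 2" for G l
    unfolding fun_eq_iff step that(1) step_v[OF that(2,3), symmetric] step_eq_Lambda_coeff by simp
  let ?A = "Y_plus \<circ> Lambda_Y_prod 1 u"
  have y1: "y_coeff ((?A ^^ 1) (Poly_Mapping.single 0 ?F)) = (\<lambda>c. v 1 ?F (c - 1))"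
    using v1 by (simp add: prod[unfolded One_nat_def])
  have y2: "y_coeff ((?A ^^ 2) (Poly_Mapping.single 0 ?F)) = (\<lambda>c. v 2 ?F (c - 1))"
    using next_v[OF y1] by (simp add: prod[unfolded One_nat_def] numeral_2_eq_2)
  have y3: "y_coeff ((?A ^^ 3) (Poly_Mapping.single 0 ?F)) = (\<lambda>c. v 3 ?F (c - 1))"
    using next_v[OF y2] by (simp add: prod[unfolded One_nat_def] numeral_2_eq_2 numeral_3_eq_3)
  have "m = 1 \<or> m = 2 \<or> m = 3" using m by auto
  then have "M_op 1 m u i F = v m ?F (int i - 1)"
    unfolding M_op_y_coeff using y1 y2 y3 by auto
  also have "\<dots> = b_unit * (\<Sum>l\<le>3. coeff_const (if l = m then 1 else 0) * v l F (int i - 1))"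
  proof -
    have "(\<Sum>l\<le>3. coeff_const (if l = m then 1 else 0) * v l F (int i - 1)) = (\<Sum>l\<le>3. if l = m then v m F (int i - 1) else 0)"
      by (intro sum.cong) auto
    then show ?thesis using m by (simp add: v_b_unit)
  qed
  finally show ?thesis unfolding z .
qed

theorem theorem2:
  fixes k d :: nat and u q :: "nat \<Rightarrow> 'v coeff"
    and L :: "int \<Rightarrow> 'v ppoly fps \<Rightarrow> 'v ppoly fps"
  assumes family: "family_I k d u q \<or> family_II k d u q"
    and L: "L = L_op k d u q"
  shows
    "(\<exists>M. \<forall>i\<ge>1. M i \<in> t_polynomials weyl_inf \<and>
        (\<forall>Z. - L i Z = of_int i * coeffwise (p_deriv (nat i)) Z - fps_X ^ 1 * M i Z)) \<and>
     (\<exists>!\<tau>. evolution k d u q \<tau>) \<and>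
     (\<forall>\<tau>. evolution k d u q \<tau> \<longrightarrow>
        (\<forall>i\<ge>1. L i \<tau> = 0) \<and> (\<forall>Z. constraints k d u q Z \<longleftrightarrow> Z = \<tau>)) \<and>
     (\<exists>D. \<forall>i\<ge>1. \<forall>j\<ge>1.
        (\<forall>l\<ge>1. D i j l \<in> t_polynomials weyl) \<and>
        (\<forall>Z. (\<forall>n. finite {l. l \<ge> 1 \<and> fps_nth (D i j l (L l Z)) n \<noteq> 0}) \<and>
           commutator (L i) (L j) Z = fps_X * fps_sum (\<lambda>l. D i j l (L l Z)) {1..})) \<and>
     (family_I k d u q \<and> k = 1 \<longrightarrow>
        (\<forall>i\<ge>1. \<forall>j\<ge>1. \<forall>Z. commutator (L i) (L j) Z = 0)) \<and>
     (family_I k d u q \<and> k = 2 \<longrightarrow>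
        (\<forall>i\<ge>1. \<forall>j\<ge>1. \<forall>Z.
           commutator (L i) (L j) Z = fps_X * of_int (i - j) * L (i + j - 1) Z)) \<and>
     (family_I k d u q \<and> k = 3 \<longrightarrow>
        (\<forall>i\<ge>1. \<forall>j\<ge>1. \<forall>\<mu> M. \<mu> = min i j \<longrightarrow> M = max i j \<longrightarrow> (\<forall>Z.
           commutator (L i) (L j) Z =
             2 * fps_X * of_int (i - j) * fps_sum (\<lambda>n. p_mult n (L (i + j + n - 1) Z)) {1..}
           + fps_X * b_fps * of_int (i - j) * of_int (i + j - 2) * L (i + j - 1) Z
           + (1 + b_fps) * fps_X *
               (3 * of_int (i - j) * (\<Sum>n=1..\<mu> - 1. p_star n (L (i + j - 1 - n) Z))
                + of_int (sgn (i - j)) *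
                  (\<Sum>n=\<mu>..M - 1. of_int (2 * M - 2 * n - \<mu> - 1) * p_star n (L (i + j - 1 - n) Z)))
           + fps_X * coeff_fps (u 1 + u 2 + u 3) * of_int (i - j) * L (i + j - 1) Z))) \<and>
     (family_II k d u q \<longrightarrow>
        (\<forall>i\<ge>1. \<forall>j\<ge>1. \<forall>\<mu> M. \<mu> = min i j \<longrightarrow> M = max i j \<longrightarrow> (\<forall>Z.
           commutator (L i) (L j) Z =
             2 * fps_X ^ 3 * coeff_fps (q 3) * of_int (i - j) *
               fps_sum (\<lambda>n. p_mult n (L (i + j + n - 3) Z)) {1..}
           + fps_X ^ 3 * coeff_fps (q 3) * b_fps * of_int (i - j) * of_int (i + j - 3) *
               L (i + j - 3) Z
           + (1 + b_fps) * fps_X ^ 3 * coeff_fps (q 3) *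
               (3 * of_int (i - j) * (\<Sum>n=1..\<mu> - 2. p_star n (L (i + j - 3 - n) Z))
                + of_int (sgn (i - j)) *
                  (\<Sum>n=\<mu> - 1..M - 2. of_int (2 * M - 2 * n - \<mu> - 3) * p_star n (L (i + j - 3 - n) Z)))
           + fps_X ^ 3 * coeff_fps (q 3) * coeff_fps (u 1) * of_int (u_factor i j) *
               L (i + j - 3) Z
           + fps_X ^ 2 * coeff_fps (q 2) * of_int (i - j) * L (i + j - 2) Z)))"
  using family
proof
  assume fam: "family_I k d u q"
  then have k: "k \<in> {1, 2, 3}" and d: "d = 1" and q: "q 1 = 1" by (auto simp: family_I_def)
  interpret I: model "0 :: 'v coeff" 0 "constellation_coeff k u" "\<lambda>l. 1" by unfold_locales auto
  have M: "M_op k m u i F = b_unit * (\<Sum>l\<le>3. coeff_const (constellation_coeff k u l) * I.v l F (int i - 1))"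
    if "m \<in> {1..d}" "1 \<le> i" for m i F
    using M_op_I[OF k that(2), of u F] that(1) d by simp
  have \<gamma>: "I.\<gamma> l = coeff_fps (constellation_coeff k u l) * fps_X" for l
    unfolding I.\<gamma>_def by simp
  have LL: "L_op k d u q = I.L"
  proof (rule I.L_op_eq_L[where h = "\<lambda>m. constellation_coeff k u"])
    show "I.\<gamma> l = (\<Sum>m\<in>{1..d}. coeff_fps (q m * constellation_coeff k u l) * fps_X ^ m)" for l
      unfolding \<gamma> using d q by simp
  qed (rule M)
  have II: "\<not> family_II k d u q" using d by (auto simp: family_II_def)
  have IL: "I.L = L" using L LL by simp
  have "constellation_coeff k u l \<noteq> 0 \<Longrightarrow> int m = 1 + (if l = 0 then 0 else (int l - 1) * 0)" if "m \<in> {1..d}" for m l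
    using that d by simp
  note parts = I.model_theorem[where h = "\<lambda>m. constellation_coeff k u", OF LL M this, unfolded IL]
  have c0: "coeff_fps 0 = (0 :: 'v ppoly fps)" and c1: "coeff_fps 1 = (1 :: 'v ppoly fps)"
    by (simp_all add: coeff_fps_def)
  note br = I.bracket[unfolded IL]
  have k1: "commutator (L i) (L j) Z = 0" if "k = 1" "1 \<le> i" "1 \<le> j" for i j Z
  proof -
    have g: "I.\<gamma> 3 = 0" "I.\<gamma> 2 = 0"
      unfolding \<gamma> using that(1) by (simp_all add: constellation_coeff_def c0)
    show ?thesis unfolding br[OF that(2,3)] g by simp
  qed
  have k2: "commutator (L i) (L j) Z = fps_X * of_int (i - j) * L (i + j - 1) Z" if "k = 2" "1 \<le> i" "1 \<le> j" for i j Z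
  proof -
    have g: "I.\<gamma> 3 = 0" "I.\<gamma> 2 = fps_X"
      unfolding \<gamma> using that(1) by (simp_all add: constellation_coeff_def c0 c1)
    show ?thesis unfolding br[OF that(2,3)] g diff_zero mult_zero_left add_0 by (simp only: mult.assoc)
  qed
  have k3: "commutator (L i) (L j) Z =
             2 * fps_X * of_int (i - j) * fps_sum (\<lambda>n. p_mult n (L (i + j + n - 1) Z)) {1..}
           + fps_X * b_fps * of_int (i - j) * of_int (i + j - 2) * L (i + j - 1) Z
           + (1 + b_fps) * fps_X *
               (3 * of_int (i - j) * (\<Sum>n=1..min i j - 1. p_star n (L (i + j - 1 - n) Z))
                + of_int (sgn (i - j)) *
                  (\<Sum>n=min i j..max i j - 1. of_int (2 * max i j - 2 * n - min i j - 1) * p_star n (L (i + j - 1 - n) Z)))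
           + fps_X * coeff_fps (u 1 + u 2 + u 3) * of_int (i - j) * L (i + j - 1) Z"
    if "k = 3" "1 \<le> i" "1 \<le> j" for i j Z
  proof -
    have g: "I.\<gamma> 3 = fps_X" "I.\<gamma> 2 = coeff_fps (u 1 + u 2 + u 3) * fps_X"
      unfolding \<gamma> using that(1) by (simp_all add: constellation_coeff_def c1)
    have ring: "x * (2 * a * f + c * a * a' * y + s * w) + U * x * (a * y) =
        2 * x * a * f + x * c * a * a' * y + s * x * w + x * U * a * y"
      for x a f c a' y s w U :: "'v ppoly fps"
      by (simp add: algebra_simps)
    show ?thesis
      unfolding br[OF that(2,3)] g c0 diff_zero mult_zero_right mult_zero_left add_0_right
      by (rule ring)
  qed
  show ?thesis
    apply (intro conjI)
    subgoal by (rule parts[THEN conjunct1])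
    subgoal by (rule parts[THEN conjunct2, THEN conjunct1])
    subgoal by (rule parts[THEN conjunct2, THEN conjunct2, THEN conjunct1])
    subgoal by (rule parts[THEN conjunct2, THEN conjunct2, THEN conjunct2])
    subgoal by (intro impI allI, elim conjE, rule k1)
    subgoal by (intro impI allI, elim conjE, rule k2)
    subgoal by (intro impI allI, elim conjE, hypsubst, rule k3)
    subgoal using II by blast
    done
next
  assume fam: "family_II k d u q"
  then have k: "k = 1" and d: "d = 3" by (auto simp: family_II_def)
  let ?h = "\<lambda>m l :: nat. if l = m then 1 else 0 :: 'v coeff"
  \<comment> \<open>Here \<open>u\<close> enters through the zero mode, so the constant term has
    coefficient 0, and \<open>v l\<close> carries \<open>q l * t ^ l\<close>.\<close>
  interpret I: model "u 1" 1 "\<lambda>l. if l = 0 then 0 else q l" "\<lambda>l. if l = 0 then 1 else l"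
    by unfold_locales auto
  have M: "M_op k m u i F = b_unit * (\<Sum>l\<le>3. coeff_const (?h m l) * I.v l F (int i - 1))"
    if "m \<in> {1..d}" "1 \<le> i" for m i F
    unfolding k by (rule M_op_II) (use that d in auto)
  have \<gamma>: "I.\<gamma> l = (if l = 0 then 0 else coeff_fps (q l) * fps_X ^ l)" for l
    unfolding I.\<gamma>_def by (simp add: coeff_fps_def)
  have LL: "L_op k d u q = I.L"
  proof (rule I.L_op_eq_L[where h = ?h])
    show "I.\<gamma> l = (\<Sum>m\<in>{1..d}. coeff_fps (q m * ?h m l) * fps_X ^ m)" if "l \<le> 3" for l
    proof -
      have "(\<Sum>m\<in>{1..d}. coeff_fps (q m * ?h m l) * fps_X ^ m) = (\<Sum>m\<in>{1..d}. if m = l then coeff_fps (q l) * fps_X ^ l else 0)"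
        by (intro sum.cong refl) (auto simp: coeff_fps_def)
      then show ?thesis unfolding \<gamma> using that d by simp
    qed
  qed (rule M)
  have I: "\<not> family_I k d u q" using d by (auto simp: family_I_def)
  have IL: "I.L = L" using L LL by simp
  have "?h m l \<noteq> 0 \<Longrightarrow> int m = 1 + (if l = 0 then 0 else (int l - 1) * 1)" if "m \<in> {1..d}" for m l
    using that by (auto split: if_splits)
  note parts = I.model_theorem[where h = ?h, OF LL M this, unfolded IL]
  have bracket: "commutator (L i) (L j) Z =
             2 * fps_X ^ 3 * coeff_fps (q 3) * of_int (i - j) *
               fps_sum (\<lambda>n. p_mult n (L (i + j + n - 3) Z)) {1..}
           + fps_X ^ 3 * coeff_fps (q 3) * b_fps * of_int (i - j) * of_int (i + j - 3) *
               L (i + j - 3) Z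
           + (1 + b_fps) * fps_X ^ 3 * coeff_fps (q 3) *
               (3 * of_int (i - j) * (\<Sum>n=1..min i j - 2. p_star n (L (i + j - 3 - n) Z))
                + of_int (sgn (i - j)) *
                  (\<Sum>n=min i j - 1..max i j - 2. of_int (2 * max i j - 2 * n - min i j - 3) * p_star n (L (i + j - 3 - n) Z)))
           + fps_X ^ 3 * coeff_fps (q 3) * coeff_fps (u 1) * of_int (u_factor i j) *
               L (i + j - 3) Z
           + fps_X ^ 2 * coeff_fps (q 2) * of_int (i - j) * L (i + j - 2) Z"
    if ij: "1 \<le> i" "1 \<le> j" for i j Z
  proof -
    have g: "I.\<gamma> 3 = coeff_fps (q 3) * fps_X ^ 3" "I.\<gamma> 2 = coeff_fps (q 2) * fps_X ^ 2"
      unfolding \<gamma> by simp_all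
    \<comment> \<open>The case distinction in \<open>u_factor\<close> is that of the thresholds
      \<open>m \<le> i - e\<close> and \<open>m \<le> j - e\<close> at \<open>m = 0\<close>: if
      \<open>min i j = 1\<close>, the smaller index fails its threshold, and only the branch of the
      larger one can contribute.\<close>
    have t: "I.structure_coeff (i - 1) (j - 1) 0 = u_factor i j"
      unfolding I.structure_coeff_def u_factor_def using ij by (auto simp: min_def max_def sgn_if)
    have n: "x - 1 - 2 * 1 = x - 3" "x - 1 - 1 = x - 2" "x - 2 - 1 = x - 3" "x - 1 - 2 * 1 - y = x - 3 - y" for x y :: int
      by auto
    have ring: "(x3 * x) * (2 * a * f + c * a * a' * y + k * w * y + s * h) + (x2 * x') * (a * y') =
        2 * x * x3 * a * f + x * x3 * c * a * a' * y + s * x * x3 * h + x * x3 * w * k * y + x' * x2 * a * y'"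
      for x x' x2 x3 a a' c f y y' k w s h :: "'v ppoly fps"
      by (simp add: algebra_simps)
    show ?thesis
      unfolding I.bracket[unfolded IL, OF ij] g t n by (rule ring)
  qed
  show ?thesis
    apply (intro conjI)
    subgoal by (rule parts[THEN conjunct1])
    subgoal by (rule parts[THEN conjunct2, THEN conjunct1])
    subgoal by (rule parts[THEN conjunct2, THEN conjunct2, THEN conjunct1])
    subgoal by (rule parts[THEN conjunct2, THEN conjunct2, THEN conjunct2])
    subgoal using I by blast
    subgoal using I by blast
    subgoal using I by blast
    subgoal by (intro impI allI, hypsubst, rule bracket)
    done
qed

end
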